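(* Let $(\mathcal C,\circ,I,\sigma)$ be a symmetric monoidal category. Assume that $\mathcal C$ has, and $\circ$ preserves, binary intersections. Then the category $\mathrm{Hopf}_{\mathrm{coc}}(\mathcal C)$ of cocommutative Hopf monoids in $\mathcal C$ is protomodular.
   Context: A binary intersection is a pullback of two monomorphisms with common codomain; "$\circ$ preserves binary intersections" means that all the functors $X\circ(-)$ and $(-)\circ X$ preserve them. $\mathrm{Hopf}_{\mathrm{coc}}(\mathcal C)$ has as objects the Hopf monoids (bimonoids with antipode) in $(\mathcal C,\circ,I,\sigma)$ with $\sigma_{H,H}\Delta_H=\Delta_H$, and as morphisms the bimonoid morphisms. Protomodular: a category with pullbacks of split epimorphisms along any morphism, such that all inverse image (change-of-base) functors of the fibration of points (split epimorphisms with chosen section, mapped to their codomain) reflect isomorphisms. *)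

theory Defs
  imports Main
begin

section \<open>Categories\<close>

text \<open>A category has a set of objects and a set of arrows inside ambient types.
  Composition is in applicative order and is meaningful only for composable arrows;
  \<open>Cmp\<close> is unspecified elsewhere.\<close>

record ('o, 'a) cat =
  Obj :: "'o set"
  Arr :: "'a set"
  Dom :: "'a \<Rightarrow> 'o"
  Cod :: "'a \<Rightarrow> 'o"
  Ide :: "'o \<Rightarrow> 'a"
  Cmp :: "'a \<Rightarrow> 'a \<Rightarrow> 'a"  (infixr "\<cdot>\<index>" 65)

definition hom :: "('o, 'a, 'm) cat_scheme \<Rightarrow> 'o \<Rightarrow> 'o \<Rightarrow> 'a set" where
  "hom C A B = {f \<in> Arr C. Dom C f = A \<and> Cod C f = B}"

locale category =
  fixes C :: "('o, 'a, 'm) cat_scheme" (structure)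
  assumes Dom_Obj: "f \<in> Arr C \<Longrightarrow> Dom C f \<in> Obj C"
    and Cod_Obj: "f \<in> Arr C \<Longrightarrow> Cod C f \<in> Obj C"
    and Ide_hom: "A \<in> Obj C \<Longrightarrow> Ide C A \<in> hom C A A"
    and Cmp_hom: "f \<in> hom C A B \<Longrightarrow> g \<in> hom C B D \<Longrightarrow> g \<cdot> f \<in> hom C A D"
    and Cmp_Ide: "f \<in> hom C A B \<Longrightarrow> f \<cdot> Ide C A = f"
    and Ide_Cmp: "f \<in> hom C A B \<Longrightarrow> Ide C B \<cdot> f = f"
    and Cmp_assoc: "f \<in> hom C A B \<Longrightarrow> g \<in> hom C B D \<Longrightarrow> h \<in> hom C D E
      \<Longrightarrow> (h \<cdot> g) \<cdot> f = h \<cdot> (g \<cdot> f)"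

context
  fixes C :: "('o, 'a, 'm) cat_scheme" (structure)
begin

definition inverse_arrows :: "'a \<Rightarrow> 'a \<Rightarrow> bool" where
  "inverse_arrows f g \<longleftrightarrow> f \<in> Arr C \<and> g \<in> hom C (Cod C f) (Dom C f) \<and>
     g \<cdot> f = Ide C (Dom C f) \<and> f \<cdot> g = Ide C (Cod C f)"

definition iso :: "'a \<Rightarrow> bool" where
  "iso f \<longleftrightarrow> (\<exists>g. inverse_arrows f g)"

definition inv_arrow :: "'a \<Rightarrow> 'a" where
  "inv_arrow f = (THE g. inverse_arrows f g)"

definition monic :: "'a \<Rightarrow> bool" where
  "monic m \<longleftrightarrow> m \<in> Arr C \<and>
     (\<forall>T. \<forall>g \<in> hom C T (Dom C m). \<forall>h \<in> hom C T (Dom C m). m \<cdot> g = m \<cdot> h \<longrightarrow> g = h)"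

definition split_epi :: "'a \<Rightarrow> bool" where
  "split_epi p \<longleftrightarrow> p \<in> Arr C \<and> (\<exists>s \<in> hom C (Cod C p) (Dom C p). p \<cdot> s = Ide C (Cod C p))"

text \<open>\<open>pullback f g p q\<close>: the arrows \<open>p\<close>, \<open>q\<close> out of a common object are the projections,
  to \<open>Dom f\<close> and \<open>Dom g\<close> respectively, of a pullback of \<open>f\<close> and \<open>g\<close>.\<close>

definition pullback :: "'a \<Rightarrow> 'a \<Rightarrow> 'a \<Rightarrow> 'a \<Rightarrow> bool" where
  "pullback f g p q \<longleftrightarrow>
     f \<in> Arr C \<and> g \<in> Arr C \<and> Cod C f = Cod C g \<and>
     p \<in> hom C (Dom C p) (Dom C f) \<and> q \<in> hom C (Dom C p) (Dom C g) \<and>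
     f \<cdot> p = g \<cdot> q \<and>
     (\<forall>T. \<forall>u \<in> hom C T (Dom C f). \<forall>v \<in> hom C T (Dom C g). f \<cdot> u = g \<cdot> v \<longrightarrow>
        (\<exists>!k. k \<in> hom C T (Dom C p) \<and> p \<cdot> k = u \<and> q \<cdot> k = v))"

text \<open>The arrow induced by \<open>u\<close>, \<open>v\<close> into the pullback with projections \<open>p\<close>, \<open>q\<close>.\<close>

definition induced :: "'a \<Rightarrow> 'a \<Rightarrow> 'a \<Rightarrow> 'a \<Rightarrow> 'a" where
  "induced p q u v = (THE k. k \<in> hom C (Dom C u) (Dom C p) \<and> p \<cdot> k = u \<and> q \<cdot> k = v)"

definition binary_intersection :: "'a \<Rightarrow> 'a \<Rightarrow> 'a \<Rightarrow> 'a \<Rightarrow> bool" where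
  "binary_intersection m n p q \<longleftrightarrow> monic m \<and> monic n \<and> pullback m n p q"

definition has_binary_intersections :: bool where
  "has_binary_intersections \<longleftrightarrow>
     (\<forall>m n. monic m \<and> monic n \<and> Cod C m = Cod C n \<longrightarrow> (\<exists>p q. binary_intersection m n p q))"

definition has_pullbacks_of_split_epis :: bool where
  "has_pullbacks_of_split_epis \<longleftrightarrow>
     (\<forall>f \<in> Arr C. \<forall>e. split_epi e \<and> Cod C e = Cod C f \<longrightarrow> (\<exists>p q. pullback f e p q))"

end

record ('o, 'a, 'p, 'b) fctr =
  FObj :: "'o \<Rightarrow> 'p"
  FArr :: "'a \<Rightarrow> 'b"

definition preserves_binary_intersections ::
  "('o, 'a, 'm) cat_scheme \<Rightarrow> ('p, 'b, 'n) cat_scheme \<Rightarrow> ('o, 'a, 'p, 'b) fctr \<Rightarrow> bool" where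
  "preserves_binary_intersections C D F \<longleftrightarrow>
     (\<forall>m n p q. binary_intersection C m n p q \<longrightarrow>
        binary_intersection D (FArr F m) (FArr F n) (FArr F p) (FArr F q))"

definition reflects_isos ::
  "('o, 'a, 'm) cat_scheme \<Rightarrow> ('p, 'b, 'n) cat_scheme \<Rightarrow> ('o, 'a, 'p, 'b) fctr \<Rightarrow> bool" where
  "reflects_isos C D F \<longleftrightarrow> (\<forall>a \<in> Arr C. iso D (FArr F a) \<longrightarrow> iso C a)"


section \<open>Points and protomodularity\<close>

text \<open>A point over \<open>B\<close> is a pair \<open>(p, s)\<close> of an arrow \<open>p\<close> into \<open>B\<close> and a section \<open>s\<close> of it.
  An arrow of points carries its source and target, since the same arrow of \<open>C\<close> can
  underlie several arrows of points. \<open>points C B\<close> is the fibre over \<open>B\<close> of the fibration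
  of points.\<close>

definition points ::
  "('o, 'a, 'm) cat_scheme \<Rightarrow> 'o \<Rightarrow> ('a \<times> 'a, ('a \<times> 'a) \<times> 'a \<times> ('a \<times> 'a)) cat" where
  "points C B =
    (let P = {(p, s). p \<in> Arr C \<and> Cod C p = B \<and> s \<in> hom C B (Dom C p) \<and> p \<cdot>\<^bsub>C\<^esub> s = Ide C B} in
     \<lparr> Obj = P,
       Arr = {((p, s), h, (p', s')) | p s h p' s'. (p, s) \<in> P \<and> (p', s') \<in> P \<and>
                h \<in> hom C (Dom C p) (Dom C p') \<and> p' \<cdot>\<^bsub>C\<^esub> h = p \<and> h \<cdot>\<^bsub>C\<^esub> s = s'},
       Dom = (\<lambda>(X, h, Y). X),
       Cod = (\<lambda>(X, h, Y). Y),
       Ide = (\<lambda>(p, s). ((p, s), Ide C (Dom C p), (p, s))),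
       Cmp = (\<lambda>(Y, k, Z) (X, h, Y'). (X, k \<cdot>\<^bsub>C\<^esub> h, Z)) \<rparr>)"

text \<open>A cleavage of the fibration of points: a choice \<open>\<kappa> f X\<close> of the two projections of a
  pullback along \<open>f\<close> of every point \<open>X\<close> over \<open>Cod f\<close>.\<close>

definition point_cleavage ::
  "('o, 'a, 'm) cat_scheme \<Rightarrow> ('a \<Rightarrow> 'a \<times> 'a \<Rightarrow> 'a \<times> 'a) \<Rightarrow> bool" where
  "point_cleavage C \<kappa> \<longleftrightarrow>
     (\<forall>f \<in> Arr C. \<forall>(p, s) \<in> Obj (points C (Cod C f)).
        pullback C f p (fst (\<kappa> f (p, s))) (snd (\<kappa> f (p, s))))"

text \<open>The pullback \<open>p'\<close> of \<open>p\<close> along \<open>f\<close> is given the section induced by the identity of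
  \<open>Dom f\<close> and \<open>s \<cdot> f\<close>.\<close>

definition pullback_point ::
  "('o, 'a, 'm) cat_scheme \<Rightarrow> ('a \<Rightarrow> 'a \<times> 'a \<Rightarrow> 'a \<times> 'a) \<Rightarrow> 'a \<Rightarrow> 'a \<times> 'a \<Rightarrow> 'a \<times> 'a" where
  "pullback_point C \<kappa> f = (\<lambda>(p, s). case \<kappa> f (p, s) of (p', q) \<Rightarrow>
     (p', induced C p' q (Ide C (Dom C f)) (s \<cdot>\<^bsub>C\<^esub> f)))"

definition inverse_image ::
  "('o, 'a, 'm) cat_scheme \<Rightarrow> ('a \<Rightarrow> 'a \<times> 'a \<Rightarrow> 'a \<times> 'a) \<Rightarrow> 'a \<Rightarrow>
   ('a \<times> 'a, ('a \<times> 'a) \<times> 'a \<times> ('a \<times> 'a), 'a \<times> 'a, ('a \<times> 'a) \<times> 'a \<times> ('a \<times> 'a)) fctr" where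
  "inverse_image C \<kappa> f =
     \<lparr> FObj = pullback_point C \<kappa> f,
       FArr = (\<lambda>(X, h, Y). case (\<kappa> f X, \<kappa> f Y) of ((p, q), (p', q')) \<Rightarrow>
         (pullback_point C \<kappa> f X, induced C p' q' p (h \<cdot>\<^bsub>C\<^esub> q), pullback_point C \<kappa> f Y)) \<rparr>"

text \<open>The inverse image functors are quantified over all cleavages; one exists as soon as
  pullbacks of split epimorphisms do, so this quantification is not vacuous.\<close>

definition protomodular :: "('o, 'a, 'm) cat_scheme \<Rightarrow> bool" where
  "protomodular C \<longleftrightarrow> category C \<and> has_pullbacks_of_split_epis C \<and>
     (\<forall>\<kappa>. point_cleavage C \<kappa> \<longrightarrow>
        (\<forall>f \<in> Arr C.
           reflects_isos (points C (Cod C f)) (points C (Dom C f)) (inverse_image C \<kappa> f)))"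


section \<open>Symmetric monoidal categories\<close>

record ('o, 'a) smcat = "('o, 'a) cat" +
  TObj :: "'o \<Rightarrow> 'o \<Rightarrow> 'o"  (infixr "\<odot>\<index>" 75)
  TArr :: "'a \<Rightarrow> 'a \<Rightarrow> 'a"  (infixr "\<otimes>\<index>" 75)
  Unit :: 'o  ("\<one>\<index>")
  Assoc :: "'o \<Rightarrow> 'o \<Rightarrow> 'o \<Rightarrow> 'a"  ("\<alpha>\<index>")
  LUnit :: "'o \<Rightarrow> 'a"  ("\<ll>\<index>")
  RUnit :: "'o \<Rightarrow> 'a"  ("\<rr>\<index>")
  Sym :: "'o \<Rightarrow> 'o \<Rightarrow> 'a"  ("\<sigma>\<index>")

locale symmetric_monoidal_category =
  category C for C :: "('o, 'a, 'm) smcat_scheme" (structure) +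
  assumes TObj_Obj: "A \<in> Obj C \<Longrightarrow> B \<in> Obj C \<Longrightarrow> A \<odot> B \<in> Obj C"
    and TArr_hom: "f \<in> hom C A B \<Longrightarrow> g \<in> hom C A' B' \<Longrightarrow> f \<otimes> g \<in> hom C (A \<odot> A') (B \<odot> B')"
    and TArr_Ide: "A \<in> Obj C \<Longrightarrow> B \<in> Obj C \<Longrightarrow> Ide C A \<otimes> Ide C B = Ide C (A \<odot> B)"
    and TArr_Cmp: "f \<in> hom C A B \<Longrightarrow> g \<in> hom C B D \<Longrightarrow> f' \<in> hom C A' B' \<Longrightarrow> g' \<in> hom C B' D'
      \<Longrightarrow> (g \<cdot> f) \<otimes> (g' \<cdot> f') = (g \<otimes> g') \<cdot> (f \<otimes> f')"
    and Unit_Obj: "\<one> \<in> Obj C"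
    and Assoc_hom: "A \<in> Obj C \<Longrightarrow> B \<in> Obj C \<Longrightarrow> D \<in> Obj C
      \<Longrightarrow> \<alpha> A B D \<in> hom C ((A \<odot> B) \<odot> D) (A \<odot> (B \<odot> D))"
    and Assoc_iso: "A \<in> Obj C \<Longrightarrow> B \<in> Obj C \<Longrightarrow> D \<in> Obj C \<Longrightarrow> iso C (\<alpha> A B D)"
    and Assoc_natural: "f \<in> hom C A A' \<Longrightarrow> g \<in> hom C B B' \<Longrightarrow> h \<in> hom C D D'
      \<Longrightarrow> \<alpha> A' B' D' \<cdot> ((f \<otimes> g) \<otimes> h) = (f \<otimes> (g \<otimes> h)) \<cdot> \<alpha> A B D"
    and LUnit_hom: "A \<in> Obj C \<Longrightarrow> \<ll> A \<in> hom C (\<one> \<odot> A) A"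
    and LUnit_iso: "A \<in> Obj C \<Longrightarrow> iso C (\<ll> A)"
    and LUnit_natural: "f \<in> hom C A B \<Longrightarrow> \<ll> B \<cdot> (Ide C \<one> \<otimes> f) = f \<cdot> \<ll> A"
    and RUnit_hom: "A \<in> Obj C \<Longrightarrow> \<rr> A \<in> hom C (A \<odot> \<one>) A"
    and RUnit_iso: "A \<in> Obj C \<Longrightarrow> iso C (\<rr> A)"
    and RUnit_natural: "f \<in> hom C A B \<Longrightarrow> \<rr> B \<cdot> (f \<otimes> Ide C \<one>) = f \<cdot> \<rr> A"
    and pentagon: "A \<in> Obj C \<Longrightarrow> B \<in> Obj C \<Longrightarrow> D \<in> Obj C \<Longrightarrow> E \<in> Obj C
      \<Longrightarrow> (Ide C A \<otimes> \<alpha> B D E) \<cdot> \<alpha> A (B \<odot> D) E \<cdot> (\<alpha> A B D \<otimes> Ide C E)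
        = \<alpha> A B (D \<odot> E) \<cdot> \<alpha> (A \<odot> B) D E"
    and triangle: "A \<in> Obj C \<Longrightarrow> B \<in> Obj C
      \<Longrightarrow> (Ide C A \<otimes> \<ll> B) \<cdot> \<alpha> A \<one> B = \<rr> A \<otimes> Ide C B"
    and Sym_hom: "A \<in> Obj C \<Longrightarrow> B \<in> Obj C \<Longrightarrow> \<sigma> A B \<in> hom C (A \<odot> B) (B \<odot> A)"
    and Sym_natural: "f \<in> hom C A A' \<Longrightarrow> g \<in> hom C B B'
      \<Longrightarrow> \<sigma> A' B' \<cdot> (f \<otimes> g) = (g \<otimes> f) \<cdot> \<sigma> A B"
    and Sym_Sym: "A \<in> Obj C \<Longrightarrow> B \<in> Obj C \<Longrightarrow> \<sigma> B A \<cdot> \<sigma> A B = Ide C (A \<odot> B)"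
    and hexagon: "A \<in> Obj C \<Longrightarrow> B \<in> Obj C \<Longrightarrow> D \<in> Obj C
      \<Longrightarrow> \<alpha> B D A \<cdot> \<sigma> A (B \<odot> D) \<cdot> \<alpha> A B D
        = (Ide C B \<otimes> \<sigma> A D) \<cdot> \<alpha> B A D \<cdot> (\<sigma> A B \<otimes> Ide C D)"

definition tensor_left :: "('o, 'a, 'm) smcat_scheme \<Rightarrow> 'o \<Rightarrow> ('o, 'a, 'o, 'a) fctr" where
  "tensor_left C X = \<lparr> FObj = (\<lambda>A. X \<odot>\<^bsub>C\<^esub> A), FArr = (\<lambda>f. Ide C X \<otimes>\<^bsub>C\<^esub> f) \<rparr>"

definition tensor_right :: "('o, 'a, 'm) smcat_scheme \<Rightarrow> 'o \<Rightarrow> ('o, 'a, 'o, 'a) fctr" where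
  "tensor_right C X = \<lparr> FObj = (\<lambda>A. A \<odot>\<^bsub>C\<^esub> X), FArr = (\<lambda>f. f \<otimes>\<^bsub>C\<^esub> Ide C X) \<rparr>"

definition tensor_preserves_binary_intersections :: "('o, 'a, 'm) smcat_scheme \<Rightarrow> bool" where
  "tensor_preserves_binary_intersections C \<longleftrightarrow>
     (\<forall>X \<in> Obj C. preserves_binary_intersections C C (tensor_left C X) \<and>
                  preserves_binary_intersections C C (tensor_right C X))"


section \<open>Hopf monoids\<close>

record ('o, 'a) bimon =
  Car :: 'o
  Mul :: 'a
  Uni :: 'a
  Com :: 'a
  Cou :: 'a

context
  fixes C :: "('o, 'a, 'm) smcat_scheme" (structure)
begin

definition is_monoid :: "'o \<Rightarrow> 'a \<Rightarrow> 'a \<Rightarrow> bool" where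
  "is_monoid A m u \<longleftrightarrow> A \<in> Obj C \<and> m \<in> hom C (A \<odot> A) A \<and> u \<in> hom C \<one> A \<and>
     m \<cdot> (m \<otimes> Ide C A) = m \<cdot> (Ide C A \<otimes> m) \<cdot> \<alpha> A A A \<and>
     m \<cdot> (u \<otimes> Ide C A) = \<ll> A \<and>
     m \<cdot> (Ide C A \<otimes> u) = \<rr> A"

definition is_comonoid :: "'o \<Rightarrow> 'a \<Rightarrow> 'a \<Rightarrow> bool" where
  "is_comonoid A d e \<longleftrightarrow> A \<in> Obj C \<and> d \<in> hom C A (A \<odot> A) \<and> e \<in> hom C A \<one> \<and>
     \<alpha> A A A \<cdot> (d \<otimes> Ide C A) \<cdot> d = (Ide C A \<otimes> d) \<cdot> d \<and>
     \<ll> A \<cdot> (e \<otimes> Ide C A) \<cdot> d = Ide C A \<and>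
     \<rr> A \<cdot> (Ide C A \<otimes> e) \<cdot> d = Ide C A"

text \<open>The arrow \<open>(A \<odot> B) \<odot> (D \<odot> E) \<rightarrow> (A \<odot> D) \<odot> (B \<odot> E)\<close> which is \<open>A \<otimes> \<sigma> B D \<otimes> E\<close> up to
  associativity.\<close>

definition interchange :: "'o \<Rightarrow> 'o \<Rightarrow> 'o \<Rightarrow> 'o \<Rightarrow> 'a" where
  "interchange A B D E =
     inv_arrow C (\<alpha> A D (B \<odot> E)) \<cdot> (Ide C A \<otimes> \<alpha> D B E) \<cdot> (Ide C A \<otimes> (\<sigma> B D \<otimes> Ide C E)) \<cdot>
     (Ide C A \<otimes> inv_arrow C (\<alpha> B D E)) \<cdot> \<alpha> A B (D \<odot> E)"

text \<open>The last four conditions say that comultiplication and counit are monoid morphisms;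
  \<open>\<ll> \<one>\<close> is the canonical isomorphism from \<open>\<one> \<odot> \<one>\<close> to \<open>\<one>\<close>.\<close>

definition is_bimonoid :: "('o, 'a) bimon \<Rightarrow> bool" where
  "is_bimonoid H \<longleftrightarrow>
     is_monoid (Car H) (Mul H) (Uni H) \<and> is_comonoid (Car H) (Com H) (Cou H) \<and>
     Com H \<cdot> Mul H =
       (Mul H \<otimes> Mul H) \<cdot> interchange (Car H) (Car H) (Car H) (Car H) \<cdot> (Com H \<otimes> Com H) \<and>
     Com H \<cdot> Uni H \<cdot> \<ll> \<one> = Uni H \<otimes> Uni H \<and>
     Cou H \<cdot> Mul H = \<ll> \<one> \<cdot> (Cou H \<otimes> Cou H) \<and>
     Cou H \<cdot> Uni H = Ide C \<one>"

definition is_antipode :: "('o, 'a) bimon \<Rightarrow> 'a \<Rightarrow> bool" where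
  "is_antipode H S \<longleftrightarrow> S \<in> hom C (Car H) (Car H) \<and>
     Mul H \<cdot> (S \<otimes> Ide C (Car H)) \<cdot> Com H = Uni H \<cdot> Cou H \<and>
     Mul H \<cdot> (Ide C (Car H) \<otimes> S) \<cdot> Com H = Uni H \<cdot> Cou H"

text \<open>An antipode is unique if it exists, so it is not part of the structure.\<close>

definition is_hopf_monoid :: "('o, 'a) bimon \<Rightarrow> bool" where
  "is_hopf_monoid H \<longleftrightarrow> is_bimonoid H \<and> (\<exists>S. is_antipode H S)"

definition is_cocommutative :: "('o, 'a) bimon \<Rightarrow> bool" where
  "is_cocommutative H \<longleftrightarrow> \<sigma> (Car H) (Car H) \<cdot> Com H = Com H"

definition bimonoid_morphism :: "('o, 'a) bimon \<Rightarrow> ('o, 'a) bimon \<Rightarrow> 'a \<Rightarrow> bool" where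
  "bimonoid_morphism H K f \<longleftrightarrow> f \<in> hom C (Car H) (Car K) \<and>
     f \<cdot> Mul H = Mul K \<cdot> (f \<otimes> f) \<and> f \<cdot> Uni H = Uni K \<and>
     Com K \<cdot> f = (f \<otimes> f) \<cdot> Com H \<and> Cou K \<cdot> f = Cou H"

definition Hopf_coc ::
  "(('o, 'a) bimon, ('o, 'a) bimon \<times> 'a \<times> ('o, 'a) bimon) cat" where
  "Hopf_coc =
     \<lparr> Obj = {H. is_hopf_monoid H \<and> is_cocommutative H},
       Arr = {(H, f, K). is_hopf_monoid H \<and> is_cocommutative H \<and>
                is_hopf_monoid K \<and> is_cocommutative K \<and> bimonoid_morphism H K f},
       Dom = (\<lambda>(H, f, K). H),
       Cod = (\<lambda>(H, f, K). K),
       Ide = (\<lambda>H. (H, Ide C (Car H), H)),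
       Cmp = (\<lambda>(K, g, L) (H, f, K'). (H, g \<cdot> f, L)) \<rparr>"

end

end

theory Submission
  imports Defs
begin

text \<open>Cocommutative Hopf monoids are the group objects in the category of cocommutative comonoids,
  in which the tensor product is the product. The equalizer of two comonoid morphisms is computed in
  \<open>C\<close>, as the intersection of their graphs, so cocommutative comonoids, and hence also the groups in
  them, have pullbacks. For every comonoid \<open>T\<close> the comonoid morphisms from \<open>T\<close> to a Hopf monoid
  form a group under convolution, and these groups turn pullbacks of Hopf monoids into pullbacks of
  groups. Protomodularity then follows from the split short five lemma for groups, applied to these
  generalized elements.\<close>

section \<open>Categories\<close>

text \<open>Two obstacles shape the development. The tensor product is not strict, so products of
  comonoids rest on coherence equations for \<open>interchange\<close>; these are reduced to one map
  \<open>swp\<close>, a symmetry acting in front of a spare right-hand factor. Once they hold,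
  \<open>pr\<close> hides the associators and one calculates with tuples. Moreover the antipode is
  given only as a convolution inverse, and has to be shown to respect comultiplication before
  inverses exist among generalized elements.

  Preservation of intersections enters when an intersection is to carry a comultiplication: laws on
  it are tested after a tensor power of its inclusion, which can be cancelled because whiskered
  intersections are again intersections.

  Kernels are never formed: an element e with p e = 1 is represented by the pair (1, e) in the
  pullback along f, so the five lemma speaks directly about change of base. Since a cleavage is
  arbitrary, each pullback of Hopf monoids must also be recognised as a pullback of
  comonoids.\<close>

context category
begin

abbreviation arr :: "'a \<Rightarrow> bool" where "arr f \<equiv> f \<in> Arr C"

abbreviation idt :: "'o \<Rightarrow> 'a" ("\<iota>") where "\<iota> A \<equiv> Ide C A"

lemma in_hom_iff: "f \<in> hom C A B \<longleftrightarrow> arr f \<and> Dom C f = A \<and> Cod C f = B"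
  by (simp add: hom_def)

declare Dom_Obj [simp] Cod_Obj [simp]

lemma Ide_simps [simp]:
  assumes "A \<in> Obj C"
  shows "arr (\<iota> A)" "Dom C (\<iota> A) = A" "Cod C (\<iota> A) = A"
  using Ide_hom[OF assms] by (auto simp: hom_def)

lemma Cmp_simps [simp]:
  assumes "arr g" "arr f" "Dom C g = Cod C f"
  shows "arr (g \<cdot> f)" "Dom C (g \<cdot> f) = Dom C f" "Cod C (g \<cdot> f) = Cod C g"
  using Cmp_hom[of f "Dom C f" "Cod C f" g "Cod C g"] assms by (auto simp: hom_def)

lemma Cmp_Ide' [simp]: "arr f \<Longrightarrow> Dom C f = A \<Longrightarrow> f \<cdot> \<iota> A = f"
  using Cmp_Ide by (auto simp: hom_def)

lemma Ide_Cmp' [simp]: "arr f \<Longrightarrow> Cod C f = A \<Longrightarrow> \<iota> A \<cdot> f = f"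
  using Ide_Cmp by (auto simp: hom_def)

lemma Cmp_assoc' [simp]:
  "arr f \<Longrightarrow> arr g \<Longrightarrow> arr h \<Longrightarrow> Dom C g = Cod C f \<Longrightarrow> Dom C h = Cod C g
    \<Longrightarrow> (h \<cdot> g) \<cdot> f = h \<cdot> g \<cdot> f"
  using Cmp_assoc[of f "Dom C f" "Cod C f" g "Cod C g" h] by (auto simp: hom_def)

text \<open>Simplification nests composites to the right, which hides an instance of
  \<open>a \<cdot> b\<close> inside a longer composite. Instantiated with an equation, this rule
  (like \<open>reassoc3\<close>) yields its version with a tail \<open>x\<close>, which still
  matches.\<close>

lemma reassoc2:
  "a \<cdot> b = c \<Longrightarrow> arr x \<Longrightarrow> arr a \<Longrightarrow> arr b \<Longrightarrow> Dom C a = Cod C b \<Longrightarrow> Dom C b = Cod C x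
    \<Longrightarrow> a \<cdot> b \<cdot> x = c \<cdot> x"
  by (metis Cmp_assoc')

lemma reassoc3:
  "a \<cdot> b \<cdot> c = d \<Longrightarrow> arr x \<Longrightarrow> arr a \<Longrightarrow> arr b \<Longrightarrow> arr c \<Longrightarrow> Dom C a = Cod C b
    \<Longrightarrow> Dom C b = Cod C c \<Longrightarrow> Dom C c = Cod C x \<Longrightarrow> a \<cdot> b \<cdot> c \<cdot> x = d \<cdot> x"
  by (metis Cmp_assoc' Cmp_simps)

lemma inverse_arrows_unique:
  assumes "inverse_arrows C f g" "inverse_arrows C f g'"
  shows "g = g'"
proof -
  have g: "arr f" "arr g" "arr g'" "Dom C g = Cod C f" "Cod C g = Dom C f"
    "Dom C g' = Cod C f" "Cod C g' = Dom C f"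
    and e: "g \<cdot> f = \<iota> (Dom C f)" "f \<cdot> g' = \<iota> (Cod C f)"
    using assms by (auto simp: inverse_arrows_def hom_def)
  have "g = g \<cdot> f \<cdot> g'"
    using g e by simp
  also have "\<dots> = (g \<cdot> f) \<cdot> g'"
    using g by simp
  also have "\<dots> = g'"
    using g by (simp add: e del: Cmp_assoc')
  finally show ?thesis .
qed

lemma inv_arrow_eq: "inverse_arrows C f g \<Longrightarrow> inv_arrow C f = g"
  unfolding inv_arrow_def using inverse_arrows_unique by blast

lemma iso_inv_arrow: "iso C f \<Longrightarrow> inverse_arrows C f (inv_arrow C f)"
  by (auto simp: iso_def inv_arrow_eq)

lemma inv_arrow_simps:
  assumes "iso C f"
  shows "arr (inv_arrow C f)" "Dom C (inv_arrow C f) = Cod C f" "Cod C (inv_arrow C f) = Dom C f"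
    "inv_arrow C f \<cdot> f = \<iota> (Dom C f)" "f \<cdot> inv_arrow C f = \<iota> (Cod C f)" "arr f"
  using iso_inv_arrow[OF assms] by (auto simp: inverse_arrows_def hom_def)

lemma iso_cancel_right:
  assumes "iso C k" "f \<cdot> k = g \<cdot> k" "arr f" "arr g" "Dom C f = Cod C k" "Dom C g = Cod C k"
  shows "f = g"
proof -
  have "f = (f \<cdot> k) \<cdot> inv_arrow C k"
    using assms(1,3-) by (simp add: inv_arrow_simps)
  also have "\<dots> = (g \<cdot> k) \<cdot> inv_arrow C k"
    using assms(2) by (simp only:)
  also have "\<dots> = g"
    using assms(1,3-) by (simp add: inv_arrow_simps)
  finally show ?thesis .
qed

lemma iso_cancel_left:
  assumes "iso C k" "k \<cdot> f = k \<cdot> g" "arr f" "arr g" "Cod C f = Dom C k" "Cod C g = Dom C k"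
  shows "f = g"
proof -
  have r: "inv_arrow C k \<cdot> k \<cdot> x = x" if "arr x" "Cod C x = Dom C k" for x
    using reassoc2[OF inv_arrow_simps(4)[OF assms(1)], of x] that assms(1)
    by (simp add: inv_arrow_simps)
  from assms(2) have "inv_arrow C k \<cdot> k \<cdot> f = inv_arrow C k \<cdot> k \<cdot> g"
    by simp
  then show ?thesis
    using assms(1,3-) by (simp only: r)
qed

lemma iso_Cmp:
  assumes "iso C f" "iso C g" "Dom C g = Cod C f"
  shows "iso C (g \<cdot> f)"
proof -
  note s [simp] = inv_arrow_simps[OF assms(1)] inv_arrow_simps[OF assms(2)]
  have "inverse_arrows C (g \<cdot> f) (inv_arrow C f \<cdot> inv_arrow C g)"
    using assms(3) by (auto simp: inverse_arrows_def hom_def reassoc2[OF s(4)] reassoc2[OF s(5)]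
      reassoc2[OF s(10)] reassoc2[OF s(11)])
  then show ?thesis
    by (auto simp: iso_def)
qed

lemma pullback_factor:
  assumes "pullback C u v k l" "arr x" "arr y" "Cod C x = Dom C u" "Cod C y = Dom C v" "Dom C x = Dom C y"
    "u \<cdot> x = v \<cdot> y"
  shows "\<exists>h. arr h \<and> Dom C h = Dom C x \<and> Cod C h = Dom C k \<and> k \<cdot> h = x \<and> l \<cdot> h = y"
proof -
  have "x \<in> hom C (Dom C x) (Dom C u)" "y \<in> hom C (Dom C x) (Dom C v)"
    using assms by (auto simp: hom_def)
  then have "\<exists>!h. h \<in> hom C (Dom C x) (Dom C k) \<and> k \<cdot> h = x \<and> l \<cdot> h = y"
    using assms(1,7) unfolding pullback_def by blast
  then show ?thesis
    by (auto simp: hom_def)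
qed

lemma pullback_unique:
  assumes pb: "pullback C u v k l" and h: "arr h" "arr h'" "Cod C h = Dom C k" "Cod C h' = Dom C k" "Dom C h = Dom C h'"
    and eq: "k \<cdot> h = k \<cdot> h'" "l \<cdot> h = l \<cdot> h'"
  shows "h = h'"
proof -
  have k: "arr k" "arr l" "arr u" "arr v" "Cod C k = Dom C u" "Cod C l = Dom C v" "Dom C l = Dom C k" "u \<cdot> k = v \<cdot> l"
    using pb by (auto simp: pullback_def hom_def)
  have "u \<cdot> k \<cdot> h = v \<cdot> l \<cdot> h"
    using reassoc2[OF k(8), of h] h k by simp
  moreover have "k \<cdot> h \<in> hom C (Dom C h) (Dom C u)" "l \<cdot> h \<in> hom C (Dom C h) (Dom C v)"
    using h k by (auto simp: hom_def)
  ultimately have "\<exists>!z. z \<in> hom C (Dom C h) (Dom C k) \<and> k \<cdot> z = k \<cdot> h \<and> l \<cdot> z = l \<cdot> h"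
    using pb unfolding pullback_def by blast
  with h eq show ?thesis
    by (auto simp: hom_def)
qed

lemma section_monic:
  assumes "arr u" "arr r" "Dom C r = Cod C u" "r \<cdot> u = \<iota> (Dom C u)"
  shows "monic C u"
  unfolding monic_def
proof (intro conjI allI ballI impI)
  fix T g h
  assume g: "g \<in> hom C T (Dom C u)" "h \<in> hom C T (Dom C u)" and "u \<cdot> g = u \<cdot> h"
  then have "r \<cdot> u \<cdot> g = r \<cdot> u \<cdot> h"
    by simp
  with g assms show "g = h"
    by (simp add: reassoc2[OF assms(4)] hom_def)
qed (rule assms)

lemma pullbackD:
  assumes "pullback C f g p q"
  shows "arr f" "arr g" "arr p" "arr q" "Cod C f = Cod C g" "Dom C q = Dom C p"
    "Cod C p = Dom C f" "Cod C q = Dom C g" "f \<cdot> p = g \<cdot> q"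
  using assms by (auto simp: pullback_def hom_def)

lemma induced_pullback:
  assumes pb: "pullback C f g p q" and u: "u \<in> hom C T (Dom C f)" and v: "v \<in> hom C T (Dom C g)"
    and e: "f \<cdot> u = g \<cdot> v"
  shows "induced C p q u v \<in> hom C T (Dom C p)" "p \<cdot> induced C p q u v = u" "q \<cdot> induced C p q u v = v"
proof -
  have "Dom C u = T"
    using u by (simp add: hom_def)
  moreover have "\<exists>!k. k \<in> hom C T (Dom C p) \<and> p \<cdot> k = u \<and> q \<cdot> k = v"
    using pb u v e unfolding pullback_def by blast
  ultimately have "induced C p q u v \<in> hom C T (Dom C p) \<and> p \<cdot> induced C p q u v = u \<and> q \<cdot> induced C p q u v = v"
    unfolding induced_def by (simp only:) (rule theI')
  then show "induced C p q u v \<in> hom C T (Dom C p)" "p \<cdot> induced C p q u v = u" "q \<cdot> induced C p q u v = v"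
    by auto
qed

end

section \<open>Coherence in symmetric monoidal categories\<close>

context symmetric_monoidal_category
begin

lemma TObj_Obj' [simp]: "A \<in> Obj C \<Longrightarrow> B \<in> Obj C \<Longrightarrow> A \<odot> B \<in> Obj C"
  by (rule TObj_Obj)

lemma Unit_Obj' [simp]: "\<one> \<in> Obj C"
  by (rule Unit_Obj)

lemma TArr_simps [simp]:
  assumes "arr f" "arr g"
  shows "arr (f \<otimes> g)" "Dom C (f \<otimes> g) = Dom C f \<odot> Dom C g" "Cod C (f \<otimes> g) = Cod C f \<odot> Cod C g"
  using TArr_hom[of f "Dom C f" "Cod C f" g "Dom C g" "Cod C g"] assms by (auto simp: hom_def)

lemma TArr_Ide' [simp]: "A \<in> Obj C \<Longrightarrow> B \<in> Obj C \<Longrightarrow> \<iota> A \<otimes> \<iota> B = \<iota> (A \<odot> B)"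
  by (rule TArr_Ide)

text \<open>Bifunctoriality is oriented so that composites of tensors collapse, with
  \<open>merge'\<close> doing so in front of a tail. \<open>split_left\<close> and
  \<open>split_right\<close> open whiskered composites again when a coherence law has to be
  matched.\<close>

lemma merge:
  assumes "arr f" "arr g" "arr f'" "arr g'" "Dom C g = Cod C f" "Dom C g' = Cod C f'"
  shows "(g \<otimes> g') \<cdot> (f \<otimes> f') = (g \<cdot> f) \<otimes> (g' \<cdot> f')"
  using TArr_Cmp[of f "Dom C f" "Cod C f" g "Cod C g" f' "Dom C f'" "Cod C f'" g' "Cod C g'"] assms
  by (auto simp: hom_def)

lemma merge':
  assumes "arr f" "arr g" "arr f'" "arr g'" "Dom C g = Cod C f" "Dom C g' = Cod C f'"
    "arr x" "Cod C x = Dom C f \<odot> Dom C f'"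
  shows "(g \<otimes> g') \<cdot> (f \<otimes> f') \<cdot> x = ((g \<cdot> f) \<otimes> (g' \<cdot> f')) \<cdot> x"
  using reassoc2[OF merge[of f g f' g']] assms by simp

lemma split_left:
  assumes "arr f" "arr g" "Dom C g = Cod C f" "A \<in> Obj C"
  shows "\<iota> A \<otimes> (g \<cdot> f) = (\<iota> A \<otimes> g) \<cdot> (\<iota> A \<otimes> f)"
  using assms by (simp add: merge)

lemma split_right:
  assumes "arr f" "arr g" "Dom C g = Cod C f" "A \<in> Obj C"
  shows "(g \<cdot> f) \<otimes> \<iota> A = (g \<otimes> \<iota> A) \<cdot> (f \<otimes> \<iota> A)"
  using assms by (simp add: merge)

lemma iso_TArr:
  assumes "iso C f" "iso C g"
  shows "iso C (f \<otimes> g)"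
proof -
  note inv_arrow_simps[OF assms(1), simp] inv_arrow_simps[OF assms(2), simp]
  have "inverse_arrows C (f \<otimes> g) (inv_arrow C f \<otimes> inv_arrow C g)"
    by (auto simp: inverse_arrows_def hom_def merge)
  then show ?thesis
    by (auto simp: iso_def)
qed

lemma iso_Ide: "A \<in> Obj C \<Longrightarrow> iso C (\<iota> A)"
  unfolding iso_def inverse_arrows_def hom_def by (rule exI[of _ "\<iota> A"]) auto

abbreviation ai :: "'o \<Rightarrow> 'o \<Rightarrow> 'o \<Rightarrow> 'a" where "ai A B D \<equiv> inv_arrow C (\<alpha> A B D)"

lemma Assoc_simps [simp]:
  assumes "A \<in> Obj C" "B \<in> Obj C" "D \<in> Obj C"
  shows "arr (\<alpha> A B D)" "Dom C (\<alpha> A B D) = (A \<odot> B) \<odot> D" "Cod C (\<alpha> A B D) = A \<odot> (B \<odot> D)"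
    "arr (ai A B D)" "Dom C (ai A B D) = A \<odot> (B \<odot> D)" "Cod C (ai A B D) = (A \<odot> B) \<odot> D"
    "ai A B D \<cdot> \<alpha> A B D = \<iota> ((A \<odot> B) \<odot> D)" "\<alpha> A B D \<cdot> ai A B D = \<iota> (A \<odot> (B \<odot> D))"
  using Assoc_hom[OF assms] inv_arrow_simps[OF Assoc_iso[OF assms]] by (auto simp: hom_def)

lemma LUnit_simps [simp]:
  assumes "A \<in> Obj C"
  shows "arr (\<ll> A)" "Dom C (\<ll> A) = \<one> \<odot> A" "Cod C (\<ll> A) = A"
  using LUnit_hom[OF assms] by (auto simp: hom_def)

lemma RUnit_simps [simp]:
  assumes "A \<in> Obj C"
  shows "arr (\<rr> A)" "Dom C (\<rr> A) = A \<odot> \<one>" "Cod C (\<rr> A) = A"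
  using RUnit_hom[OF assms] by (auto simp: hom_def)

lemma Sym_simps [simp]:
  assumes "A \<in> Obj C" "B \<in> Obj C"
  shows "arr (\<sigma> A B)" "Dom C (\<sigma> A B) = A \<odot> B" "Cod C (\<sigma> A B) = B \<odot> A"
    "\<sigma> B A \<cdot> \<sigma> A B = \<iota> (A \<odot> B)"
  using Sym_hom[OF assms] Sym_Sym[OF assms] by (auto simp: hom_def)

lemma iso_Sym: "A \<in> Obj C \<Longrightarrow> B \<in> Obj C \<Longrightarrow> iso C (\<sigma> A B)"
  unfolding iso_def inverse_arrows_def hom_def by (rule exI[of _ "\<sigma> B A"]) auto

lemma Assoc_nat:
  assumes "arr f" "arr g" "arr h" "Dom C f = A" "Dom C g = B" "Dom C h = D"
    "Cod C f = A'" "Cod C g = B'" "Cod C h = D'"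
  shows "\<alpha> A' B' D' \<cdot> ((f \<otimes> g) \<otimes> h) = (f \<otimes> (g \<otimes> h)) \<cdot> \<alpha> A B D"
  using Assoc_natural[of f A A' g B B' h D D'] assms by (auto simp: hom_def)

lemma Assoc_inv_nat:
  assumes "arr f" "arr g" "arr h" "Dom C f = A" "Dom C g = B" "Dom C h = D"
    "Cod C f = A'" "Cod C g = B'" "Cod C h = D'"
  shows "ai A' B' D' \<cdot> (f \<otimes> (g \<otimes> h)) = ((f \<otimes> g) \<otimes> h) \<cdot> ai A B D"
proof -
  have o: "A \<in> Obj C" "B \<in> Obj C" "D \<in> Obj C" "A' \<in> Obj C" "B' \<in> Obj C" "D' \<in> Obj C"
    using assms by auto
  show ?thesis
    apply (rule iso_cancel_left[OF Assoc_iso[of A' B' D']])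
    using o assms Assoc_nat[OF assms]
    by (simp_all add: reassoc2[OF Assoc_nat[OF assms]] reassoc2[OF Assoc_simps(8)])
qed

lemma LUnit_nat:
  assumes "arr f" "Dom C f = A" "Cod C f = B" shows "\<ll> B \<cdot> (\<iota> \<one> \<otimes> f) = f \<cdot> \<ll> A"
  using LUnit_natural[of f A B] assms by (auto simp: hom_def)

lemma RUnit_nat:
  assumes "arr f" "Dom C f = A" "Cod C f = B" shows "\<rr> B \<cdot> (f \<otimes> \<iota> \<one>) = f \<cdot> \<rr> A"
  using RUnit_natural[of f A B] assms by (auto simp: hom_def)

lemma Sym_nat:
  assumes "arr f" "arr g" "Dom C f = A" "Dom C g = B" "Cod C f = A'" "Cod C g = B'"
  shows "\<sigma> A' B' \<cdot> (f \<otimes> g) = (g \<otimes> f) \<cdot> \<sigma> A B"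
  using Sym_natural[of f A A' g B B'] assms by (auto simp: hom_def)

text \<open>Naturality of \<open>\<ll>\<close> makes tensoring with \<open>\<one>\<close> isomorphic
  to the identity functor. Coherence laws can therefore be proved after tensoring with
  \<open>\<one>\<close>, where pentagon, triangle and hexagon apply.\<close>

lemma Unit_TArr_faithful:
  assumes "\<iota> \<one> \<otimes> f = \<iota> \<one> \<otimes> g" "arr f" "arr g" "Dom C f = Dom C g" "Cod C f = Cod C g"
  shows "f = g"
proof -
  have "f \<cdot> \<ll> (Dom C f) = g \<cdot> \<ll> (Dom C f)"
    using LUnit_nat[of f "Dom C f" "Cod C f"] LUnit_nat[of g "Dom C f" "Cod C f"] assms by simp
  then show ?thesis
    by (rule iso_cancel_right[OF LUnit_iso, rotated]) (use assms in auto)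
qed

lemma TArr_Unit_faithful:
  assumes "f \<otimes> \<iota> \<one> = g \<otimes> \<iota> \<one>" "arr f" "arr g" "Dom C f = Dom C g" "Cod C f = Cod C g"
  shows "f = g"
proof -
  have "f \<cdot> \<rr> (Dom C f) = g \<cdot> \<rr> (Dom C f)"
    using RUnit_nat[of f "Dom C f" "Cod C f"] RUnit_nat[of g "Dom C f" "Cod C f"] assms by simp
  then show ?thesis
    by (rule iso_cancel_right[OF RUnit_iso, rotated]) (use assms in auto)
qed

text \<open>In a right-nested product an adjacent pair of factors is followed by a remainder
  \<open>X\<close>. Building \<open>X\<close> and the two associators into the symmetry lets
  permutations of long products be written without further rebracketing.\<close>

definition swp :: "'o \<Rightarrow> 'o \<Rightarrow> 'o \<Rightarrow> 'a" where
  "swp A B X = \<alpha> B A X \<cdot> (\<sigma> A B \<otimes> \<iota> X) \<cdot> ai A B X"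

lemma swp_simps [simp]:
  assumes "A \<in> Obj C" "B \<in> Obj C" "X \<in> Obj C"
  shows "arr (swp A B X)" "Dom C (swp A B X) = A \<odot> (B \<odot> X)" "Cod C (swp A B X) = B \<odot> (A \<odot> X)"
  using assms by (simp_all add: swp_def)

lemma swp_Assoc:
  assumes [simp]: "A \<in> Obj C" "B \<in> Obj C" "X \<in> Obj C"
  shows "swp A B X \<cdot> \<alpha> A B X = \<alpha> B A X \<cdot> (\<sigma> A B \<otimes> \<iota> X)"
  by (simp add: swp_def)

lemma swp_nat:
  assumes "arr f" "arr g" "arr h" "Dom C f = A" "Dom C g = B" "Dom C h = X"
    "Cod C f = A'" "Cod C g = B'" "Cod C h = X'"
  shows "swp A' B' X' \<cdot> (f \<otimes> (g \<otimes> h)) = (g \<otimes> (f \<otimes> h)) \<cdot> swp A B X"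
proof -
  have [simp]: "A \<in> Obj C" "B \<in> Obj C" "X \<in> Obj C" "A' \<in> Obj C" "B' \<in> Obj C" "X' \<in> Obj C"
    using assms by auto
  have "swp A' B' X' \<cdot> (f \<otimes> (g \<otimes> h)) = \<alpha> B' A' X' \<cdot> (\<sigma> A' B' \<otimes> \<iota> X') \<cdot> ((f \<otimes> g) \<otimes> h) \<cdot> ai A B X"
    using assms by (simp add: swp_def Assoc_inv_nat)
  also have "\<dots> = \<alpha> B' A' X' \<cdot> ((g \<otimes> f) \<otimes> h) \<cdot> (\<sigma> A B \<otimes> \<iota> X) \<cdot> ai A B X"
    using assms by (simp add: merge' Sym_nat)
  also have "\<dots> = (g \<otimes> (f \<otimes> h)) \<cdot> swp A B X"
    using assms by (simp add: swp_def reassoc2[OF Assoc_nat])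
  finally show ?thesis .
qed

lemma swp_swp:
  assumes [simp]: "A \<in> Obj C" "B \<in> Obj C" "X \<in> Obj C"
  shows "swp B A X \<cdot> swp A B X = \<iota> (A \<odot> (B \<odot> X))"
  by (simp add: swp_def reassoc2[OF Assoc_simps(7)] merge')

lemma pent:
  assumes "A \<in> Obj C" "B \<in> Obj C" "D \<in> Obj C" "E \<in> Obj C"
  shows "(\<iota> A \<otimes> \<alpha> B D E) \<cdot> \<alpha> A (B \<odot> D) E \<cdot> (\<alpha> A B D \<otimes> \<iota> E)
    = \<alpha> A B (D \<odot> E) \<cdot> \<alpha> (A \<odot> B) D E"
  using pentagon assms by simp

text \<open>The hexagon axiom tensored with \<open>X\<close>, the pentagon restoring right nesting.
  The isomorphism that is cancelled starts from \<open>((A \<odot> B) \<odot> D) \<odot> X\<close>,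
  the bracketing in which the axiom becomes visible.\<close>

lemma swp_hexagon:
  assumes [simp]: "A \<in> Obj C" "B \<in> Obj C" "D \<in> Obj C" "X \<in> Obj C"
  shows "\<alpha> B D (A \<odot> X) \<cdot> swp A (B \<odot> D) X =
    (\<iota> B \<otimes> swp A D X) \<cdot> swp A B (D \<odot> X) \<cdot> (\<iota> A \<otimes> \<alpha> B D X)"
proof (rule iso_cancel_right[of "\<alpha> A (B \<odot> D) X \<cdot> (\<alpha> A B D \<otimes> \<iota> X)"])
  have "(\<alpha> B D (A \<odot> X) \<cdot> swp A (B \<odot> D) X) \<cdot> \<alpha> A (B \<odot> D) X \<cdot> (\<alpha> A B D \<otimes> \<iota> X)
    = (\<alpha> B D (A \<odot> X) \<cdot> \<alpha> (B \<odot> D) A X) \<cdot> (\<sigma> A (B \<odot> D) \<otimes> \<iota> X) \<cdot> (\<alpha> A B D \<otimes> \<iota> X)"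
    by (simp add: reassoc2[OF swp_Assoc])
  also have "\<dots> = (\<iota> B \<otimes> \<alpha> D A X) \<cdot> \<alpha> B (D \<odot> A) X \<cdot> ((\<alpha> B D A \<cdot> \<sigma> A (B \<odot> D) \<cdot> \<alpha> A B D) \<otimes> \<iota> X)"
    by (simp add: pent[symmetric] merge)
  also have "\<dots> = (\<iota> B \<otimes> \<alpha> D A X) \<cdot> \<alpha> B (D \<odot> A) X \<cdot> ((\<iota> B \<otimes> \<sigma> A D) \<otimes> \<iota> X) \<cdot> (\<alpha> B A D \<otimes> \<iota> X) \<cdot> ((\<sigma> A B \<otimes> \<iota> D) \<otimes> \<iota> X)"
    by (simp add: hexagon merge)
  also have "\<dots> = (\<iota> B \<otimes> \<alpha> D A X) \<cdot> (\<iota> B \<otimes> (\<sigma> A D \<otimes> \<iota> X)) \<cdot> \<alpha> B (A \<odot> D) X \<cdot> (\<alpha> B A D \<otimes> \<iota> X) \<cdot> ((\<sigma> A B \<otimes> \<iota> D) \<otimes> \<iota> X)"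
    by (simp add: reassoc2[OF Assoc_nat])
  also have "\<dots> = (\<iota> B \<otimes> swp A D X) \<cdot> ((\<iota> B \<otimes> \<alpha> A D X) \<cdot> \<alpha> B (A \<odot> D) X \<cdot> (\<alpha> B A D \<otimes> \<iota> X)) \<cdot> ((\<sigma> A B \<otimes> \<iota> D) \<otimes> \<iota> X)"
    by (simp add: merge' swp_Assoc)
  also have "\<dots> = (\<iota> B \<otimes> swp A D X) \<cdot> \<alpha> B A (D \<odot> X) \<cdot> (\<sigma> A B \<otimes> \<iota> (D \<odot> X)) \<cdot> \<alpha> (A \<odot> B) D X"
    by (simp add: pent Assoc_nat)
  also have "\<dots> = (\<iota> B \<otimes> swp A D X) \<cdot> swp A B (D \<odot> X) \<cdot> \<alpha> A B (D \<odot> X) \<cdot> \<alpha> (A \<odot> B) D X"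
    by (simp add: reassoc2[OF swp_Assoc])
  also have "\<dots> = ((\<iota> B \<otimes> swp A D X) \<cdot> swp A B (D \<odot> X) \<cdot> (\<iota> A \<otimes> \<alpha> B D X)) \<cdot> \<alpha> A (B \<odot> D) X \<cdot> (\<alpha> A B D \<otimes> \<iota> X)"
    by (simp add: pent)
  finally show "(\<alpha> B D (A \<odot> X) \<cdot> swp A (B \<odot> D) X) \<cdot> \<alpha> A (B \<odot> D) X \<cdot> (\<alpha> A B D \<otimes> \<iota> X) = \<dots>" .
qed (simp_all add: iso_Cmp Assoc_iso iso_TArr iso_Ide)

text \<open>Swapping back inverts \<open>swp\<close>, so inverting \<open>swp_hexagon\<close> gives
  the hexagon for a composite first argument.\<close>

lemma swp_hexagon':
  assumes [simp]: "A \<in> Obj C" "A' \<in> Obj C" "B \<in> Obj C" "X \<in> Obj C"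
  shows "(\<iota> B \<otimes> \<alpha> A A' X) \<cdot> swp (A \<odot> A') B X =
    swp A B (A' \<odot> X) \<cdot> (\<iota> A \<otimes> swp A' B X) \<cdot> \<alpha> A A' (B \<odot> X)"
proof -
  note h = swp_hexagon[of B A A' X]
  have "swp A B (A' \<odot> X) \<cdot> (\<iota> A \<otimes> swp A' B X) \<cdot> \<alpha> A A' (B \<odot> X)
     = swp A B (A' \<odot> X) \<cdot> (\<iota> A \<otimes> swp A' B X) \<cdot> (\<alpha> A A' (B \<odot> X) \<cdot> swp B (A \<odot> A') X) \<cdot> swp (A \<odot> A') B X"
    by (simp add: swp_swp)
  also have "\<dots> = swp A B (A' \<odot> X) \<cdot> ((\<iota> A \<otimes> swp A' B X) \<cdot> (\<iota> A \<otimes> swp B A' X)) \<cdot>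
      swp B A (A' \<odot> X) \<cdot> (\<iota> B \<otimes> \<alpha> A A' X) \<cdot> swp (A \<odot> A') B X"
    by (simp add: reassoc2[OF h])
  also have "\<dots> = (\<iota> B \<otimes> \<alpha> A A' X) \<cdot> swp (A \<odot> A') B X"
    by (simp add: merge swp_swp reassoc2[OF swp_swp])
  finally show ?thesis by simp
qed

text \<open>Whiskering on the right by \<open>Z\<close> only enlarges the spare factor from
  \<open>X\<close> to \<open>X \<odot> Z\<close>. This carries a swap inside a left-hand bracket
  into right-nested form.\<close>

lemma swp_tensor:
  assumes [simp]: "A \<in> Obj C" "B \<in> Obj C" "X \<in> Obj C" "Z \<in> Obj C"
  shows "(\<iota> B \<otimes> \<alpha> A X Z) \<cdot> \<alpha> B (A \<odot> X) Z \<cdot> (swp A B X \<otimes> \<iota> Z) =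
    swp A B (X \<odot> Z) \<cdot> (\<iota> A \<otimes> \<alpha> B X Z) \<cdot> \<alpha> A (B \<odot> X) Z"
proof (rule iso_cancel_right[of "\<alpha> A B X \<otimes> \<iota> Z"])
  have "((\<iota> B \<otimes> \<alpha> A X Z) \<cdot> \<alpha> B (A \<odot> X) Z \<cdot> (swp A B X \<otimes> \<iota> Z)) \<cdot> (\<alpha> A B X \<otimes> \<iota> Z)
    = ((\<iota> B \<otimes> \<alpha> A X Z) \<cdot> \<alpha> B (A \<odot> X) Z \<cdot> (\<alpha> B A X \<otimes> \<iota> Z)) \<cdot> ((\<sigma> A B \<otimes> \<iota> X) \<otimes> \<iota> Z)"
    by (simp add: merge swp_Assoc)
  also have "\<dots> = \<alpha> B A (X \<odot> Z) \<cdot> (\<sigma> A B \<otimes> \<iota> (X \<odot> Z)) \<cdot> \<alpha> (A \<odot> B) X Z"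
    by (simp add: pent Assoc_nat)
  also have "\<dots> = swp A B (X \<odot> Z) \<cdot> \<alpha> A B (X \<odot> Z) \<cdot> \<alpha> (A \<odot> B) X Z"
    by (simp add: reassoc2[OF swp_Assoc])
  also have "\<dots> = (swp A B (X \<odot> Z) \<cdot> (\<iota> A \<otimes> \<alpha> B X Z) \<cdot> \<alpha> A (B \<odot> X) Z) \<cdot> (\<alpha> A B X \<otimes> \<iota> Z)"
    by (simp add: pent)
  finally show "((\<iota> B \<otimes> \<alpha> A X Z) \<cdot> \<alpha> B (A \<odot> X) Z \<cdot> (swp A B X \<otimes> \<iota> Z)) \<cdot> (\<alpha> A B X \<otimes> \<iota> Z) = \<dots>" .
qed (simp_all add: iso_Cmp Assoc_iso iso_TArr iso_Ide)

text \<open>Kelly's derivation of this unit law: after tensoring with \<open>\<one>\<close> on the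
  left, the pentagon exposes \<open>\<one> \<odot> \<one>\<close>, and two triangles joined by
  naturality of the associator identify the sides.\<close>

lemma LUnit_TObj:
  assumes [simp]: "A \<in> Obj C" "B \<in> Obj C"
  shows "\<ll> (A \<odot> B) \<cdot> \<alpha> \<one> A B = \<ll> A \<otimes> \<iota> B"
proof (rule Unit_TArr_faithful)
  note t = triangle[OF Unit_Obj]
  show "\<iota> \<one> \<otimes> (\<ll> (A \<odot> B) \<cdot> \<alpha> \<one> A B) = \<iota> \<one> \<otimes> (\<ll> A \<otimes> \<iota> B)"
  proof (rule iso_cancel_right[of "\<alpha> \<one> (\<one> \<odot> A) B \<cdot> (\<alpha> \<one> \<one> A \<otimes> \<iota> B)"])
    have "(\<iota> \<one> \<otimes> (\<ll> (A \<odot> B) \<cdot> \<alpha> \<one> A B)) \<cdot> \<alpha> \<one> (\<one> \<odot> A) B \<cdot> (\<alpha> \<one> \<one> A \<otimes> \<iota> B)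
      = (\<iota> \<one> \<otimes> \<ll> (A \<odot> B)) \<cdot> \<alpha> \<one> \<one> (A \<odot> B) \<cdot> \<alpha> (\<one> \<odot> \<one>) A B"
      by (simp add: split_left pent)
    also have "\<dots> = (\<rr> \<one> \<otimes> \<iota> (A \<odot> B)) \<cdot> \<alpha> (\<one> \<odot> \<one>) A B"
      by (simp add: reassoc2[OF t])
    also have "\<dots> = \<alpha> \<one> A B \<cdot> ((\<rr> \<one> \<otimes> \<iota> A) \<otimes> \<iota> B)"
      by (simp add: Assoc_nat)
    also have "\<dots> = \<alpha> \<one> A B \<cdot> ((\<iota> \<one> \<otimes> \<ll> A) \<otimes> \<iota> B) \<cdot> (\<alpha> \<one> \<one> A \<otimes> \<iota> B)"
      by (simp add: merge t)
    also have "\<dots> = (\<iota> \<one> \<otimes> (\<ll> A \<otimes> \<iota> B)) \<cdot> \<alpha> \<one> (\<one> \<odot> A) B \<cdot> (\<alpha> \<one> \<one> A \<otimes> \<iota> B)"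
      by (simp add: reassoc2[OF Assoc_nat])
    finally show "(\<iota> \<one> \<otimes> (\<ll> (A \<odot> B) \<cdot> \<alpha> \<one> A B)) \<cdot> \<alpha> \<one> (\<one> \<odot> A) B \<cdot> (\<alpha> \<one> \<one> A \<otimes> \<iota> B) = \<dots>" .
  qed (simp_all add: iso_Cmp Assoc_iso iso_TArr iso_Ide)
qed simp_all

text \<open>Naturality of \<open>\<ll>\<close> along \<open>\<ll> \<one>\<close> itself forces
  \<open>\<ll> (\<one> \<odot> \<one>) = \<iota> \<one> \<otimes> \<ll> \<one>\<close>; the triangle
  and \<open>LUnit_TObj\<close> then evaluate the same composite.\<close>

lemma LUnit_Unit: "\<ll> \<one> = \<rr> \<one>"
proof (rule TArr_Unit_faithful)
  have "\<ll> (\<one> \<odot> \<one>) = \<iota> \<one> \<otimes> \<ll> \<one>"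
    by (rule iso_cancel_left[OF LUnit_iso[of \<one>]]) (simp_all add: LUnit_nat)
  then show "\<ll> \<one> \<otimes> \<iota> \<one> = \<rr> \<one> \<otimes> \<iota> \<one>"
    using LUnit_TObj[of \<one> \<one>] triangle[of \<one> \<one>] by simp
qed simp_all

text \<open>The hexagon with two of its objects equal to \<open>\<one>\<close>. Prefixing the
  invertible \<open>\<sigma> A \<one>\<close> to both sides is what makes the naturality of
  \<open>\<ll>\<close> and of the symmetry applicable.\<close>

lemma LUnit_Sym:
  assumes [simp]: "A \<in> Obj C"
  shows "\<ll> A \<cdot> \<sigma> A \<one> = \<rr> A"
proof (rule TArr_Unit_faithful)
  have "\<sigma> A \<one> \<cdot> ((\<ll> A \<cdot> \<sigma> A \<one>) \<otimes> \<iota> \<one>) = \<sigma> A \<one> \<cdot> (\<ll> A \<otimes> \<iota> \<one>) \<cdot> (\<sigma> A \<one> \<otimes> \<iota> \<one>)"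
    by (simp add: merge)
  also have "\<dots> = \<ll> (\<one> \<odot> A) \<cdot> (\<iota> \<one> \<otimes> \<sigma> A \<one>) \<cdot> \<alpha> \<one> A \<one> \<cdot> (\<sigma> A \<one> \<otimes> \<iota> \<one>)"
    by (simp add: LUnit_TObj[symmetric] reassoc2[OF LUnit_nat])
  also have "\<dots> = (\<ll> (\<one> \<odot> A) \<cdot> \<alpha> \<one> \<one> A) \<cdot> \<sigma> A (\<one> \<odot> \<one>) \<cdot> \<alpha> A \<one> \<one>"
    by (simp add: hexagon)
  also have "\<dots> = (\<ll> \<one> \<otimes> \<iota> A) \<cdot> \<sigma> A (\<one> \<odot> \<one>) \<cdot> \<alpha> A \<one> \<one>"
    unfolding LUnit_TObj[OF Unit_Obj assms] ..
  also have "\<dots> = \<sigma> A \<one> \<cdot> (\<iota> A \<otimes> \<ll> \<one>) \<cdot> \<alpha> A \<one> \<one>"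
    by (simp add: reassoc2[OF Sym_nat[symmetric]])
  also have "\<dots> = \<sigma> A \<one> \<cdot> (\<rr> A \<otimes> \<iota> \<one>)"
    by (simp add: triangle)
  finally show "(\<ll> A \<cdot> \<sigma> A \<one>) \<otimes> \<iota> \<one> = \<rr> A \<otimes> \<iota> \<one>"
    by (rule iso_cancel_left[OF iso_Sym, rotated 2]) simp_all
qed simp_all

lemma Sym_Unit: "\<sigma> \<one> \<one> = \<iota> (\<one> \<odot> \<one>)"
  by (rule iso_cancel_left[OF LUnit_iso[of \<one>]]) (use LUnit_Sym[of \<one>] LUnit_Unit in simp_all)

section \<open>The interchange isomorphism and its coherence\<close>

abbreviation itc :: "'o \<Rightarrow> 'o \<Rightarrow> 'o \<Rightarrow> 'o \<Rightarrow> 'a" where "itc \<equiv> interchange C"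

lemma itc_eq:
  assumes [simp]: "A \<in> Obj C" "B \<in> Obj C" "D \<in> Obj C" "E \<in> Obj C"
  shows "itc A B D E = ai A D (B \<odot> E) \<cdot> (\<iota> A \<otimes> swp B D E) \<cdot> \<alpha> A B (D \<odot> E)"
  by (simp add: interchange_def swp_def merge')

lemma itc_simps [simp]:
  assumes [simp]: "A \<in> Obj C" "B \<in> Obj C" "D \<in> Obj C" "E \<in> Obj C"
  shows "arr (itc A B D E)" "Dom C (itc A B D E) = (A \<odot> B) \<odot> (D \<odot> E)"
    "Cod C (itc A B D E) = (A \<odot> D) \<odot> (B \<odot> E)"
  by (simp_all add: itc_eq)

lemma Assoc_itc:
  assumes [simp]: "A \<in> Obj C" "B \<in> Obj C" "D \<in> Obj C" "E \<in> Obj C"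
  shows "\<alpha> A D (B \<odot> E) \<cdot> itc A B D E = (\<iota> A \<otimes> swp B D E) \<cdot> \<alpha> A B (D \<odot> E)"
  by (simp add: itc_eq reassoc2[OF Assoc_simps(8)])

lemma itc_nat:
  assumes "arr a" "arr b" "arr d" "arr e" "Dom C a = A" "Dom C b = B" "Dom C d = D" "Dom C e = E"
    "Cod C a = A'" "Cod C b = B'" "Cod C d = D'" "Cod C e = E'"
  shows "itc A' B' D' E' \<cdot> ((a \<otimes> b) \<otimes> (d \<otimes> e)) = ((a \<otimes> d) \<otimes> (b \<otimes> e)) \<cdot> itc A B D E"
proof -
  have [simp]: "A \<in> Obj C" "B \<in> Obj C" "D \<in> Obj C" "E \<in> Obj C"
    "A' \<in> Obj C" "B' \<in> Obj C" "D' \<in> Obj C" "E' \<in> Obj C"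
    using assms by auto
  have "itc A' B' D' E' \<cdot> ((a \<otimes> b) \<otimes> (d \<otimes> e))
    = ai A' D' (B' \<odot> E') \<cdot> (\<iota> A' \<otimes> swp B' D' E') \<cdot> (a \<otimes> (b \<otimes> (d \<otimes> e))) \<cdot> \<alpha> A B (D \<odot> E)"
    using assms by (simp add: itc_eq Assoc_nat)
  also have "\<dots> = ai A' D' (B' \<odot> E') \<cdot> (a \<otimes> (d \<otimes> (b \<otimes> e))) \<cdot> (\<iota> A \<otimes> swp B D E) \<cdot> \<alpha> A B (D \<odot> E)"
    using assms by (simp add: merge' swp_nat)
  also have "\<dots> = ((a \<otimes> d) \<otimes> (b \<otimes> e)) \<cdot> itc A B D E"
    using assms by (simp add: itc_eq reassoc2[OF Assoc_inv_nat])
  finally show ?thesis .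
qed

lemma itc_itc:
  assumes [simp]: "A \<in> Obj C" "B \<in> Obj C" "D \<in> Obj C" "E \<in> Obj C"
  shows "itc A D B E \<cdot> itc A B D E = \<iota> ((A \<odot> B) \<odot> (D \<odot> E))"
  by (simp add: itc_eq reassoc2[OF Assoc_simps(8)] merge' swp_swp)

text \<open>The associativity constraint that makes the tensor product a monoidal functor of two
  variables; coassociativity of a tensor product of comonoids depends on it. Both sides are
  flattened to a right-nested product of six factors, where they are words in
  \<open>swp\<close>.\<close>

lemma itc_Assoc:
  assumes [simp]: "A \<in> Obj C" "A' \<in> Obj C" "A'' \<in> Obj C" "B \<in> Obj C" "B' \<in> Obj C" "B'' \<in> Obj C"
  shows "\<alpha> (A \<odot> B) (A' \<odot> B') (A'' \<odot> B'') \<cdot> (itc A A' B B' \<otimes> \<iota> (A'' \<odot> B'')) \<cdot>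
      itc (A \<odot> A') A'' (B \<odot> B') B''
    = (\<iota> (A \<odot> B) \<otimes> itc A' A'' B' B'') \<cdot> itc A (A' \<odot> A'') B (B' \<odot> B'') \<cdot> (\<alpha> A A' A'' \<otimes> \<alpha> B B' B'')"
proof (rule iso_cancel_left[of "(\<iota> A \<otimes> (\<iota> B \<otimes> \<alpha> A' B' (A'' \<odot> B''))) \<cdot> \<alpha> A B ((A' \<odot> B') \<odot> (A'' \<odot> B''))"])
  let ?Z = "A'' \<odot> B''" and ?Y = "B' \<odot> B''"
  \<comment> \<open>The common normal form: after flattening, \<open>A''\<close> moves past
    \<open>B\<close> and then past \<open>B'\<close>, and finally \<open>A'\<close> moves past
    \<open>B\<close>.\<close>
  let ?N = "(\<iota> A \<otimes> swp A' B (B' \<odot> (A'' \<odot> B''))) \<cdot>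
      (\<iota> A \<otimes> (\<iota> A' \<otimes> (\<iota> B \<otimes> swp A'' B' B''))) \<cdot> (\<iota> A \<otimes> (\<iota> A' \<otimes> swp A'' B (B' \<odot> B''))) \<cdot>
      \<alpha> A A' (A'' \<odot> (B \<odot> (B' \<odot> B''))) \<cdot> \<alpha> (A \<odot> A') A'' (B \<odot> (B' \<odot> B'')) \<cdot>
      (\<iota> ((A \<odot> A') \<odot> A'') \<otimes> \<alpha> B B' B'')"
  have "((\<iota> A \<otimes> (\<iota> B \<otimes> \<alpha> A' B' ?Z)) \<cdot> \<alpha> A B ((A' \<odot> B') \<odot> ?Z)) \<cdot>
      \<alpha> (A \<odot> B) (A' \<odot> B') ?Z \<cdot> (itc A A' B B' \<otimes> \<iota> ?Z) \<cdot> itc (A \<odot> A') A'' (B \<odot> B') B''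
    = (\<iota> A \<otimes> (\<iota> B \<otimes> \<alpha> A' B' ?Z)) \<cdot> (\<iota> A \<otimes> \<alpha> B (A' \<odot> B') ?Z) \<cdot> \<alpha> A (B \<odot> (A' \<odot> B')) ?Z \<cdot>
      ((\<alpha> A B (A' \<odot> B') \<cdot> itc A A' B B') \<otimes> \<iota> ?Z) \<cdot> itc (A \<odot> A') A'' (B \<odot> B') B''"
    by (simp add: reassoc2[OF pent[symmetric]] merge')
  also have "\<dots> = (\<iota> A \<otimes> (\<iota> B \<otimes> \<alpha> A' B' ?Z)) \<cdot> (\<iota> A \<otimes> \<alpha> B (A' \<odot> B') ?Z) \<cdot>
      (\<alpha> A (B \<odot> (A' \<odot> B')) ?Z \<cdot> ((\<iota> A \<otimes> swp A' B B') \<otimes> \<iota> ?Z)) \<cdot> (\<alpha> A A' (B \<odot> B') \<otimes> \<iota> ?Z) \<cdot>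
      itc (A \<odot> A') A'' (B \<odot> B') B''"
    by (simp add: Assoc_itc split_right)
  also have "\<dots> = (\<iota> A \<otimes> ((\<iota> B \<otimes> \<alpha> A' B' ?Z) \<cdot> \<alpha> B (A' \<odot> B') ?Z \<cdot> (swp A' B B' \<otimes> \<iota> ?Z))) \<cdot>
      \<alpha> A (A' \<odot> (B \<odot> B')) ?Z \<cdot> (\<alpha> A A' (B \<odot> B') \<otimes> \<iota> ?Z) \<cdot> itc (A \<odot> A') A'' (B \<odot> B') B''"
    by (simp add: reassoc2[OF Assoc_nat] split_left)
  also have "\<dots> = (\<iota> A \<otimes> swp A' B (B' \<odot> ?Z)) \<cdot> (\<iota> A \<otimes> (\<iota> A' \<otimes> \<alpha> B B' ?Z)) \<cdot>
      ((\<iota> A \<otimes> \<alpha> A' (B \<odot> B') ?Z) \<cdot> \<alpha> A (A' \<odot> (B \<odot> B')) ?Z \<cdot> (\<alpha> A A' (B \<odot> B') \<otimes> \<iota> ?Z)) \<cdot>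
      itc (A \<odot> A') A'' (B \<odot> B') B''"
    unfolding swp_tensor[OF \<open>A' \<in> Obj C\<close> \<open>B \<in> Obj C\<close> \<open>B' \<in> Obj C\<close> TObj_Obj[OF \<open>A'' \<in> Obj C\<close> \<open>B'' \<in> Obj C\<close>]]
    by (simp add: split_left)
  also have "\<dots> = (\<iota> A \<otimes> swp A' B (B' \<odot> ?Z)) \<cdot> (\<iota> A \<otimes> (\<iota> A' \<otimes> \<alpha> B B' ?Z)) \<cdot>
      \<alpha> A A' ((B \<odot> B') \<odot> ?Z) \<cdot> (\<alpha> (A \<odot> A') (B \<odot> B') ?Z \<cdot> itc (A \<odot> A') A'' (B \<odot> B') B'')"
    by (simp add: pent)
  also have "\<dots> = (\<iota> A \<otimes> swp A' B (B' \<odot> ?Z)) \<cdot> (\<iota> A \<otimes> (\<iota> A' \<otimes> \<alpha> B B' ?Z)) \<cdot>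
      (\<alpha> A A' ((B \<odot> B') \<odot> ?Z) \<cdot> ((\<iota> A \<otimes> \<iota> A') \<otimes> swp A'' (B \<odot> B') B'')) \<cdot> \<alpha> (A \<odot> A') A'' ((B \<odot> B') \<odot> B'')"
    by (simp add: Assoc_itc)
  also have "\<dots> = (\<iota> A \<otimes> swp A' B (B' \<odot> ?Z)) \<cdot> (\<iota> A \<otimes> (\<iota> A' \<otimes> (\<alpha> B B' ?Z \<cdot> swp A'' (B \<odot> B') B''))) \<cdot>
      \<alpha> A A' (A'' \<odot> ((B \<odot> B') \<odot> B'')) \<cdot> \<alpha> (A \<odot> A') A'' ((B \<odot> B') \<odot> B'')"
    by (simp add: reassoc2[OF Assoc_nat] split_left del: TArr_Ide')
  also have "\<dots> = (\<iota> A \<otimes> swp A' B (B' \<odot> ?Z)) \<cdot> (\<iota> A \<otimes> (\<iota> A' \<otimes> (\<iota> B \<otimes> swp A'' B' B''))) \<cdot>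
      (\<iota> A \<otimes> (\<iota> A' \<otimes> swp A'' B ?Y)) \<cdot> (\<iota> A \<otimes> (\<iota> A' \<otimes> (\<iota> A'' \<otimes> \<alpha> B B' B''))) \<cdot>
      \<alpha> A A' (A'' \<odot> ((B \<odot> B') \<odot> B'')) \<cdot> \<alpha> (A \<odot> A') A'' ((B \<odot> B') \<odot> B'')"
    by (simp add: swp_hexagon split_left)
  also have "\<dots> = ?N"
  proof -
    have "(\<iota> A \<otimes> (\<iota> A' \<otimes> (\<iota> A'' \<otimes> \<alpha> B B' B''))) \<cdot>
      \<alpha> A A' (A'' \<odot> ((B \<odot> B') \<odot> B'')) \<cdot> \<alpha> (A \<odot> A') A'' ((B \<odot> B') \<odot> B'')
      = \<alpha> A A' (A'' \<odot> (B \<odot> (B' \<odot> B''))) \<cdot> ((\<iota> A \<otimes> \<iota> A') \<otimes> (\<iota> A'' \<otimes> \<alpha> B B' B'')) \<cdot> \<alpha> (A \<odot> A') A'' ((B \<odot> B') \<odot> B'')"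
      by (simp add: reassoc2[OF Assoc_nat[symmetric]] del: TArr_Ide')
    also have "\<dots> = \<alpha> A A' (A'' \<odot> (B \<odot> (B' \<odot> B''))) \<cdot> \<alpha> (A \<odot> A') A'' (B \<odot> (B' \<odot> B'')) \<cdot>
         ((\<iota> (A \<odot> A') \<otimes> \<iota> A'') \<otimes> \<alpha> B B' B'')"
      by (simp add: Assoc_nat[of "\<iota> (A \<odot> A')" "\<iota> A''" "\<alpha> B B' B''"] del: TArr_Ide') simp
    finally show ?thesis by simp
  qed
  finally have L: "((\<iota> A \<otimes> (\<iota> B \<otimes> \<alpha> A' B' ?Z)) \<cdot> \<alpha> A B ((A' \<odot> B') \<odot> ?Z)) \<cdot>
      \<alpha> (A \<odot> B) (A' \<odot> B') ?Z \<cdot> (itc A A' B B' \<otimes> \<iota> ?Z) \<cdot> itc (A \<odot> A') A'' (B \<odot> B') B'' = ?N" .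
  have "((\<iota> A \<otimes> (\<iota> B \<otimes> \<alpha> A' B' ?Z)) \<cdot> \<alpha> A B ((A' \<odot> B') \<odot> ?Z)) \<cdot>
      (\<iota> (A \<odot> B) \<otimes> itc A' A'' B' B'') \<cdot> itc A (A' \<odot> A'') B ?Y \<cdot> (\<alpha> A A' A'' \<otimes> \<alpha> B B' B'')
    = (\<iota> A \<otimes> (\<iota> B \<otimes> \<alpha> A' B' ?Z)) \<cdot> (\<alpha> A B ((A' \<odot> B') \<odot> ?Z) \<cdot>
      ((\<iota> A \<otimes> \<iota> B) \<otimes> itc A' A'' B' B'')) \<cdot> itc A (A' \<odot> A'') B ?Y \<cdot> (\<alpha> A A' A'' \<otimes> \<alpha> B B' B'')"
    by simp
  also have "\<dots> = (\<iota> A \<otimes> (\<iota> B \<otimes> (\<alpha> A' B' ?Z \<cdot> itc A' A'' B' B''))) \<cdot> \<alpha> A B ((A' \<odot> A'') \<odot> ?Y) \<cdot>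
      itc A (A' \<odot> A'') B ?Y \<cdot> (\<alpha> A A' A'' \<otimes> \<alpha> B B' B'')"
    by (simp add: reassoc2[OF Assoc_nat] split_left del: TArr_Ide')
  also have "\<dots> = (\<iota> A \<otimes> (\<iota> B \<otimes> (\<iota> A' \<otimes> swp A'' B' B''))) \<cdot> (\<iota> A \<otimes> ((\<iota> B \<otimes> \<alpha> A' A'' ?Y) \<cdot> swp (A' \<odot> A'') B ?Y)) \<cdot>
      \<alpha> A (A' \<odot> A'') (B \<odot> ?Y) \<cdot> (\<alpha> A A' A'' \<otimes> \<alpha> B B' B'')"
    by (simp add: Assoc_itc reassoc2[OF Assoc_itc] split_left)
  also have "\<dots> = (\<iota> A \<otimes> (\<iota> B \<otimes> (\<iota> A' \<otimes> swp A'' B' B''))) \<cdot> (\<iota> A \<otimes> swp A' B (A'' \<odot> ?Y)) \<cdot>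
      (\<iota> A \<otimes> (\<iota> A' \<otimes> swp A'' B ?Y)) \<cdot> (\<iota> A \<otimes> \<alpha> A' A'' (B \<odot> ?Y)) \<cdot>
      \<alpha> A (A' \<odot> A'') (B \<odot> ?Y) \<cdot> (\<alpha> A A' A'' \<otimes> \<iota> (B \<odot> ?Y)) \<cdot> (\<iota> ((A \<odot> A') \<odot> A'') \<otimes> \<alpha> B B' B'')"
    by (simp add: swp_hexagon' split_left) (simp add: merge)
  also have "\<dots> = (\<iota> A \<otimes> (\<iota> B \<otimes> (\<iota> A' \<otimes> swp A'' B' B''))) \<cdot> (\<iota> A \<otimes> swp A' B (A'' \<odot> ?Y)) \<cdot>
      (\<iota> A \<otimes> (\<iota> A' \<otimes> swp A'' B ?Y)) \<cdot> \<alpha> A A' (A'' \<odot> (B \<odot> (B' \<odot> B''))) \<cdot> \<alpha> (A \<odot> A') A'' (B \<odot> (B' \<odot> B'')) \<cdot>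
      (\<iota> ((A \<odot> A') \<odot> A'') \<otimes> \<alpha> B B' B'')"
    by (simp add: reassoc3[OF pent])
  also have "\<dots> = ?N"
  proof -
    \<comment> \<open>This side moves \<open>A'\<close> past \<open>B\<close> before
      \<open>A''\<close> passes \<open>B'\<close>. The two swaps act on disjoint factors and commute
      by naturality of \<open>swp\<close>.\<close>
    have "swp A' B (B' \<odot> ?Z) \<cdot> (\<iota> A' \<otimes> (\<iota> B \<otimes> swp A'' B' B''))
      = (\<iota> B \<otimes> (\<iota> A' \<otimes> swp A'' B' B'')) \<cdot> swp A' B (A'' \<odot> ?Y)"
      by (simp add: swp_nat)
    then have "(\<iota> A \<otimes> swp A' B (B' \<odot> ?Z)) \<cdot> (\<iota> A \<otimes> (\<iota> A' \<otimes> (\<iota> B \<otimes> swp A'' B' B'')))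
      = (\<iota> A \<otimes> (\<iota> B \<otimes> (\<iota> A' \<otimes> swp A'' B' B''))) \<cdot> (\<iota> A \<otimes> swp A' B (A'' \<odot> ?Y))"
      by (simp add: merge)
    from reassoc2[OF this] show ?thesis
      by simp
  qed
  finally show "((\<iota> A \<otimes> (\<iota> B \<otimes> \<alpha> A' B' ?Z)) \<cdot> \<alpha> A B ((A' \<odot> B') \<odot> ?Z)) \<cdot>
      \<alpha> (A \<odot> B) (A' \<odot> B') ?Z \<cdot> (itc A A' B B' \<otimes> \<iota> ?Z) \<cdot> itc (A \<odot> A') A'' (B \<odot> B') B''
    = ((\<iota> A \<otimes> (\<iota> B \<otimes> \<alpha> A' B' ?Z)) \<cdot> \<alpha> A B ((A' \<odot> B') \<odot> ?Z)) \<cdot>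
      (\<iota> (A \<odot> B) \<otimes> itc A' A'' B' B'') \<cdot> itc A (A' \<odot> A'') B ?Y \<cdot> (\<alpha> A A' A'' \<otimes> \<alpha> B B' B'')"
    using L by simp
qed (simp_all add: iso_Cmp Assoc_iso iso_TArr iso_Ide)

text \<open>The unit constraint matching \<open>itc_Assoc\<close>, giving the counit law of a tensor
  product of comonoids. \<open>LUnit_Sym\<close> absorbs the inner swap of \<open>A\<close> with
  \<open>\<one>\<close> by turning a left unitor into a right one, after which the triangle
  applies.\<close>

lemma itc_Unit:
  assumes [simp]: "A \<in> Obj C" "B \<in> Obj C"
  shows "\<ll> (A \<odot> B) \<cdot> (\<ll> \<one> \<otimes> \<iota> (A \<odot> B)) \<cdot> itc \<one> A \<one> B = \<ll> A \<otimes> \<ll> B"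
proof -
  have "\<ll> (A \<odot> B) \<cdot> swp A \<one> B = (\<ll> (A \<odot> B) \<cdot> \<alpha> \<one> A B) \<cdot> (\<sigma> A \<one> \<otimes> \<iota> B) \<cdot> ai A \<one> B"
    by (simp add: swp_def)
  also have "\<dots> = (\<rr> A \<otimes> \<iota> B) \<cdot> ai A \<one> B"
    unfolding LUnit_TObj[OF assms] by (simp add: merge' LUnit_Sym)
  also have "\<dots> = \<iota> A \<otimes> \<ll> B"
    by (simp add: triangle[symmetric])
  finally have s: "\<ll> (A \<odot> B) \<cdot> swp A \<one> B = \<iota> A \<otimes> \<ll> B" .
  have t: "\<ll> \<one> \<otimes> \<iota> (A \<odot> B) = (\<iota> \<one> \<otimes> \<ll> (A \<odot> B)) \<cdot> \<alpha> \<one> \<one> (A \<odot> B)"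
    by (simp add: triangle LUnit_Unit)
  have "\<ll> (A \<odot> B) \<cdot> (\<ll> \<one> \<otimes> \<iota> (A \<odot> B)) \<cdot> itc \<one> A \<one> B
    = \<ll> (A \<odot> B) \<cdot> (\<iota> \<one> \<otimes> (\<ll> (A \<odot> B) \<cdot> swp A \<one> B)) \<cdot> \<alpha> \<one> A (\<one> \<odot> B)"
    unfolding t by (simp add: Assoc_itc merge')
  also have "\<dots> = (\<ll> (A \<odot> B) \<cdot> \<alpha> \<one> A B) \<cdot> (\<iota> (\<one> \<odot> A) \<otimes> \<ll> B)"
    unfolding s using Assoc_nat[of "\<iota> \<one>" "\<iota> A" "\<ll> B" \<one> A "\<one> \<odot> B" \<one> A B] by simp
  also have "\<dots> = \<ll> A \<otimes> \<ll> B"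
    unfolding LUnit_TObj[OF assms] by (simp add: merge)
  finally show ?thesis .
qed

text \<open>Swapping \<open>\<one>\<close> with \<open>\<one>\<close> is the identity, so the
  interchange moves nothing here; this yields surjective pairing in \<open>pr_proj\<close>.\<close>

lemma itc_Unit_mid:
  assumes [simp]: "A \<in> Obj C" "B \<in> Obj C"
  shows "itc A \<one> \<one> B = \<iota> ((A \<odot> \<one>) \<odot> (\<one> \<odot> B))"
  by (simp add: itc_eq swp_def Sym_Unit)

text \<open>Tensoring with a spare object \<open>X\<close> on the right turns \<^const>\<open>interchange\<close> and all
  symmetries into whiskered instances of \<^const>\<open>swp\<close>.\<close>

definition flat :: "'o \<Rightarrow> 'o \<Rightarrow> 'o \<Rightarrow> 'o \<Rightarrow> 'o \<Rightarrow> 'a" where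
  "flat A B D E X = (\<iota> A \<otimes> (\<iota> B \<otimes> \<alpha> D E X)) \<cdot> \<alpha> A B ((D \<odot> E) \<odot> X) \<cdot> \<alpha> (A \<odot> B) (D \<odot> E) X"

lemma flat_simps [simp]:
  assumes [simp]: "A \<in> Obj C" "B \<in> Obj C" "D \<in> Obj C" "E \<in> Obj C" "X \<in> Obj C"
  shows "arr (flat A B D E X)" "Dom C (flat A B D E X) = ((A \<odot> B) \<odot> (D \<odot> E)) \<odot> X"
    "Cod C (flat A B D E X) = A \<odot> (B \<odot> (D \<odot> (E \<odot> X)))" "iso C (flat A B D E X)"
  by (simp_all add: flat_def iso_Cmp Assoc_iso iso_TArr iso_Ide)

lemma flat_itc:
  assumes [simp]: "A \<in> Obj C" "B \<in> Obj C" "D \<in> Obj C" "E \<in> Obj C" "X \<in> Obj C"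
  shows "flat A D B E X \<cdot> (itc A B D E \<otimes> \<iota> X) = (\<iota> A \<otimes> swp B D (E \<odot> X)) \<cdot> flat A B D E X"
proof -
  have "flat A D B E X \<cdot> (itc A B D E \<otimes> \<iota> X)
    = (\<iota> A \<otimes> (\<iota> D \<otimes> \<alpha> B E X)) \<cdot> (\<iota> A \<otimes> \<alpha> D (B \<odot> E) X) \<cdot> \<alpha> A (D \<odot> (B \<odot> E)) X \<cdot>
      ((\<alpha> A D (B \<odot> E) \<cdot> itc A B D E) \<otimes> \<iota> X)"
    by (simp add: flat_def reassoc2[OF pent[symmetric]] merge)
  also have "\<dots> = (\<iota> A \<otimes> (\<iota> D \<otimes> \<alpha> B E X)) \<cdot> (\<iota> A \<otimes> \<alpha> D (B \<odot> E) X) \<cdot>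
      (\<alpha> A (D \<odot> (B \<odot> E)) X \<cdot> ((\<iota> A \<otimes> swp B D E) \<otimes> \<iota> X)) \<cdot> (\<alpha> A B (D \<odot> E) \<otimes> \<iota> X)"
    by (simp add: Assoc_itc split_right)
  also have "\<dots> = (\<iota> A \<otimes> ((\<iota> D \<otimes> \<alpha> B E X) \<cdot> \<alpha> D (B \<odot> E) X \<cdot> (swp B D E \<otimes> \<iota> X))) \<cdot>
      \<alpha> A (B \<odot> (D \<odot> E)) X \<cdot> (\<alpha> A B (D \<odot> E) \<otimes> \<iota> X)"
    by (simp add: reassoc2[OF Assoc_nat] split_left)
  also have "\<dots> = (\<iota> A \<otimes> swp B D (E \<odot> X)) \<cdot> (\<iota> A \<otimes> (\<iota> B \<otimes> \<alpha> D E X)) \<cdot>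
      ((\<iota> A \<otimes> \<alpha> B (D \<odot> E) X) \<cdot> \<alpha> A (B \<odot> (D \<odot> E)) X \<cdot> (\<alpha> A B (D \<odot> E) \<otimes> \<iota> X))"
    unfolding swp_tensor[OF assms(2,3,4,5)] by (simp add: split_left)
  also have "\<dots> = (\<iota> A \<otimes> swp B D (E \<odot> X)) \<cdot> flat A B D E X"
    by (simp add: flat_def pent)
  finally show ?thesis .
qed

text \<open>Exchanging two blocks of length two takes four adjacent swaps: the hexagons resolve
  \<open>swp\<close> in its second argument and then in its first.\<close>

lemma flat_Sym_TObj:
  assumes [simp]: "A \<in> Obj C" "B \<in> Obj C" "A' \<in> Obj C" "B' \<in> Obj C" "X \<in> Obj C"
  shows "flat A' B' A B X \<cdot> (\<sigma> (A \<odot> B) (A' \<odot> B') \<otimes> \<iota> X) =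
    (\<iota> A' \<otimes> swp A B' (B \<odot> X)) \<cdot> (\<iota> A' \<otimes> (\<iota> A \<otimes> swp B B' X)) \<cdot>
    swp A A' (B \<odot> (B' \<odot> X)) \<cdot> (\<iota> A \<otimes> swp B A' (B' \<odot> X)) \<cdot> flat A B A' B' X"
proof -
  have "flat A' B' A B X \<cdot> (\<sigma> (A \<odot> B) (A' \<odot> B') \<otimes> \<iota> X)
    = (\<iota> A' \<otimes> (\<iota> B' \<otimes> \<alpha> A B X)) \<cdot> (\<alpha> A' B' ((A \<odot> B) \<odot> X) \<cdot> swp (A \<odot> B) (A' \<odot> B') X) \<cdot>
      \<alpha> (A \<odot> B) (A' \<odot> B') X"
    by (simp add: flat_def swp_Assoc)
  also have "\<dots> = (\<iota> A' \<otimes> ((\<iota> B' \<otimes> \<alpha> A B X) \<cdot> swp (A \<odot> B) B' X)) \<cdot> swp (A \<odot> B) A' (B' \<odot> X) \<cdot>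
      (\<iota> (A \<odot> B) \<otimes> \<alpha> A' B' X) \<cdot> \<alpha> (A \<odot> B) (A' \<odot> B') X"
    by (simp add: swp_hexagon split_left)
  also have "\<dots> = (\<iota> A' \<otimes> swp A B' (B \<odot> X)) \<cdot> (\<iota> A' \<otimes> (\<iota> A \<otimes> swp B B' X)) \<cdot>
      ((\<iota> A' \<otimes> \<alpha> A B (B' \<odot> X)) \<cdot> swp (A \<odot> B) A' (B' \<odot> X)) \<cdot>
      (\<iota> (A \<odot> B) \<otimes> \<alpha> A' B' X) \<cdot> \<alpha> (A \<odot> B) (A' \<odot> B') X"
    unfolding swp_hexagon'[OF assms(1,2,4,5)] by (simp add: split_left)
  also have "\<dots> = (\<iota> A' \<otimes> swp A B' (B \<odot> X)) \<cdot> (\<iota> A' \<otimes> (\<iota> A \<otimes> swp B B' X)) \<cdot>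
      swp A A' (B \<odot> (B' \<odot> X)) \<cdot> (\<iota> A \<otimes> swp B A' (B' \<odot> X)) \<cdot>
      (\<alpha> A B (A' \<odot> (B' \<odot> X)) \<cdot> ((\<iota> A \<otimes> \<iota> B) \<otimes> \<alpha> A' B' X)) \<cdot> \<alpha> (A \<odot> B) (A' \<odot> B') X"
    by (simp add: swp_hexagon')
  also have "\<dots> = (\<iota> A' \<otimes> swp A B' (B \<odot> X)) \<cdot> (\<iota> A' \<otimes> (\<iota> A \<otimes> swp B B' X)) \<cdot>
      swp A A' (B \<odot> (B' \<odot> X)) \<cdot> (\<iota> A \<otimes> swp B A' (B' \<odot> X)) \<cdot> flat A B A' B' X"
    by (simp add: flat_def reassoc2[OF Assoc_nat] del: TArr_Ide')
  finally show ?thesis .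
qed

lemma flat_Sym_TArr:
  assumes [simp]: "A \<in> Obj C" "B \<in> Obj C" "A' \<in> Obj C" "B' \<in> Obj C" "X \<in> Obj C"
  shows "flat A' A B' B X \<cdot> ((\<sigma> A A' \<otimes> \<sigma> B B') \<otimes> \<iota> X) =
    swp A A' (B' \<odot> (B \<odot> X)) \<cdot> (\<iota> A \<otimes> (\<iota> A' \<otimes> swp B B' X)) \<cdot> flat A A' B B' X"
proof -
  have "flat A' A B' B X \<cdot> ((\<sigma> A A' \<otimes> \<sigma> B B') \<otimes> \<iota> X)
    = (\<iota> A' \<otimes> (\<iota> A \<otimes> \<alpha> B' B X)) \<cdot> \<alpha> A' A ((B' \<odot> B) \<odot> X) \<cdot> (\<sigma> A A' \<otimes> \<iota> ((B' \<odot> B) \<odot> X)) \<cdot>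
      ((\<iota> A \<otimes> \<iota> A') \<otimes> (\<sigma> B B' \<otimes> \<iota> X)) \<cdot> \<alpha> (A \<odot> A') (B \<odot> B') X"
    by (simp add: flat_def Assoc_nat merge')
  also have "\<dots> = ((\<iota> A' \<otimes> (\<iota> A \<otimes> \<alpha> B' B X)) \<cdot> swp A A' ((B' \<odot> B) \<odot> X)) \<cdot> \<alpha> A A' ((B' \<odot> B) \<odot> X) \<cdot>
      ((\<iota> A \<otimes> \<iota> A') \<otimes> (\<sigma> B B' \<otimes> \<iota> X)) \<cdot> \<alpha> (A \<odot> A') (B \<odot> B') X"
    by (simp add: reassoc2[OF swp_Assoc])
  also have "\<dots> = swp A A' (B' \<odot> (B \<odot> X)) \<cdot> (\<iota> A \<otimes> (\<iota> A' \<otimes> \<alpha> B' B X)) \<cdot>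
      (\<alpha> A A' ((B' \<odot> B) \<odot> X) \<cdot> ((\<iota> A \<otimes> \<iota> A') \<otimes> (\<sigma> B B' \<otimes> \<iota> X))) \<cdot> \<alpha> (A \<odot> A') (B \<odot> B') X"
    by (simp add: swp_nat[symmetric])
  also have "\<dots> = swp A A' (B' \<odot> (B \<odot> X)) \<cdot> (\<iota> A \<otimes> (\<iota> A' \<otimes> (\<alpha> B' B X \<cdot> (\<sigma> B B' \<otimes> \<iota> X)))) \<cdot>
      \<alpha> A A' ((B \<odot> B') \<odot> X) \<cdot> \<alpha> (A \<odot> A') (B \<odot> B') X"
    by (simp add: reassoc2[OF Assoc_nat] split_left del: TArr_Ide')
  also have "\<dots> = swp A A' (B' \<odot> (B \<odot> X)) \<cdot> (\<iota> A \<otimes> (\<iota> A' \<otimes> swp B B' X)) \<cdot> flat A A' B B' X"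
    by (simp add: flat_def swp_Assoc[symmetric] split_left)
  finally show ?thesis .
qed

text \<open>Both sides become words in adjacent swaps. The swap inside the interchange cancels
  against its inverse in the block exchange, and the swaps of \<open>A\<close> with
  \<open>A'\<close> and of \<open>B\<close> with \<open>B'\<close> commute. The spare factor is
  \<open>\<one>\<close>, since tensoring with \<open>\<one>\<close> can be undone.\<close>

lemma Sym_itc:
  assumes [simp]: "A \<in> Obj C" "A' \<in> Obj C" "B \<in> Obj C" "B' \<in> Obj C"
  shows "\<sigma> (A \<odot> B) (A' \<odot> B') \<cdot> itc A A' B B' = itc A' A B' B \<cdot> (\<sigma> A A' \<otimes> \<sigma> B B')"
proof (rule TArr_Unit_faithful, rule iso_cancel_left[of "flat A' B' A B \<one>"])
  let ?X = "\<one>"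
  have "flat A' B' A B ?X \<cdot> ((\<sigma> (A \<odot> B) (A' \<odot> B') \<cdot> itc A A' B B') \<otimes> \<iota> ?X)
    = (flat A' B' A B ?X \<cdot> (\<sigma> (A \<odot> B) (A' \<odot> B') \<otimes> \<iota> ?X)) \<cdot> (itc A A' B B' \<otimes> \<iota> ?X)"
    by (simp add: split_right)
  also have "\<dots> = (\<iota> A' \<otimes> swp A B' (B \<odot> ?X)) \<cdot> (\<iota> A' \<otimes> (\<iota> A \<otimes> swp B B' ?X)) \<cdot>
      swp A A' (B \<odot> (B' \<odot> ?X)) \<cdot> flat A A' B B' ?X"
    unfolding flat_Sym_TObj[OF assms(1,3,2,4) Unit_Obj]
    by (simp add: flat_itc merge' swp_swp)
  also have "\<dots> = (\<iota> A' \<otimes> swp A B' (B \<odot> ?X)) \<cdot> swp A A' (B' \<odot> (B \<odot> ?X)) \<cdot>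
      (\<iota> A \<otimes> (\<iota> A' \<otimes> swp B B' ?X)) \<cdot> flat A A' B B' ?X"
    by (simp add: reassoc2[OF swp_nat])
  also have "\<dots> = (\<iota> A' \<otimes> swp A B' (B \<odot> ?X)) \<cdot> flat A' A B' B ?X \<cdot> ((\<sigma> A A' \<otimes> \<sigma> B B') \<otimes> \<iota> ?X)"
    by (simp add: flat_Sym_TArr)
  also have "\<dots> = flat A' B' A B ?X \<cdot> ((itc A' A B' B \<cdot> (\<sigma> A A' \<otimes> \<sigma> B B')) \<otimes> \<iota> ?X)"
    by (simp add: split_right reassoc2[OF flat_itc])
  finally show "flat A' B' A B ?X \<cdot> ((\<sigma> (A \<odot> B) (A' \<odot> B') \<cdot> itc A A' B B') \<otimes> \<iota> ?X) = \<dots>" .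
qed simp_all

text \<open>\<open>Sym_itc\<close> conjugated by the interchange, which is inverted by another
  interchange.\<close>

lemma itc_Sym:
  assumes [simp]: "A \<in> Obj C" "A' \<in> Obj C" "B \<in> Obj C" "B' \<in> Obj C"
  shows "itc B B' A A' \<cdot> \<sigma> (A \<odot> A') (B \<odot> B') = (\<sigma> A B \<otimes> \<sigma> A' B') \<cdot> itc A A' B B'"
proof -
  have "itc B B' A A' \<cdot> \<sigma> (A \<odot> A') (B \<odot> B')
    = itc B B' A A' \<cdot> (\<sigma> (A \<odot> A') (B \<odot> B') \<cdot> itc A B A' B') \<cdot> itc A A' B B'"
    by (simp add: itc_itc)
  also have "\<dots> = (\<sigma> A B \<otimes> \<sigma> A' B') \<cdot> itc A A' B B'"
    by (simp add: Sym_itc reassoc2[OF itc_itc])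
  finally show ?thesis .
qed

end

section \<open>The cartesian category of cocommutative comonoids\<close>

record ('o, 'a) comon =
  Ob :: 'o
  Del :: 'a
  Eps :: 'a

context symmetric_monoidal_category
begin

definition coc :: "('o, 'a) comon \<Rightarrow> bool" where
  "coc T \<longleftrightarrow> is_comonoid C (Ob T) (Del T) (Eps T) \<and> \<sigma> (Ob T) (Ob T) \<cdot> Del T = Del T"

definition cmor :: "('o, 'a) comon \<Rightarrow> ('o, 'a) comon \<Rightarrow> 'a \<Rightarrow> bool" where
  "cmor T U f \<longleftrightarrow> f \<in> hom C (Ob T) (Ob U) \<and> Del U \<cdot> f = (f \<otimes> f) \<cdot> Del T \<and> Eps U \<cdot> f = Eps T"

text \<open>Arbitrary arrows out of \<open>T\<close> may be paired, not only comonoid morphisms.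
  Compatibility with counits is required only when a component is to be recovered by
  projecting.\<close>

definition pr :: "('o, 'a) comon \<Rightarrow> 'a \<Rightarrow> 'a \<Rightarrow> 'a" where
  "pr T x y = (x \<otimes> y) \<cdot> Del T"

lemma coc_simps [simp]:
  assumes "coc T"
  shows "Ob T \<in> Obj C" "arr (Del T)" "Dom C (Del T) = Ob T" "Cod C (Del T) = Ob T \<odot> Ob T"
    "arr (Eps T)" "Dom C (Eps T) = Ob T" "Cod C (Eps T) = \<one>"
    "\<sigma> (Ob T) (Ob T) \<cdot> Del T = Del T"
  using assms by (auto simp: coc_def is_comonoid_def hom_def)

lemma coc_eqs:
  assumes "coc T"
  shows "\<alpha> (Ob T) (Ob T) (Ob T) \<cdot> (Del T \<otimes> \<iota> (Ob T)) \<cdot> Del T = (\<iota> (Ob T) \<otimes> Del T) \<cdot> Del T"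
    "\<ll> (Ob T) \<cdot> (Eps T \<otimes> \<iota> (Ob T)) \<cdot> Del T = \<iota> (Ob T)"
    "\<rr> (Ob T) \<cdot> (\<iota> (Ob T) \<otimes> Eps T) \<cdot> Del T = \<iota> (Ob T)"
  using assms unfolding coc_def is_comonoid_def by blast+

text \<open>Cocommutativity turns the left counit law into the right one, so constructions of
  comonoids have one law less to verify.\<close>

lemma cocI:
  assumes "A \<in> Obj C" "arr d" "Dom C d = A" "Cod C d = A \<odot> A" "arr e" "Dom C e = A" "Cod C e = \<one>"
    and "\<alpha> A A A \<cdot> (d \<otimes> \<iota> A) \<cdot> d = (\<iota> A \<otimes> d) \<cdot> d"
    and l: "\<ll> A \<cdot> (e \<otimes> \<iota> A) \<cdot> d = \<iota> A"
    and s: "\<sigma> A A \<cdot> d = d"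
  shows "coc \<lparr>Ob = A, Del = d, Eps = e\<rparr>"
proof -
  have "\<rr> A \<cdot> (\<iota> A \<otimes> e) \<cdot> d = \<ll> A \<cdot> \<sigma> A \<one> \<cdot> (\<iota> A \<otimes> e) \<cdot> d"
    using assms(1-7) by (simp add: reassoc2[OF LUnit_Sym])
  also have "\<dots> = \<ll> A \<cdot> (e \<otimes> \<iota> A) \<cdot> \<sigma> A A \<cdot> d"
    using assms(1-7) by (simp add: reassoc2[OF Sym_nat])
  finally show ?thesis
    using assms unfolding coc_def is_comonoid_def hom_def by simp
qed

lemma cmor_simps:
  assumes "cmor T U f"
  shows "arr f" "Dom C f = Ob T" "Cod C f = Ob U" "Eps U \<cdot> f = Eps T"
  using assms by (auto simp: cmor_def hom_def)

lemma cmor_Del: "cmor T U f \<Longrightarrow> Del U \<cdot> f = (f \<otimes> f) \<cdot> Del T"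
  by (simp add: cmor_def)

lemma cmor_Ide: "coc T \<Longrightarrow> cmor T T (\<iota> (Ob T))"
  by (simp add: cmor_def hom_def)

lemma cmor_Cmp:
  assumes "cmor T U f" "cmor U V g" "coc T" "coc U" "coc V"
  shows "cmor T V (g \<cdot> f)"
proof -
  note s [simp] = cmor_simps[OF assms(1)] cmor_simps[OF assms(2)]
  show ?thesis
    unfolding cmor_def in_hom_iff using assms(3-5)
    by (simp add: reassoc2[OF cmor_Del[OF assms(2)]] cmor_Del[OF assms(1)] merge' reassoc2[OF s(8)])
qed

lemma pr_simps [simp]:
  assumes "coc T" "arr x" "arr y" "Dom C x = Ob T" "Dom C y = Ob T"
  shows "arr (pr T x y)" "Dom C (pr T x y) = Ob T" "Cod C (pr T x y) = Cod C x \<odot> Cod C y"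
  using assms by (simp_all add: pr_def)

lemma TArr_pr:
  assumes "coc T" "arr x" "arr y" "Dom C x = Ob T" "Dom C y = Ob T" "arr f" "arr g"
    "Dom C f = Cod C x" "Dom C g = Cod C y"
  shows "(f \<otimes> g) \<cdot> pr T x y = pr T (f \<cdot> x) (g \<cdot> y)"
  using assms by (simp add: pr_def merge')

lemma pr_cmor:
  assumes "cmor T U h" "coc T" "coc U" "arr x" "arr y" "Dom C x = Ob U" "Dom C y = Ob U"
  shows "pr U x y \<cdot> h = pr T (x \<cdot> h) (y \<cdot> h)"
  using assms cmor_simps[OF assms(1)] by (simp add: pr_def cmor_Del[OF assms(1)] merge')

lemma cmor_Del_pr: "cmor T U f \<Longrightarrow> Del U \<cdot> f = pr T f f"
  by (simp add: cmor_Del pr_def)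

text \<open>Coassociativity of \<open>T\<close> becomes rebracketing of tuples, as cocommutativity
  becomes exchange of entries in \<open>Sym_pr\<close>. Coherence maps thus act on tuples by
  rewriting, and \<open>itc_pr\<close> already follows in this way.\<close>

lemma Assoc_pr:
  assumes "coc T" "arr x" "arr y" "arr z" "Dom C x = Ob T" "Dom C y = Ob T" "Dom C z = Ob T"
    "Cod C x = A" "Cod C y = B" "Cod C z = D"
  shows "\<alpha> A B D \<cdot> pr T (pr T x y) z = pr T x (pr T y z)"
proof -
  have [simp]: "A \<in> Obj C" "B \<in> Obj C" "D \<in> Obj C"
    using assms by auto
  have "\<alpha> A B D \<cdot> pr T (pr T x y) z = \<alpha> A B D \<cdot> ((x \<otimes> y) \<otimes> z) \<cdot> (Del T \<otimes> \<iota> (Ob T)) \<cdot> Del T"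
    using assms by (simp add: pr_def merge')
  also have "\<dots> = (x \<otimes> (y \<otimes> z)) \<cdot> \<alpha> (Ob T) (Ob T) (Ob T) \<cdot> (Del T \<otimes> \<iota> (Ob T)) \<cdot> Del T"
    using assms by (simp add: reassoc2[OF Assoc_nat])
  also have "\<dots> = pr T x (pr T y z)"
    using assms by (simp add: coc_eqs pr_def merge')
  finally show ?thesis .
qed

lemma Assoc_inv_pr:
  assumes "coc T" "arr x" "arr y" "arr z" "Dom C x = Ob T" "Dom C y = Ob T" "Dom C z = Ob T"
    "Cod C x = A" "Cod C y = B" "Cod C z = D"
  shows "ai A B D \<cdot> pr T x (pr T y z) = pr T (pr T x y) z"
proof -
  have [simp]: "A \<in> Obj C" "B \<in> Obj C" "D \<in> Obj C"
    using assms by auto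
  show ?thesis
    using assms(1-7) by (simp add: Assoc_pr[OF assms, symmetric] reassoc2[OF Assoc_simps(7)] assms(8-10))
qed

lemma Sym_pr:
  assumes "coc T" "arr x" "arr y" "Dom C x = Ob T" "Dom C y = Ob T" "Cod C x = A" "Cod C y = B"
  shows "\<sigma> A B \<cdot> pr T x y = pr T y x"
proof -
  have [simp]: "A \<in> Obj C" "B \<in> Obj C"
    using assms by auto
  show ?thesis
    using assms by (simp add: pr_def reassoc2[OF Sym_nat])
qed

lemma itc_pr:
  assumes "coc T" "arr x" "arr y" "arr z" "arr w" "Dom C x = Ob T" "Dom C y = Ob T" "Dom C z = Ob T"
    "Dom C w = Ob T" "Cod C x = A" "Cod C y = B" "Cod C z = D" "Cod C w = E"
  shows "itc A B D E \<cdot> pr T (pr T x y) (pr T z w) = pr T (pr T x z) (pr T y w)"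
proof -
  have [simp]: "A \<in> Obj C" "B \<in> Obj C" "D \<in> Obj C" "E \<in> Obj C"
    using assms by auto
  show ?thesis
    using assms by (simp add: itc_eq swp_def Assoc_pr Assoc_inv_pr TArr_pr Sym_pr)
qed

section \<open>Products of cocommutative comonoids\<close>

definition tns :: "('o, 'a) comon \<Rightarrow> ('o, 'a) comon \<Rightarrow> ('o, 'a) comon" where
  "tns T U = \<lparr>Ob = Ob T \<odot> Ob U, Del = itc (Ob T) (Ob T) (Ob U) (Ob U) \<cdot> (Del T \<otimes> Del U),
     Eps = \<ll> \<one> \<cdot> (Eps T \<otimes> Eps U)\<rparr>"

definition proj1 :: "('o, 'a) comon \<Rightarrow> ('o, 'a) comon \<Rightarrow> 'a" where
  "proj1 T U = \<rr> (Ob T) \<cdot> (\<iota> (Ob T) \<otimes> Eps U)"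

definition proj2 :: "('o, 'a) comon \<Rightarrow> ('o, 'a) comon \<Rightarrow> 'a" where
  "proj2 T U = \<ll> (Ob U) \<cdot> (Eps T \<otimes> \<iota> (Ob U))"

lemma Ob_tns [simp]: "Ob (tns T U) = Ob T \<odot> Ob U"
  by (simp add: tns_def)

lemma coc_tns [simp]:
  assumes [simp]: "coc T" "coc U"
  shows "coc (tns T U)"
  unfolding tns_def
proof (rule cocI)
  let ?A = "Ob T" and ?B = "Ob U"
  let ?i = "itc ?A ?A ?B ?B" and ?d = "Del T \<otimes> Del U"
  \<comment> \<open>\<open>n1\<close> and \<open>n2\<close> slide the interchange past a
    comultiplication or counit acting on one of the two copies, so that it meets the second
    interchange or the unitors and \<open>itc_Assoc\<close> or \<open>itc_Unit\<close>
    applies.\<close>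
  have n1: "itc (?A \<odot> ?A) ?A (?B \<odot> ?B) ?B \<cdot> ((Del T \<otimes> \<iota> ?A) \<otimes> (Del U \<otimes> \<iota> ?B))
    = ((Del T \<otimes> Del U) \<otimes> (\<iota> ?A \<otimes> \<iota> ?B)) \<cdot> ?i"
    by (rule itc_nat) simp_all
  have n2: "itc \<one> ?A \<one> ?B \<cdot> ((Eps T \<otimes> \<iota> ?A) \<otimes> (Eps U \<otimes> \<iota> ?B))
    = ((Eps T \<otimes> Eps U) \<otimes> (\<iota> ?A \<otimes> \<iota> ?B)) \<cdot> ?i"
    by (rule itc_nat) simp_all
  have "\<alpha> (?A \<odot> ?B) (?A \<odot> ?B) (?A \<odot> ?B) \<cdot> ((?i \<cdot> ?d) \<otimes> \<iota> (?A \<odot> ?B)) \<cdot> ?i \<cdot> ?d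
    = \<alpha> (?A \<odot> ?B) (?A \<odot> ?B) (?A \<odot> ?B) \<cdot> (?i \<otimes> \<iota> (?A \<odot> ?B)) \<cdot>
      (((Del T \<otimes> Del U) \<otimes> (\<iota> ?A \<otimes> \<iota> ?B)) \<cdot> ?i) \<cdot> ?d"
    by (simp add: split_right)
  also have "\<dots> = (\<alpha> (?A \<odot> ?B) (?A \<odot> ?B) (?A \<odot> ?B) \<cdot> (?i \<otimes> \<iota> (?A \<odot> ?B)) \<cdot>
      itc (?A \<odot> ?A) ?A (?B \<odot> ?B) ?B) \<cdot> ((Del T \<otimes> \<iota> ?A) \<otimes> (Del U \<otimes> \<iota> ?B)) \<cdot> ?d"
    unfolding n1[symmetric] by simp
  also have "\<dots> = (\<iota> (?A \<odot> ?B) \<otimes> ?i) \<cdot> itc ?A (?A \<odot> ?A) ?B (?B \<odot> ?B) \<cdot>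
      ((\<iota> ?A \<otimes> Del T) \<otimes> (\<iota> ?B \<otimes> Del U)) \<cdot> ?d"
    by (simp add: itc_Assoc merge merge' coc_eqs)
  also have "\<dots> = (\<iota> (?A \<odot> ?B) \<otimes> ?i) \<cdot> ((\<iota> ?A \<otimes> \<iota> ?B) \<otimes> ?d) \<cdot> ?i \<cdot> ?d"
    by (simp add: reassoc2[OF itc_nat] del: TArr_Ide')
  also have "\<dots> = (\<iota> (?A \<odot> ?B) \<otimes> (?i \<cdot> ?d)) \<cdot> ?i \<cdot> ?d"
    by (simp add: split_left)
  finally show "\<alpha> (?A \<odot> ?B) (?A \<odot> ?B) (?A \<odot> ?B) \<cdot> ((?i \<cdot> ?d) \<otimes> \<iota> (?A \<odot> ?B)) \<cdot> ?i \<cdot> ?d = \<dots>" .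
  have "\<ll> (?A \<odot> ?B) \<cdot> ((\<ll> \<one> \<cdot> (Eps T \<otimes> Eps U)) \<otimes> \<iota> (?A \<odot> ?B)) \<cdot> ?i \<cdot> ?d
    = \<ll> (?A \<odot> ?B) \<cdot> (\<ll> \<one> \<otimes> \<iota> (?A \<odot> ?B)) \<cdot>
      (((Eps T \<otimes> Eps U) \<otimes> (\<iota> ?A \<otimes> \<iota> ?B)) \<cdot> ?i) \<cdot> ?d"
    by (simp add: split_right)
  also have "\<dots> = (\<ll> (?A \<odot> ?B) \<cdot> (\<ll> \<one> \<otimes> \<iota> (?A \<odot> ?B)) \<cdot> itc \<one> ?A \<one> ?B) \<cdot>
      ((Eps T \<otimes> \<iota> ?A) \<otimes> (Eps U \<otimes> \<iota> ?B)) \<cdot> ?d"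
    unfolding n2[symmetric] by simp
  also have "\<dots> = \<iota> (?A \<odot> ?B)"
    unfolding itc_Unit[OF coc_simps(1)[OF assms(1)] coc_simps(1)[OF assms(2)]]
    by (simp add: merge coc_eqs)
  finally show "\<ll> (?A \<odot> ?B) \<cdot> ((\<ll> \<one> \<cdot> (Eps T \<otimes> Eps U)) \<otimes> \<iota> (?A \<odot> ?B)) \<cdot> ?i \<cdot> ?d = \<iota> (?A \<odot> ?B)" .
  show "\<sigma> (?A \<odot> ?B) (?A \<odot> ?B) \<cdot> ?i \<cdot> ?d = ?i \<cdot> ?d"
    by (simp add: reassoc2[OF Sym_itc] merge)
qed simp_all

lemma tns_eqs:
  "Del (tns T U) = itc (Ob T) (Ob T) (Ob U) (Ob U) \<cdot> (Del T \<otimes> Del U)"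
  "Eps (tns T U) = \<ll> \<one> \<cdot> (Eps T \<otimes> Eps U)"
  by (simp_all add: tns_def)

lemma proj_simps [simp]:
  assumes [simp]: "coc T" "coc U"
  shows "arr (proj1 T U)" "Dom C (proj1 T U) = Ob T \<odot> Ob U" "Cod C (proj1 T U) = Ob T"
    "arr (proj2 T U)" "Dom C (proj2 T U) = Ob T \<odot> Ob U" "Cod C (proj2 T U) = Ob U"
  by (simp_all add: proj1_def proj2_def)

text \<open>The first leg of the duplication is discarded; naturality of the unitor moves the second
  counit out, and the counit law removes the duplication.\<close>

lemma Eps_pr:
  assumes [simp]: "coc T" shows "\<ll> \<one> \<cdot> pr T (Eps T) (Eps T) = Eps T"
proof -
  have "\<ll> \<one> \<cdot> pr T (Eps T) (Eps T) = \<ll> \<one> \<cdot> (\<iota> \<one> \<otimes> Eps T) \<cdot> (Eps T \<otimes> \<iota> (Ob T)) \<cdot> Del T"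
    by (simp add: pr_def merge')
  also have "\<dots> = Eps T \<cdot> \<ll> (Ob T) \<cdot> (Eps T \<otimes> \<iota> (Ob T)) \<cdot> Del T"
    by (simp add: reassoc2[OF LUnit_nat])
  finally show ?thesis
    by (simp add: coc_eqs)
qed

lemma cmor_proj2:
  assumes [simp]: "coc T" "coc U"
  shows "cmor (tns T U) U (proj2 T U)"
proof -
  let ?A = "Ob T" and ?B = "Ob U"
  \<comment> \<open>\<open>itc_Unit\<close> solved for the unitors on the other side, using that the
    interchange is undone by an interchange.\<close>
  have l: "(\<ll> ?B \<otimes> \<ll> ?B) \<cdot> itc \<one> \<one> ?B ?B = \<ll> (?B \<odot> ?B) \<cdot> (\<ll> \<one> \<otimes> \<iota> (?B \<odot> ?B))"
    by (simp add: itc_Unit[symmetric] itc_itc)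
  have n3: "itc \<one> \<one> ?B ?B \<cdot> ((Eps T \<otimes> Eps T) \<otimes> (\<iota> ?B \<otimes> \<iota> ?B))
    = ((Eps T \<otimes> \<iota> ?B) \<otimes> (Eps T \<otimes> \<iota> ?B)) \<cdot> itc ?A ?A ?B ?B"
    by (rule itc_nat) simp_all
  have e: "\<ll> \<one> \<cdot> (Eps T \<otimes> Eps T) \<cdot> Del T = Eps T"
    using Eps_pr[of T] by (simp add: pr_def)
  have "(proj2 T U \<otimes> proj2 T U) \<cdot> Del (tns T U)
    = (\<ll> ?B \<otimes> \<ll> ?B) \<cdot> (((Eps T \<otimes> \<iota> ?B) \<otimes> (Eps T \<otimes> \<iota> ?B)) \<cdot> itc ?A ?A ?B ?B) \<cdot> (Del T \<otimes> Del U)"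
    by (simp add: proj2_def tns_eqs merge')
  also have "\<dots> = ((\<ll> ?B \<otimes> \<ll> ?B) \<cdot> itc \<one> \<one> ?B ?B) \<cdot> ((Eps T \<otimes> Eps T) \<otimes> (\<iota> ?B \<otimes> \<iota> ?B)) \<cdot> (Del T \<otimes> Del U)"
    unfolding n3[symmetric] by simp
  also have "\<dots> = \<ll> (?B \<odot> ?B) \<cdot> (Eps T \<otimes> Del U)"
    unfolding l by (simp add: merge e)
  also have "\<dots> = Del U \<cdot> proj2 T U"
  proof -
    have "Eps T \<otimes> Del U = (\<iota> \<one> \<otimes> Del U) \<cdot> (Eps T \<otimes> \<iota> ?B)"
      by (simp add: merge)
    then show ?thesis
      by (simp add: proj2_def reassoc2[OF LUnit_nat])
  qed
  finally have 1: "Del U \<cdot> proj2 T U = (proj2 T U \<otimes> proj2 T U) \<cdot> Del (tns T U)" ..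
  have "Eps U \<cdot> proj2 T U = \<ll> \<one> \<cdot> (\<iota> \<one> \<otimes> Eps U) \<cdot> (Eps T \<otimes> \<iota> ?B)"
    by (simp add: proj2_def reassoc2[OF LUnit_nat])
  also have "\<dots> = Eps (tns T U)"
    by (simp add: tns_eqs merge)
  finally show ?thesis
    using 1 by (simp add: cmor_def in_hom_iff)
qed

lemma cmor_Sym:
  assumes [simp]: "coc T" "coc U"
  shows "cmor (tns T U) (tns U T) (\<sigma> (Ob T) (Ob U))"
proof -
  let ?A = "Ob T" and ?B = "Ob U"
  have "\<ll> \<one> \<cdot> (Eps U \<otimes> Eps T) \<cdot> \<sigma> ?A ?B = \<ll> \<one> \<cdot> (Eps T \<otimes> Eps U)"
    by (simp add: Sym_nat[symmetric] Sym_Unit)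
  moreover have "itc ?B ?B ?A ?A \<cdot> (Del U \<otimes> Del T) \<cdot> \<sigma> ?A ?B =
      (\<sigma> ?A ?B \<otimes> \<sigma> ?A ?B) \<cdot> itc ?A ?A ?B ?B \<cdot> (Del T \<otimes> Del U)"
    by (simp add: Sym_nat[symmetric] reassoc2[OF itc_Sym])
  ultimately show ?thesis
    by (simp add: cmor_def in_hom_iff tns_eqs)
qed

text \<open>The symmetry is a comonoid morphism, so this reduces the first projection to the second
  and only one of them is checked directly.\<close>

lemma proj1_Sym: "coc T \<Longrightarrow> coc U \<Longrightarrow> proj1 T U = proj2 U T \<cdot> \<sigma> (Ob T) (Ob U)"
  by (simp add: proj1_def proj2_def Sym_nat[symmetric] reassoc2[OF LUnit_Sym])

lemma cmor_proj1: "coc T \<Longrightarrow> coc U \<Longrightarrow> cmor (tns T U) T (proj1 T U)"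
  unfolding proj1_Sym by (rule cmor_Cmp[OF cmor_Sym cmor_proj2]) simp_all

text \<open>Surjective pairing. Each object is duplicated and one copy discarded, which leaves two
  units in the middle; there the interchange is an identity and the counit laws finish.\<close>

lemma pr_proj:
  assumes [simp]: "coc T" "coc U"
  shows "pr (tns T U) (proj1 T U) (proj2 T U) = \<iota> (Ob T \<odot> Ob U)"
proof -
  let ?A = "Ob T" and ?B = "Ob U"
  have n: "itc ?A \<one> \<one> ?B \<cdot> ((\<iota> ?A \<otimes> Eps T) \<otimes> (Eps U \<otimes> \<iota> ?B)) = ((\<iota> ?A \<otimes> Eps U) \<otimes> (Eps T \<otimes> \<iota> ?B)) \<cdot> itc ?A ?A ?B ?B"
    by (rule itc_nat) simp_all
  have "pr (tns T U) (proj1 T U) (proj2 T U)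
    = (\<rr> ?A \<otimes> \<ll> ?B) \<cdot> (((\<iota> ?A \<otimes> Eps U) \<otimes> (Eps T \<otimes> \<iota> ?B)) \<cdot> itc ?A ?A ?B ?B) \<cdot> (Del T \<otimes> Del U)"
    by (simp add: pr_def proj1_def proj2_def tns_eqs merge')
  also have "\<dots> = \<iota> (Ob T \<odot> Ob U)"
    unfolding n[symmetric] by (simp add: itc_Unit_mid merge coc_eqs)
  finally show ?thesis .
qed

lemma proj_pr:
  assumes [simp]: "coc T" "coc U" "coc V" "arr x" "arr y" "Dom C x = Ob T" "Dom C y = Ob T"
    "Cod C x = Ob U" "Cod C y = Ob V"
  shows "Eps V \<cdot> y = Eps T \<Longrightarrow> proj1 U V \<cdot> pr T x y = x"
    "Eps U \<cdot> x = Eps T \<Longrightarrow> proj2 U V \<cdot> pr T x y = y"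
proof -
  assume [simp]: "Eps V \<cdot> y = Eps T"
  have "proj1 U V \<cdot> pr T x y = \<rr> (Ob U) \<cdot> (x \<otimes> \<iota> \<one>) \<cdot> (\<iota> (Ob T) \<otimes> Eps T) \<cdot> Del T"
    by (simp add: proj1_def pr_def merge')
  also have "\<dots> = x \<cdot> \<rr> (Ob T) \<cdot> (\<iota> (Ob T) \<otimes> Eps T) \<cdot> Del T"
    by (simp add: reassoc2[OF RUnit_nat])
  finally show "proj1 U V \<cdot> pr T x y = x"
    by (simp add: coc_eqs)
next
  assume [simp]: "Eps U \<cdot> x = Eps T"
  have "proj2 U V \<cdot> pr T x y = \<ll> (Ob V) \<cdot> (\<iota> \<one> \<otimes> y) \<cdot> (Eps T \<otimes> \<iota> (Ob T)) \<cdot> Del T"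
    by (simp add: proj2_def pr_def merge')
  also have "\<dots> = y \<cdot> \<ll> (Ob T) \<cdot> (Eps T \<otimes> \<iota> (Ob T)) \<cdot> Del T"
    by (simp add: reassoc2[OF LUnit_nat])
  finally show "proj2 U V \<cdot> pr T x y = y"
    by (simp add: coc_eqs)
qed

text \<open>Cocommutativity of \<open>T\<close> enters here: comultiplying the pair entrywise gives
  \<open>((f, f), (g, g))\<close>, duplicating the pair gives \<open>((f, g), (f, g))\<close>, and
  \<open>itc_pr\<close> exchanges the middle entries.\<close>

lemma cmor_pr:
  assumes [simp]: "coc T" "coc U" "coc V" and f: "cmor T U f" and g: "cmor T V g"
  shows "cmor T (tns U V) (pr T f g)"
proof -
  note [simp] = cmor_simps[OF f] cmor_simps[OF g]
  have "Del (tns U V) \<cdot> pr T f g = pr T (pr T f g) (pr T f g)"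
    by (simp add: tns_eqs TArr_pr cmor_Del_pr[OF f] cmor_Del_pr[OF g] itc_pr)
  moreover have "Eps (tns U V) \<cdot> pr T f g = Eps T"
    by (simp add: tns_eqs TArr_pr Eps_pr)
  ultimately show ?thesis
    by (simp add: cmor_def in_hom_iff) (simp add: pr_def)
qed

lemma pr_eta:
  assumes [simp]: "coc T" "coc U" "coc V" and h: "cmor T (tns U V) h"
  shows "pr T (proj1 U V \<cdot> h) (proj2 U V \<cdot> h) = h"
  using pr_cmor[OF h, of "proj1 U V" "proj2 U V"] cmor_simps[OF h] by (simp add: pr_proj)

lemma TArr_eq_pr:
  assumes [simp]: "coc T" "coc U" "arr f" "arr g" "Dom C f = Ob T" "Dom C g = Ob U"
  shows "f \<otimes> g = pr (tns T U) (f \<cdot> proj1 T U) (g \<cdot> proj2 T U)"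
  using TArr_pr[of "tns T U" "proj1 T U" "proj2 T U" f g] by (simp add: pr_proj)

lemma cmor_TArr:
  assumes [simp]: "coc T" "coc U" "coc T'" "coc U'" and f: "cmor T T' f" and g: "cmor U U' g"
  shows "cmor (tns T U) (tns T' U') (f \<otimes> g)"
proof -
  note [simp] = cmor_simps[OF f] cmor_simps[OF g]
  show ?thesis
    unfolding TArr_eq_pr[OF assms(1,2) cmor_simps(1)[OF f] cmor_simps(1)[OF g] cmor_simps(2)[OF f] cmor_simps(2)[OF g]]
    by (intro cmor_pr cmor_Cmp[OF cmor_proj1 f] cmor_Cmp[OF cmor_proj2 g]) simp_all
qed

text \<open>The terminal object: a comonoid morphism from \<open>T\<close> to it can only be
  \<open>Eps T\<close>, so the unit of a Hopf monoid is a global element.\<close>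

definition unit_comon :: "('o, 'a) comon" where
  "unit_comon = \<lparr>Ob = \<one>, Del = inv_arrow C (\<ll> \<one>), Eps = \<iota> \<one>\<rparr>"

lemma unit_comon_simps [simp]: "Ob unit_comon = \<one>" "Eps unit_comon = \<iota> \<one>"
  by (simp_all add: unit_comon_def)

lemma LUnit_inv [simp]:
  assumes "A \<in> Obj C"
  shows "arr (inv_arrow C (\<ll> A))" "Dom C (inv_arrow C (\<ll> A)) = A" "Cod C (inv_arrow C (\<ll> A)) = \<one> \<odot> A"
    "inv_arrow C (\<ll> A) \<cdot> \<ll> A = \<iota> (\<one> \<odot> A)" "\<ll> A \<cdot> inv_arrow C (\<ll> A) = \<iota> A"
  using inv_arrow_simps[OF LUnit_iso[OF assms]] assms by auto

lemma coc_unit_comon [simp]: "coc unit_comon"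
  unfolding unit_comon_def
proof (rule cocI)
  let ?d = "inv_arrow C (\<ll> \<one>)"
  have "\<alpha> \<one> \<one> \<one> \<cdot> (?d \<otimes> \<iota> \<one>) = \<iota> \<one> \<otimes> ?d"
  proof (rule iso_cancel_left[of "\<iota> \<one> \<otimes> \<ll> \<one>"])
    show "(\<iota> \<one> \<otimes> \<ll> \<one>) \<cdot> \<alpha> \<one> \<one> \<one> \<cdot> (?d \<otimes> \<iota> \<one>) = (\<iota> \<one> \<otimes> \<ll> \<one>) \<cdot> (\<iota> \<one> \<otimes> ?d)"
      by (simp add: reassoc2[OF triangle] merge flip: LUnit_Unit)
  qed (simp_all add: iso_TArr iso_Ide LUnit_iso)
  then show "\<alpha> \<one> \<one> \<one> \<cdot> (?d \<otimes> \<iota> \<one>) \<cdot> ?d = (\<iota> \<one> \<otimes> ?d) \<cdot> ?d"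
    by (simp add: reassoc2)
  show "\<sigma> \<one> \<one> \<cdot> inv_arrow C (\<ll> \<one>) = inv_arrow C (\<ll> \<one>)"
    by (simp add: Sym_Unit)
qed simp_all

lemma cmor_Eps:
  assumes [simp]: "coc T" shows "cmor T unit_comon (Eps T)"
proof -
  have "inv_arrow C (\<ll> \<one>) \<cdot> Eps T = inv_arrow C (\<ll> \<one>) \<cdot> \<ll> \<one> \<cdot> pr T (Eps T) (Eps T)"
    by (simp only: Eps_pr[OF assms])
  also have "\<dots> = pr T (Eps T) (Eps T)"
    by (simp add: reassoc2[OF LUnit_inv(4)])
  finally show ?thesis
    by (simp add: cmor_def in_hom_iff unit_comon_def) (simp add: pr_def)
qed

end

section \<open>Cocommutative Hopf monoids as groups\<close>

context symmetric_monoidal_category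
begin

lemma cmor_inverse:
  assumes f: "cmor T U f" and g: "arr g" "Dom C g = Ob U" "Cod C g = Ob T"
    and gf: "g \<cdot> f = \<iota> (Ob T)" and fg: "f \<cdot> g = \<iota> (Ob U)" and [simp]: "coc T" "coc U"
  shows "cmor U T g"
proof -
  note [simp] = cmor_simps[OF f] g
  have "Del T \<cdot> g = ((g \<cdot> f) \<otimes> (g \<cdot> f)) \<cdot> Del T \<cdot> g"
    by (simp add: gf)
  also have "\<dots> = (g \<otimes> g) \<cdot> ((f \<otimes> f) \<cdot> Del T) \<cdot> g"
    by (simp add: merge')
  also have "\<dots> = (g \<otimes> g) \<cdot> Del U"
    by (simp add: cmor_Del[OF f, symmetric] fg)
  finally have "Del T \<cdot> g = (g \<otimes> g) \<cdot> Del U" .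
  moreover have "Eps T \<cdot> g = (Eps U \<cdot> f) \<cdot> g"
    by simp
  then have "Eps T \<cdot> g = Eps U"
    by (simp add: fg del: cmor_simps(4)[OF f])
  ultimately show ?thesis
    by (simp add: cmor_def in_hom_iff)
qed

definition comon_of :: "('o, 'a) bimon \<Rightarrow> ('o, 'a) comon" where
  "comon_of H = \<lparr>Ob = Car H, Del = Com H, Eps = Cou H\<rparr>"

definition hopf :: "('o, 'a) bimon \<Rightarrow> bool" where
  "hopf H \<longleftrightarrow> is_hopf_monoid C H \<and> is_cocommutative C H"

definition antip :: "('o, 'a) bimon \<Rightarrow> 'a" where
  "antip H = (SOME S. is_antipode C H S)"

lemma comon_of_simps [simp]: "Ob (comon_of H) = Car H" "Del (comon_of H) = Com H" "Eps (comon_of H) = Cou H"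
  by (simp_all add: comon_of_def)

lemma hopf_coc [simp]: "hopf H \<Longrightarrow> coc (comon_of H)"
  by (simp add: hopf_def is_hopf_monoid_def is_bimonoid_def coc_def is_cocommutative_def)

lemma hopf_simps [simp]:
  assumes "hopf H"
  shows "Car H \<in> Obj C" "arr (Mul H)" "Dom C (Mul H) = Car H \<odot> Car H" "Cod C (Mul H) = Car H"
    "arr (Uni H)" "Dom C (Uni H) = \<one>" "Cod C (Uni H) = Car H"
    "arr (Com H)" "Dom C (Com H) = Car H" "Cod C (Com H) = Car H \<odot> Car H"
    "arr (Cou H)" "Dom C (Cou H) = Car H" "Cod C (Cou H) = \<one>"
    "arr (antip H)" "Dom C (antip H) = Car H" "Cod C (antip H) = Car H"
proof -
  have "is_antipode C H (antip H)"
    unfolding antip_def using assms by (auto simp: hopf_def is_hopf_monoid_def intro: someI_ex)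
  with assms show "Car H \<in> Obj C" "arr (Mul H)" "Dom C (Mul H) = Car H \<odot> Car H" "Cod C (Mul H) = Car H"
    "arr (Uni H)" "Dom C (Uni H) = \<one>" "Cod C (Uni H) = Car H"
    "arr (Com H)" "Dom C (Com H) = Car H" "Cod C (Com H) = Car H \<odot> Car H"
    "arr (Cou H)" "Dom C (Cou H) = Car H" "Cod C (Cou H) = \<one>"
    "arr (antip H)" "Dom C (antip H) = Car H" "Cod C (antip H) = Car H"
    unfolding hopf_def is_hopf_monoid_def is_bimonoid_def is_monoid_def is_comonoid_def is_antipode_def in_hom_iff
    by blast+
qed

lemma hopf_eqs:
  assumes "hopf H"
  shows "Mul H \<cdot> (Mul H \<otimes> \<iota> (Car H)) = Mul H \<cdot> (\<iota> (Car H) \<otimes> Mul H) \<cdot> \<alpha> (Car H) (Car H) (Car H)"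
    "Mul H \<cdot> (Uni H \<otimes> \<iota> (Car H)) = \<ll> (Car H)"
    "Mul H \<cdot> (\<iota> (Car H) \<otimes> Uni H) = \<rr> (Car H)"
    "Mul H \<cdot> (antip H \<otimes> \<iota> (Car H)) \<cdot> Com H = Uni H \<cdot> Cou H"
    "Mul H \<cdot> (\<iota> (Car H) \<otimes> antip H) \<cdot> Com H = Uni H \<cdot> Cou H"
proof -
  have "is_antipode C H (antip H)"
    unfolding antip_def using assms by (auto simp: hopf_def is_hopf_monoid_def intro: someI_ex)
  with assms show "Mul H \<cdot> (Mul H \<otimes> \<iota> (Car H)) = Mul H \<cdot> (\<iota> (Car H) \<otimes> Mul H) \<cdot> \<alpha> (Car H) (Car H) (Car H)"
    "Mul H \<cdot> (Uni H \<otimes> \<iota> (Car H)) = \<ll> (Car H)"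
    "Mul H \<cdot> (\<iota> (Car H) \<otimes> Uni H) = \<rr> (Car H)"
    "Mul H \<cdot> (antip H \<otimes> \<iota> (Car H)) \<cdot> Com H = Uni H \<cdot> Cou H"
    "Mul H \<cdot> (\<iota> (Car H) \<otimes> antip H) \<cdot> Com H = Uni H \<cdot> Cou H"
    unfolding hopf_def is_hopf_monoid_def is_bimonoid_def is_monoid_def is_antipode_def
    by blast+
qed

lemma cmor_Mul: "hopf H \<Longrightarrow> cmor (tns (comon_of H) (comon_of H)) (comon_of H) (Mul H)"
  by (simp add: cmor_def in_hom_iff tns_eqs) (simp add: hopf_def is_hopf_monoid_def is_bimonoid_def)

lemma cmor_Uni:
  assumes [simp]: "hopf H" shows "cmor unit_comon (comon_of H) (Uni H)"
proof -
  have "Com H \<cdot> Uni H \<cdot> \<ll> \<one> = Uni H \<otimes> Uni H" and e: "Cou H \<cdot> Uni H = \<iota> \<one>"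
    using assms by (simp_all only: hopf_def is_hopf_monoid_def is_bimonoid_def)
  then have "(Com H \<cdot> Uni H \<cdot> \<ll> \<one>) \<cdot> inv_arrow C (\<ll> \<one>) = (Uni H \<otimes> Uni H) \<cdot> inv_arrow C (\<ll> \<one>)"
    by (simp only:)
  with e show ?thesis
    by (simp add: cmor_def in_hom_iff unit_comon_def)
qed

text \<open>Not only comonoid morphisms are multiplied here: the antipode is not known to be one until
  \<open>cmor_antip\<close>.\<close>

definition mult :: "('o, 'a) comon \<Rightarrow> ('o, 'a) bimon \<Rightarrow> 'a \<Rightarrow> 'a \<Rightarrow> 'a" where
  "mult T H x y = Mul H \<cdot> pr T x y"

definition unit :: "('o, 'a) comon \<Rightarrow> ('o, 'a) bimon \<Rightarrow> 'a" where
  "unit T H = Uni H \<cdot> Eps T"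

lemma mult_simps [simp]:
  assumes "coc T" "hopf H" "arr x" "arr y" "Dom C x = Ob T" "Dom C y = Ob T" "Cod C x = Car H" "Cod C y = Car H"
  shows "arr (mult T H x y)" "Dom C (mult T H x y) = Ob T" "Cod C (mult T H x y) = Car H"
  using assms by (simp_all add: mult_def)

lemma unit_simps [simp]:
  assumes "coc T" "hopf H"
  shows "arr (unit T H)" "Dom C (unit T H) = Ob T" "Cod C (unit T H) = Car H"
  using assms by (simp_all add: unit_def)

lemma mult_assoc:
  assumes [simp]: "coc T" "hopf H" "arr x" "arr y" "arr z" "Dom C x = Ob T" "Dom C y = Ob T" "Dom C z = Ob T"
    "Cod C x = Car H" "Cod C y = Car H" "Cod C z = Car H"
  shows "mult T H (mult T H x y) z = mult T H x (mult T H y z)"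
proof -
  have "mult T H (mult T H x y) z = (Mul H \<cdot> (Mul H \<otimes> \<iota> (Car H))) \<cdot> pr T (pr T x y) z"
    by (simp add: mult_def TArr_pr)
  also have "\<dots> = mult T H x (mult T H y z)"
    unfolding hopf_eqs(1)[OF assms(2)] by (simp add: mult_def TArr_pr Assoc_pr)
  finally show ?thesis .
qed

lemma unit_mult:
  assumes [simp]: "coc T" "hopf H" "arr x" "Dom C x = Ob T" "Cod C x = Car H"
  shows "mult T H (unit T H) x = x" "mult T H x (unit T H) = x"
proof -
  have "mult T H (unit T H) x = (Mul H \<cdot> (Uni H \<otimes> \<iota> (Car H))) \<cdot> (\<iota> \<one> \<otimes> x) \<cdot> (Eps T \<otimes> \<iota> (Ob T)) \<cdot> Del T"
    by (simp add: mult_def unit_def pr_def merge')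
  also have "\<dots> = x \<cdot> \<ll> (Ob T) \<cdot> (Eps T \<otimes> \<iota> (Ob T)) \<cdot> Del T"
    unfolding hopf_eqs(2)[OF assms(2)] by (simp add: reassoc2[OF LUnit_nat])
  finally show "mult T H (unit T H) x = x"
    by (simp add: coc_eqs)
  have "mult T H x (unit T H) = (Mul H \<cdot> (\<iota> (Car H) \<otimes> Uni H)) \<cdot> (x \<otimes> \<iota> \<one>) \<cdot> (\<iota> (Ob T) \<otimes> Eps T) \<cdot> Del T"
    by (simp add: mult_def unit_def pr_def merge')
  also have "\<dots> = x \<cdot> \<rr> (Ob T) \<cdot> (\<iota> (Ob T) \<otimes> Eps T) \<cdot> Del T"
    unfolding hopf_eqs(3)[OF assms(2)] by (simp add: reassoc2[OF RUnit_nat])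
  finally show "mult T H x (unit T H) = x"
    by (simp add: coc_eqs)
qed

lemma mult_Cmp:
  assumes h: "cmor T U h" and [simp]: "coc T" "coc U" "hopf H" "arr x" "arr y" "Dom C x = Ob U" "Dom C y = Ob U"
    "Cod C x = Car H" "Cod C y = Car H"
  shows "mult U H x y \<cdot> h = mult T H (x \<cdot> h) (y \<cdot> h)"
  using cmor_simps[OF h] by (simp add: mult_def pr_cmor[OF h])

lemma unit_Cmp:
  assumes h: "cmor T U h" and [simp]: "coc T" "coc U" "hopf H"
  shows "unit U H \<cdot> h = unit T H"
  using cmor_simps[OF h] by (simp add: unit_def)

text \<open>The antipode law can be applied to \<open>x\<close> because
  \<open>Com H \<cdot> x = pr T x x\<close>; this is where \<open>x\<close> has to be a comonoid
  morphism.\<close>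

lemma antip_mult:
  assumes [simp]: "coc T" "hopf H" and x: "cmor T (comon_of H) x"
  shows "mult T H (antip H \<cdot> x) x = unit T H" "mult T H x (antip H \<cdot> x) = unit T H"
proof -
  note [simp] = cmor_simps[OF x, simplified]
  have "mult T H (antip H \<cdot> x) x = (Mul H \<cdot> (antip H \<otimes> \<iota> (Car H)) \<cdot> Com H) \<cdot> x"
    using cmor_Del_pr[OF x] by (simp add: mult_def TArr_pr)
  then show "mult T H (antip H \<cdot> x) x = unit T H"
    unfolding hopf_eqs(4)[OF assms(2)] by (simp add: unit_def)
  have "mult T H x (antip H \<cdot> x) = (Mul H \<cdot> (\<iota> (Car H) \<otimes> antip H) \<cdot> Com H) \<cdot> x"
    using cmor_Del_pr[OF x] by (simp add: mult_def TArr_pr)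
  then show "mult T H x (antip H \<cdot> x) = unit T H"
    unfolding hopf_eqs(5)[OF assms(2)] by (simp add: unit_def)
qed

lemma cmor_mult:
  assumes "coc T" "hopf H" "cmor T (comon_of H) x" "cmor T (comon_of H) y"
  shows "cmor T (comon_of H) (mult T H x y)"
  unfolding mult_def using assms by (intro cmor_Cmp[OF cmor_pr cmor_Mul]) simp_all

lemma cmor_unit:
  assumes "coc T" "hopf H"
  shows "cmor T (comon_of H) (unit T H)"
  unfolding unit_def using assms by (intro cmor_Cmp[OF cmor_Eps cmor_Uni]) simp_all

text \<open>In elements this is \<open>(x, y) \<mapsto> (x, n(x, y))\<close>. Only the first factor
  is duplicated, so neither \<open>n\<close> nor the second entry has to be a comonoid
  morphism.\<close>

definition shear :: "('o, 'a) bimon \<Rightarrow> 'a \<Rightarrow> 'a" where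
  "shear H n = (\<iota> (Car H) \<otimes> n) \<cdot> \<alpha> (Car H) (Car H) (Car H) \<cdot> (Com H \<otimes> \<iota> (Car H))"

lemma shear_simps [simp]:
  assumes [simp]: "hopf H" "arr n" "Dom C n = Car H \<odot> Car H" "Cod C n = Car H"
  shows "arr (shear H n)" "Dom C (shear H n) = Car H \<odot> Car H" "Cod C (shear H n) = Car H \<odot> Car H"
  by (simp_all add: shear_def)

text \<open>Successive shears keep the first entry:
  \<open>(x, y) \<mapsto> (x, n(x, y)) \<mapsto> (x, m(x, n(x, y)))\<close>. The auxiliary equation
  \<open>e\<close> is coassociativity for duplicating \<open>x\<close> twice beside a
  spectator.\<close>

lemma shear_shear:
  assumes [simp]: "hopf H" "arr m" "Dom C m = Car H \<odot> Car H" "Cod C m = Car H"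
    "arr n" "Dom C n = Car H \<odot> Car H" "Cod C n = Car H"
  shows "shear H m \<cdot> shear H n = shear H (m \<cdot> shear H n)"
proof -
  let ?H = "Car H" and ?d = "Com H"
  have c: "\<alpha> ?H ?H ?H \<cdot> (?d \<otimes> \<iota> ?H) \<cdot> ?d = (\<iota> ?H \<otimes> ?d) \<cdot> ?d"
    using coc_eqs(1)[of "comon_of H"] by simp
  have "\<alpha> ?H ?H (?H \<odot> ?H) \<cdot> (?d \<otimes> \<iota> (?H \<odot> ?H)) \<cdot> \<alpha> ?H ?H ?H \<cdot> (?d \<otimes> \<iota> ?H)
    = \<alpha> ?H ?H (?H \<odot> ?H) \<cdot> \<alpha> (?H \<odot> ?H) ?H ?H \<cdot> ((?d \<otimes> \<iota> ?H) \<otimes> \<iota> ?H) \<cdot> (?d \<otimes> \<iota> ?H)"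
    by (simp add: reassoc2[OF Assoc_nat])
  also have "\<dots> = (\<iota> ?H \<otimes> \<alpha> ?H ?H ?H) \<cdot> \<alpha> ?H (?H \<odot> ?H) ?H \<cdot> ((\<alpha> ?H ?H ?H \<cdot> (?d \<otimes> \<iota> ?H) \<cdot> ?d) \<otimes> \<iota> ?H)"
    by (simp add: reassoc2[OF pent[symmetric]] split_right)
  also have "\<dots> = (\<iota> ?H \<otimes> \<alpha> ?H ?H ?H) \<cdot> (\<alpha> ?H (?H \<odot> ?H) ?H \<cdot> ((\<iota> ?H \<otimes> ?d) \<otimes> \<iota> ?H)) \<cdot> (?d \<otimes> \<iota> ?H)"
    unfolding c by (simp add: split_right)
  also have "\<dots> = (\<iota> ?H \<otimes> (\<alpha> ?H ?H ?H \<cdot> (?d \<otimes> \<iota> ?H))) \<cdot> \<alpha> ?H ?H ?H \<cdot> (?d \<otimes> \<iota> ?H)"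
    by (simp add: reassoc2[OF Assoc_nat] split_left)
  finally have e: "\<alpha> ?H ?H (?H \<odot> ?H) \<cdot> (?d \<otimes> \<iota> (?H \<odot> ?H)) \<cdot> \<alpha> ?H ?H ?H \<cdot> (?d \<otimes> \<iota> ?H)
    = (\<iota> ?H \<otimes> (\<alpha> ?H ?H ?H \<cdot> (?d \<otimes> \<iota> ?H))) \<cdot> \<alpha> ?H ?H ?H \<cdot> (?d \<otimes> \<iota> ?H)" .
  have i: "(?d \<otimes> \<iota> ?H) \<cdot> (\<iota> ?H \<otimes> n) = ((\<iota> ?H \<otimes> \<iota> ?H) \<otimes> n) \<cdot> (?d \<otimes> \<iota> (?H \<odot> ?H))"
    by (simp add: merge)
  have "shear H m \<cdot> shear H n = (\<iota> ?H \<otimes> m) \<cdot> (\<alpha> ?H ?H ?H \<cdot> ((\<iota> ?H \<otimes> \<iota> ?H) \<otimes> n)) \<cdot> (?d \<otimes> \<iota> (?H \<odot> ?H)) \<cdot>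
      \<alpha> ?H ?H ?H \<cdot> (?d \<otimes> \<iota> ?H)"
    by (simp add: shear_def reassoc2[OF i] del: TArr_Ide')
  also have "\<dots> = (\<iota> ?H \<otimes> m) \<cdot> (\<iota> ?H \<otimes> (\<iota> ?H \<otimes> n)) \<cdot> \<alpha> ?H ?H (?H \<odot> ?H) \<cdot> (?d \<otimes> \<iota> (?H \<odot> ?H)) \<cdot>
      \<alpha> ?H ?H ?H \<cdot> (?d \<otimes> \<iota> ?H)"
    by (simp add: reassoc2[OF Assoc_nat] del: TArr_Ide')
  also have "\<dots> = shear H (m \<cdot> shear H n)"
    unfolding e by (simp add: shear_def split_left)
  finally show ?thesis .
qed

text \<open>In elements, \<open>a(x) (b(x) y) = y\<close> as soon as \<open>a\<close> and
  \<open>b\<close> are convolution inverse in this order. Keeping both arrows variable covers both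
  composites of the multiplication shear with its inverse.\<close>

lemma shear_inverse:
  assumes H [simp]: "hopf H" and [simp]: "arr a" "Dom C a = Car H" "Cod C a = Car H"
    "arr b" "Dom C b = Car H" "Cod C b = Car H"
    and ab: "Mul H \<cdot> (a \<otimes> b) \<cdot> Com H = Uni H \<cdot> Cou H"
  shows "shear H (Mul H \<cdot> (a \<otimes> \<iota> (Car H))) \<cdot> shear H (Mul H \<cdot> (b \<otimes> \<iota> (Car H))) = \<iota> (Car H \<odot> Car H)"
proof -
  let ?H = "Car H" and ?d = "Com H" and ?n = "Mul H \<cdot> (b \<otimes> \<iota> (Car H))"
  have "(Mul H \<cdot> (a \<otimes> \<iota> ?H)) \<cdot> shear H ?n
    = Mul H \<cdot> (\<iota> ?H \<otimes> Mul H) \<cdot> (a \<otimes> (b \<otimes> \<iota> ?H)) \<cdot> \<alpha> ?H ?H ?H \<cdot> (?d \<otimes> \<iota> ?H)"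
    by (simp add: shear_def merge')
  also have "\<dots> = (Mul H \<cdot> (\<iota> ?H \<otimes> Mul H) \<cdot> \<alpha> ?H ?H ?H) \<cdot> ((a \<otimes> b) \<otimes> \<iota> ?H) \<cdot> (?d \<otimes> \<iota> ?H)"
    by (simp add: reassoc2[OF Assoc_nat])
  also have "\<dots> = Mul H \<cdot> ((Mul H \<cdot> (a \<otimes> b) \<cdot> ?d) \<otimes> \<iota> ?H)"
    unfolding hopf_eqs(1)[OF H, symmetric] by (simp add: merge merge')
  also have "\<dots> = (Mul H \<cdot> (Uni H \<otimes> \<iota> ?H)) \<cdot> (Cou H \<otimes> \<iota> ?H)"
    unfolding ab by (simp add: split_right)
  finally have "(Mul H \<cdot> (a \<otimes> \<iota> ?H)) \<cdot> shear H ?n = \<ll> ?H \<cdot> (Cou H \<otimes> \<iota> ?H)"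
    unfolding hopf_eqs(2)[OF H] .
  then have "shear H (Mul H \<cdot> (a \<otimes> \<iota> ?H)) \<cdot> shear H ?n = shear H (\<ll> ?H \<cdot> (Cou H \<otimes> \<iota> ?H))"
    by (simp add: shear_shear)
  also have "\<dots> = (\<iota> ?H \<otimes> \<ll> ?H) \<cdot> (\<iota> ?H \<otimes> (Cou H \<otimes> \<iota> ?H)) \<cdot> \<alpha> ?H ?H ?H \<cdot> (?d \<otimes> \<iota> ?H)"
    by (simp add: shear_def split_left)
  also have "\<dots> = ((\<iota> ?H \<otimes> \<ll> ?H) \<cdot> \<alpha> ?H \<one> ?H) \<cdot> ((\<iota> ?H \<otimes> Cou H) \<otimes> \<iota> ?H) \<cdot> (?d \<otimes> \<iota> ?H)"
    by (simp add: reassoc2[OF Assoc_nat])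
  also have "\<dots> = (\<rr> ?H \<cdot> (\<iota> ?H \<otimes> Cou H) \<cdot> ?d) \<otimes> \<iota> ?H"
    by (simp add: triangle merge merge')
  also have "\<dots> = \<iota> (?H \<odot> ?H)"
    using coc_eqs(3)[of "comon_of H"] by simp
  finally show ?thesis .
qed

text \<open>In generalized elements, \<open>shear H (Mul H)\<close> is the comonoid automorphism
  \<open>(x, y) \<mapsto> (x, xy)\<close>. Its inverse \<open>(x, y) \<mapsto> (x, x\<inverse>y)\<close> is then a comonoid morphism
  too, and the antipode is obtained from it by setting \<open>y = 1\<close>.\<close>

lemma cmor_antip:
  assumes H [simp]: "hopf H"
  shows "cmor (comon_of H) (comon_of H) (antip H)"
proof -
  let ?U = "comon_of H" and ?H = "Car H"
  let ?n = "Mul H \<cdot> (antip H \<otimes> \<iota> ?H)"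
  \<comment> \<open>Elementwise form of a shear; the two copies of the first entry are
    \<open>pr T x x\<close> because \<open>x\<close> is a comonoid morphism.\<close>
  have tr: "shear H m \<cdot> pr T x y = pr T x (m \<cdot> pr T x y)"
    if [simp]: "coc T" and x: "cmor T ?U x" and [simp]: "arr m" "Dom C m = ?H \<odot> ?H" "Cod C m = ?H"
      and [simp]: "arr y" "Dom C y = Ob T" "Cod C y = ?H" for T x y m
    using cmor_simps[OF x, simplified] cmor_Del_pr[OF x]
    by (simp add: shear_def TArr_pr Assoc_pr)
  let ?TT = "tns ?U ?U"
  have [simp]: "arr (proj1 ?U ?U)" "Dom C (proj1 ?U ?U) = ?H \<odot> ?H" "Cod C (proj1 ?U ?U) = ?H"
    "arr (proj2 ?U ?U)" "Dom C (proj2 ?U ?U) = ?H \<odot> ?H" "Cod C (proj2 ?U ?U) = ?H"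
    by simp_all
  have p: "pr ?TT (proj1 ?U ?U) (proj2 ?U ?U) = \<iota> (?H \<odot> ?H)"
    using pr_proj[of ?U ?U] by simp
  have "shear H (Mul H) = shear H (Mul H) \<cdot> pr ?TT (proj1 ?U ?U) (proj2 ?U ?U)"
    by (simp add: p)
  also have "\<dots> = pr ?TT (proj1 ?U ?U) (Mul H)"
    using tr[of ?TT "proj1 ?U ?U" "Mul H" "proj2 ?U ?U"] by (simp add: p cmor_proj1)
  finally have c: "cmor ?TT ?TT (shear H (Mul H))"
    by (simp add: cmor_pr cmor_proj1 cmor_Mul)
  have mn: "shear H (Mul H) \<cdot> shear H ?n = \<iota> (?H \<odot> ?H)"
    using shear_inverse[of H "\<iota> ?H" "antip H"] by (simp add: hopf_eqs)
  have nm: "shear H ?n \<cdot> shear H (Mul H) = \<iota> (?H \<odot> ?H)"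
    using shear_inverse[of H "antip H" "\<iota> ?H"] by (simp add: hopf_eqs)
  have w: "cmor ?TT ?TT (shear H ?n)"
    by (rule cmor_inverse[OF c]) (simp_all add: mn nm)
  have one: "cmor ?U ?U (unit ?U H)"
    by (simp add: cmor_unit)
  have "shear H ?n \<cdot> pr ?U (\<iota> ?H) (unit ?U H) = pr ?U (\<iota> ?H) (mult ?U H (antip H) (unit ?U H))"
    using cmor_Ide[of ?U] by (simp add: tr TArr_pr mult_def)
  then have "antip H = proj2 ?U ?U \<cdot> shear H ?n \<cdot> pr ?U (\<iota> ?H) (unit ?U H)"
    by (simp add: unit_mult proj_pr)
  moreover have "cmor ?U ?U \<dots>"
    using cmor_Ide[of ?U] one by (intro cmor_Cmp[OF cmor_Cmp[OF cmor_pr w] cmor_proj2]) simp_all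
  ultimately show ?thesis
    by simp
qed

text \<open>A Yoneda argument: laws valid for all generalized elements are instantiated at generic
  ones, the projections from tensor powers of \<open>P\<close>, and become equations between arrows.
  Assuming the laws on elements lets a pullback verify them componentwise.\<close>

lemma hopfI:
  fixes P m u s
  defines "H \<equiv> \<lparr>Car = Ob P, Mul = m, Uni = u, Com = Del P, Cou = Eps P\<rparr>"
  assumes P [simp]: "coc P" and m: "cmor (tns P P) P m" and u: "cmor unit_comon P u" and s: "cmor P P s"
    and assoc: "\<And>T x y z. coc T \<Longrightarrow> cmor T P x \<Longrightarrow> cmor T P y \<Longrightarrow> cmor T P z \<Longrightarrow>
      m \<cdot> pr T (m \<cdot> pr T x y) z = m \<cdot> pr T x (m \<cdot> pr T y z)"
    and unit_left: "\<And>T x. coc T \<Longrightarrow> cmor T P x \<Longrightarrow> m \<cdot> pr T (u \<cdot> Eps T) x = x"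
    and unit_right: "\<And>T x. coc T \<Longrightarrow> cmor T P x \<Longrightarrow> m \<cdot> pr T x (u \<cdot> Eps T) = x"
    and inv_left: "\<And>T x. coc T \<Longrightarrow> cmor T P x \<Longrightarrow> m \<cdot> pr T (s \<cdot> x) x = u \<cdot> Eps T"
    and inv_right: "\<And>T x. coc T \<Longrightarrow> cmor T P x \<Longrightarrow> m \<cdot> pr T x (s \<cdot> x) = u \<cdot> Eps T"
  shows "hopf H" "comon_of H = P"
proof -
  let ?P = "Ob P"
  have [simp]: "Car H = ?P" "Mul H = m" "Uni H = u" "Com H = Del P" "Cou H = Eps P"
    by (simp_all add: H_def)
  note [simp] = cmor_simps[OF m, simplified] cmor_simps[OF u, simplified] cmor_simps[OF s]
  show "comon_of H = P"
    by (simp add: comon_of_def)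
  have a: "m \<cdot> (m \<otimes> \<iota> ?P) = m \<cdot> (\<iota> ?P \<otimes> m) \<cdot> \<alpha> ?P ?P ?P"
  proof -
    \<comment> \<open>The generic triple: by surjective pairing its entries \<open>?x\<close>,
      \<open>?y\<close>, \<open>?z\<close> together form the identity of the triple product.\<close>
    let ?T = "tns (tns P P) P"
    let ?p = "proj1 (tns P P) P" and ?z = "proj2 (tns P P) P"
    let ?x = "proj1 P P \<cdot> ?p" and ?y = "proj2 P P \<cdot> ?p"
    have [simp]: "arr ?p" "arr ?z" "Dom C ?p = (?P \<odot> ?P) \<odot> ?P" "Dom C ?z = (?P \<odot> ?P) \<odot> ?P"
      "Cod C ?p = ?P \<odot> ?P" "Cod C ?z = ?P"
      by simp_all
    have p: "cmor ?T (tns P P) ?p"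
      by (simp add: cmor_proj1)
    have xyz: "cmor ?T P ?x" "cmor ?T P ?y" "cmor ?T P ?z"
      by (rule cmor_Cmp[OF p cmor_proj1] cmor_Cmp[OF p cmor_proj2] cmor_proj2; simp)+
    have pe: "pr ?T ?x ?y = ?p"
      using pr_eta[of ?T P P ?p] p by simp
    have id: "pr ?T (pr ?T ?x ?y) ?z = \<iota> ((?P \<odot> ?P) \<odot> ?P)"
      unfolding pe using pr_proj[of "tns P P" P] by simp
    have "m \<cdot> (m \<otimes> \<iota> ?P) = m \<cdot> (m \<otimes> \<iota> ?P) \<cdot> pr ?T (pr ?T ?x ?y) ?z"
      unfolding id by simp
    also have "\<dots> = m \<cdot> pr ?T (m \<cdot> pr ?T ?x ?y) ?z"
      by (simp add: TArr_pr)
    also have "\<dots> = m \<cdot> pr ?T ?x (m \<cdot> pr ?T ?y ?z)"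
      by (rule assoc) (simp_all add: xyz)
    also have "\<dots> = m \<cdot> (\<iota> ?P \<otimes> m) \<cdot> \<alpha> ?P ?P ?P \<cdot> pr ?T (pr ?T ?x ?y) ?z"
      by (simp add: TArr_pr Assoc_pr)
    also have "\<dots> = m \<cdot> (\<iota> ?P \<otimes> m) \<cdot> \<alpha> ?P ?P ?P"
      unfolding id by simp
    finally show ?thesis .
  qed
  have l: "m \<cdot> (u \<otimes> \<iota> ?P) = \<ll> ?P"
  proof -
    let ?T = "tns unit_comon P"
    \<comment> \<open>The counit of \<open>unit_comon\<close> is an identity, so the projection onto
      it is the counit of the product, and \<open>u\<close> after it is the unit element over
      \<open>?T\<close>.\<close>
    have e: "Eps ?T = proj1 unit_comon P"
      using cmor_simps(4)[OF cmor_proj1[of unit_comon P]] by simp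
    have "m \<cdot> (u \<otimes> \<iota> ?P) = m \<cdot> pr ?T (u \<cdot> Eps ?T) (proj2 unit_comon P)"
      by (simp add: e TArr_eq_pr[of unit_comon P u "\<iota> ?P"])
    also have "\<dots> = proj2 unit_comon P"
      by (rule unit_left) (simp_all add: cmor_proj2)
    finally show ?thesis
      by (simp add: proj2_def)
  qed
  have r: "m \<cdot> (\<iota> ?P \<otimes> u) = \<rr> ?P"
  proof -
    let ?T = "tns P unit_comon"
    have e: "Eps ?T = proj2 P unit_comon"
      using cmor_simps(4)[OF cmor_proj2[of P unit_comon]] by simp
    have "m \<cdot> (\<iota> ?P \<otimes> u) = m \<cdot> pr ?T (proj1 P unit_comon) (u \<cdot> Eps ?T)"
      by (simp add: e TArr_eq_pr[of P unit_comon "\<iota> ?P" u])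
    also have "\<dots> = proj1 P unit_comon"
      by (rule unit_right) (simp_all add: cmor_proj1)
    finally show ?thesis
      by (simp add: proj1_def)
  qed
  \<comment> \<open>At the identity, the generic element of \<open>P\<close>, the inverse laws are
    the antipode equations.\<close>
  have S: "is_antipode C H s"
    using inv_left[OF P cmor_Ide[OF P]] inv_right[OF P cmor_Ide[OF P]]
    by (simp add: is_antipode_def in_hom_iff pr_def)
  have "Del P \<cdot> u \<cdot> \<ll> \<one> = (u \<otimes> u) \<cdot> inv_arrow C (\<ll> \<one>) \<cdot> \<ll> \<one>"
    using reassoc2[OF cmor_Del[OF u], of "\<ll> \<one>"] by (simp add: unit_comon_def)
  then have du: "Del P \<cdot> u \<cdot> \<ll> \<one> = u \<otimes> u"
    by simp
  have eu: "Eps P \<cdot> u = \<iota> \<one>"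
    using cmor_simps(4)[OF u] by (simp add: unit_comon_def)
  have em: "Eps P \<cdot> m = \<ll> \<one> \<cdot> (Eps P \<otimes> Eps P)"
    using cmor_simps(4)[OF m] by (simp add: tns_eqs)
  have "is_comonoid C ?P (Del P) (Eps P)"
    using P by (simp add: coc_def)
  then show "hopf H"
    using a l r S du eu em cmor_Del[OF m]
    unfolding hopf_def is_hopf_monoid_def is_bimonoid_def is_monoid_def in_hom_iff is_cocommutative_def
    by (auto simp: tns_eqs)
qed

section \<open>Bimonoid morphisms as homomorphisms of convolution groups\<close>

abbreviation bm :: "('o, 'a) bimon \<Rightarrow> ('o, 'a) bimon \<Rightarrow> 'a \<Rightarrow> bool" where
  "bm \<equiv> bimonoid_morphism C"

lemma bm_iff:
  "bm H K f \<longleftrightarrow> cmor (comon_of H) (comon_of K) f \<and> f \<cdot> Mul H = Mul K \<cdot> (f \<otimes> f) \<and> f \<cdot> Uni H = Uni K"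
  by (auto simp: bimonoid_morphism_def cmor_def)

lemma bm_cmor: "bm H K f \<Longrightarrow> cmor (comon_of H) (comon_of K) f"
  by (simp add: bm_iff)

lemma bm_simps:
  assumes "bm H K f"
  shows "arr f" "Dom C f = Car H" "Cod C f = Car K"
  using cmor_simps[OF bm_cmor[OF assms]] by simp_all

lemma bm_Ide: "hopf H \<Longrightarrow> bm H H (\<iota> (Car H))"
  using cmor_Ide[of "comon_of H"] by (simp add: bm_iff)

lemma bm_Cmp:
  assumes f: "bm H K f" and g: "bm K L g" and [simp]: "hopf H" "hopf K" "hopf L"
  shows "bm H L (g \<cdot> f)"
proof -
  note [simp] = bm_simps[OF f] bm_simps[OF g]
  have e: "f \<cdot> Mul H = Mul K \<cdot> (f \<otimes> f)" "f \<cdot> Uni H = Uni K"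
    "g \<cdot> Mul K = Mul L \<cdot> (g \<otimes> g)" "g \<cdot> Uni K = Uni L"
    using f g by (auto simp: bm_iff)
  show ?thesis
    unfolding bm_iff using cmor_Cmp[OF bm_cmor[OF f] bm_cmor[OF g]]
    by (simp add: e reassoc2[OF e(3)] merge)
qed

lemma bm_inverse:
  assumes f: "bm H K f" and g: "cmor (comon_of K) (comon_of H) g" and gf: "g \<cdot> f = \<iota> (Car H)"
    and fg: "f \<cdot> g = \<iota> (Car K)" and [simp]: "hopf H" "hopf K"
  shows "bm K H g"
proof -
  note [simp] = bm_simps[OF f] cmor_simps(1-3)[OF g, simplified]
  have e: "f \<cdot> Mul H = Mul K \<cdot> (f \<otimes> f)" "f \<cdot> Uni H = Uni K"
    using f by (auto simp: bm_iff)
  have "g \<cdot> Mul K = g \<cdot> (Mul K \<cdot> (f \<otimes> f)) \<cdot> (g \<otimes> g)"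
    by (simp add: merge fg)
  also have "\<dots> = Mul H \<cdot> (g \<otimes> g)"
    unfolding e(1)[symmetric] by (simp add: reassoc2[OF gf])
  finally have "g \<cdot> Mul K = Mul H \<cdot> (g \<otimes> g)" .
  moreover have "g \<cdot> Uni K = Uni H"
    unfolding e(2)[symmetric] by (simp add: reassoc2[OF gf])
  ultimately show ?thesis
    by (simp add: bm_iff g)
qed

lemma bm_mult:
  assumes f: "bm H K f" and [simp]: "coc T" "hopf H" "hopf K" "arr x" "arr y" "Dom C x = Ob T" "Dom C y = Ob T"
    "Cod C x = Car H" "Cod C y = Car H"
  shows "f \<cdot> mult T H x y = mult T K (f \<cdot> x) (f \<cdot> y)"
proof -
  note [simp] = bm_simps[OF f]
  have e: "f \<cdot> Mul H = Mul K \<cdot> (f \<otimes> f)"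
    using f by (auto simp: bm_iff)
  show ?thesis
    by (simp add: mult_def reassoc2[OF e] TArr_pr)
qed

lemma bm_unit:
  assumes f: "bm H K f" and [simp]: "coc T" "hopf H" "hopf K"
  shows "f \<cdot> unit T H = unit T K"
proof -
  note [simp] = bm_simps[OF f]
  have e: "f \<cdot> Uni H = Uni K"
    using f by (auto simp: bm_iff)
  show ?thesis
    by (simp add: unit_def reassoc2[OF e])
qed

lemma cmor_antip_Cmp: "coc T \<Longrightarrow> hopf H \<Longrightarrow> cmor T (comon_of H) x \<Longrightarrow> cmor T (comon_of H) (antip H \<cdot> x)"
  by (rule cmor_Cmp[OF _ cmor_antip]) simp_all

text \<open>Uniqueness of inverses, \<open>a = a (x x^-1)\<close>, computed in the convolution
  monoid of all arrows into \<open>H\<close>; the candidate \<open>a\<close> may therefore be an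
  arbitrary arrow.\<close>

lemma antip_unique:
  assumes [simp]: "coc T" "hopf H" and x: "cmor T (comon_of H) x" and a: "arr a" "Dom C a = Ob T" "Cod C a = Car H"
    and e: "mult T H a x = unit T H"
  shows "a = antip H \<cdot> x"
proof -
  note [simp] = cmor_simps(1-3)[OF x, simplified] a
  have "a = mult T H a (mult T H x (antip H \<cdot> x))"
    by (simp add: antip_mult[OF _ _ x] unit_mult)
  also have "\<dots> = antip H \<cdot> x"
    by (simp add: mult_assoc[symmetric] e unit_mult)
  finally show ?thesis .
qed

lemma bm_antip:
  assumes f: "bm H K f" and x: "cmor T (comon_of H) x" and [simp]: "coc T" "hopf H" "hopf K"
  shows "f \<cdot> antip H \<cdot> x = antip K \<cdot> f \<cdot> x"
proof (rule antip_unique)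
  note [simp] = cmor_simps(1-3)[OF x, simplified] bm_simps[OF f]
  show "cmor T (comon_of K) (f \<cdot> x)"
    by (rule cmor_Cmp[OF x bm_cmor[OF f]]) simp_all
  show "mult T K (f \<cdot> antip H \<cdot> x) (f \<cdot> x) = unit T K"
    by (simp add: bm_mult[OF f, symmetric] antip_mult[OF _ _ x] bm_unit[OF f])
qed (use cmor_simps(1-3)[OF x, simplified] bm_simps[OF f] in simp_all)

text \<open>Recovers an element from its quotient by \<open>x\<close>; the five lemma divides and
  multiplies back in this way.\<close>

lemma mult_antip_cancel:
  assumes [simp]: "coc T" "hopf H" and x: "cmor T (comon_of H) x" and y: "arr y" "Dom C y = Ob T" "Cod C y = Car H"
  shows "mult T H (mult T H y (antip H \<cdot> x)) x = y"
  using cmor_simps(1-3)[OF x, simplified] y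
  by (simp add: mult_assoc antip_mult[OF _ _ x] unit_mult)

end

section \<open>Pullbacks\<close>

locale intersective_monoidal_category =
  symmetric_monoidal_category C for C :: "('o, 'a, 'm) smcat_scheme" (structure) +
  assumes intersections: "has_binary_intersections C"
    and preserved: "tensor_preserves_binary_intersections C"
begin

text \<open>\<open>k\<close> is an equalizer of \<open>u\<close> and \<open>v\<close>, recorded as
  an intersection whose two projections coincide. In this form it passes to
  \<open>\<iota> X \<otimes> k\<close> and \<open>k \<otimes> \<iota> X\<close> by the preservation
  hypothesis, which makes these arrows cancellable as well.\<close>

definition eq_mono :: "'a \<Rightarrow> bool" where
  "eq_mono k \<longleftrightarrow> (\<exists>u v. binary_intersection C u v k k)"

lemma intersection_TArr:
  assumes "binary_intersection C u v k l" "X \<in> Obj C"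
  shows "binary_intersection C (\<iota> X \<otimes> u) (\<iota> X \<otimes> v) (\<iota> X \<otimes> k) (\<iota> X \<otimes> l)"
    "binary_intersection C (u \<otimes> \<iota> X) (v \<otimes> \<iota> X) (k \<otimes> \<iota> X) (l \<otimes> \<iota> X)"
  using preserved assms unfolding tensor_preserves_binary_intersections_def preserves_binary_intersections_def
    tensor_left_def tensor_right_def by auto

lemma eq_mono_TArr:
  assumes "eq_mono k" "X \<in> Obj C"
  shows "eq_mono (\<iota> X \<otimes> k)" "eq_mono (k \<otimes> \<iota> X)"
  using intersection_TArr assms unfolding eq_mono_def by blast+

lemma eq_mono_cancel:
  assumes "eq_mono k" "k \<cdot> h = k \<cdot> h'" "arr h" "arr h'" "Cod C h = Dom C k" "Cod C h' = Dom C k" "Dom C h = Dom C h'"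
  shows "h = h'"
  using assms pullback_unique unfolding eq_mono_def binary_intersection_def by metis

lemma eq_mono_arr: "eq_mono k \<Longrightarrow> arr k"
  unfolding eq_mono_def binary_intersection_def pullback_def by (auto simp: hom_def)

text \<open>Factor \<open>k \<otimes> m\<close> as \<open>\<iota> \<otimes> m\<close> after
  \<open>k \<otimes> \<iota>\<close> and cancel in turn. The assumption concerns whiskerings of
  \<open>m\<close>, so that \<open>m\<close> may itself be a tensor product in
  \<open>eq_mono_cube_cancel\<close>.\<close>

lemma eq_mono_TArr_TArr_cancel:
  assumes k: "eq_mono k" and m: "\<And>X. X \<in> Obj C \<Longrightarrow> eq_mono (\<iota> X \<otimes> m)"
    and m_arr: "arr m" and eq: "(k \<otimes> m) \<cdot> h = (k \<otimes> m) \<cdot> h'"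
    and h: "arr h" "arr h'" "Cod C h = Dom C k \<odot> Dom C m" "Cod C h' = Dom C k \<odot> Dom C m" "Dom C h = Dom C h'"
  shows "h = h'"
proof -
  note [simp] = eq_mono_arr[OF k]
  have "(\<iota> (Cod C k) \<otimes> m) \<cdot> (k \<otimes> \<iota> (Dom C m)) \<cdot> h = (\<iota> (Cod C k) \<otimes> m) \<cdot> (k \<otimes> \<iota> (Dom C m)) \<cdot> h'"
    using eq h m_arr by (simp add: merge')
  then have "(k \<otimes> \<iota> (Dom C m)) \<cdot> h = (k \<otimes> \<iota> (Dom C m)) \<cdot> h'"
    by (rule eq_mono_cancel[OF m, rotated 1]) (use h m_arr in simp_all)
  then show ?thesis
    by (rule eq_mono_cancel[OF eq_mono_TArr(2)[OF k], rotated 1]) (use h m_arr in simp_all)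
qed

lemma eq_mono_square_cancel:
  assumes k: "eq_mono k" and eq: "(k \<otimes> k) \<cdot> h = (k \<otimes> k) \<cdot> h'"
    and h: "arr h" "arr h'" "Cod C h = Dom C k \<odot> Dom C k" "Cod C h' = Dom C k \<odot> Dom C k" "Dom C h = Dom C h'"
  shows "h = h'"
  by (rule eq_mono_TArr_TArr_cancel[OF k eq_mono_TArr(1)[OF k] eq_mono_arr[OF k] eq h])

text \<open>\<open>k \<otimes> (k \<otimes> k)\<close> is
  \<open>\<iota> \<otimes> (\<iota> \<otimes> k)\<close> after
  \<open>k \<otimes> (k \<otimes> \<iota>)\<close>. It serves to test coassociativity on an
  equalizer.\<close>

lemma eq_mono_cube_cancel:
  assumes k: "eq_mono k" and eq: "(k \<otimes> (k \<otimes> k)) \<cdot> h = (k \<otimes> (k \<otimes> k)) \<cdot> h'"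
    and h: "arr h" "arr h'" "Cod C h = Dom C k \<odot> (Dom C k \<odot> Dom C k)"
      "Cod C h' = Dom C k \<odot> (Dom C k \<odot> Dom C k)" "Dom C h = Dom C h'"
  shows "h = h'"
proof -
  note [simp] = eq_mono_arr[OF k]
  let ?m = "\<iota> (Cod C k) \<otimes> k" and ?n = "k \<otimes> \<iota> (Dom C k)"
  have e: "(\<iota> (Cod C k) \<otimes> ?m) \<cdot> (k \<otimes> ?n) \<cdot> h = (\<iota> (Cod C k) \<otimes> ?m) \<cdot> (k \<otimes> ?n) \<cdot> h'"
    using eq h by (simp add: merge merge')
  have m: "eq_mono (\<iota> X \<otimes> ?m)" "eq_mono (\<iota> X \<otimes> ?n)" if "X \<in> Obj C" for X
    by (intro eq_mono_TArr k that Cod_Obj Dom_Obj; simp)+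
  have "(k \<otimes> ?n) \<cdot> h = (k \<otimes> ?n) \<cdot> h'"
    by (rule eq_mono_cancel[OF m(1) e]) (use h in simp_all)
  then show ?thesis
    by (rule eq_mono_TArr_TArr_cancel[OF k m(2), rotated 2]) (use h in simp_all)
qed

text \<open>The equalizer of \<open>a\<close> and \<open>b\<close> is the intersection of their graphs, which are
  monomorphisms with the common retraction \<^const>\<open>proj1\<close>. The retraction is also what makes
  the comultiplication restrict to the intersection.\<close>

lemma cmor_equalizer:
  assumes W [simp]: "coc W" and B [simp]: "coc B" and a: "cmor W B a" and b: "cmor W B b"
  obtains P k where "coc P" "cmor P W k" "a \<cdot> k = b \<cdot> k"
    "\<And>h h'. arr h \<Longrightarrow> arr h' \<Longrightarrow> Cod C h = Ob P \<Longrightarrow> Cod C h' = Ob P \<Longrightarrow> Dom C h = Dom C h' \<Longrightarrow>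
      k \<cdot> h = k \<cdot> h' \<Longrightarrow> h = h'"
    "\<And>T h. coc T \<Longrightarrow> cmor T W h \<Longrightarrow> a \<cdot> h = b \<cdot> h \<Longrightarrow> \<exists>h'. cmor T P h' \<and> k \<cdot> h' = h"
proof -
  note [simp] = cmor_simps[OF a] cmor_simps[OF b]
  let ?u = "pr W (\<iota> (Ob W)) a" and ?v = "pr W (\<iota> (Ob W)) b" and ?r = "proj1 W B"
  have u: "cmor W (tns W B) ?u" and v: "cmor W (tns W B) ?v"
    by (simp_all add: cmor_pr cmor_Ide a b)
  have ru: "?r \<cdot> ?u = \<iota> (Ob W)" and rv: "?r \<cdot> ?v = \<iota> (Ob W)"
    by (simp_all add: proj_pr)
  have "monic C ?u" "monic C ?v"
    by (rule section_monic[of _ ?r]; simp add: ru rv)+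
  then obtain k l where "binary_intersection C ?u ?v k l"
    using intersections unfolding has_binary_intersections_def by fastforce
  moreover from this have k: "arr k" "Cod C k = Ob W" and l: "arr l" "Cod C l = Ob W" and ukl: "?u \<cdot> k = ?v \<cdot> l"
    by (auto simp: binary_intersection_def pullback_def hom_def)
  moreover have "k = l"
  proof -
    have "?r \<cdot> ?u \<cdot> k = ?r \<cdot> ?v \<cdot> l"
      by (simp add: ukl)
    with k l show ?thesis
      by (simp add: reassoc2[OF ru] reassoc2[OF rv])
  qed
  ultimately have bi: "binary_intersection C ?u ?v k k" and uk: "?u \<cdot> k = ?v \<cdot> k"
    by auto
  then have m: "eq_mono k"
    by (auto simp: eq_mono_def)
  let ?E = "Dom C k"
  note [simp] = k
  \<comment> \<open>The graphs are comonoid morphisms. Comultiplying the equal arrows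
    \<open>?u \<cdot> k\<close> and \<open>?v \<cdot> k\<close> and retracting one of the two copies
    shows that the graphs agree on the other copy in \<open>Del W \<cdot> k\<close>.\<close>
  have uuk: "pr W ?u ?u \<cdot> k = pr W ?v ?v \<cdot> k"
  proof -
    have "Del (tns W B) \<cdot> ?u \<cdot> k = Del (tns W B) \<cdot> ?v \<cdot> k"
      by (simp add: uk)
    then show ?thesis
      by (simp add: reassoc2[OF cmor_Del_pr[OF u]] reassoc2[OF cmor_Del_pr[OF v]])
  qed
  have "(?r \<otimes> \<iota> (Ob W \<odot> Ob B)) \<cdot> pr W ?u ?u \<cdot> k = (?r \<otimes> \<iota> (Ob W \<odot> Ob B)) \<cdot> pr W ?v ?v \<cdot> k"
    by (simp add: uuk)
  then have uk1: "(\<iota> (Ob W) \<otimes> ?u) \<cdot> Del W \<cdot> k = (\<iota> (Ob W) \<otimes> ?v) \<cdot> Del W \<cdot> k"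
    by (simp add: reassoc2[OF TArr_pr] ru rv) (simp add: pr_def)
  have "(\<iota> (Ob W \<odot> Ob B) \<otimes> ?r) \<cdot> pr W ?u ?u \<cdot> k = (\<iota> (Ob W \<odot> Ob B) \<otimes> ?r) \<cdot> pr W ?v ?v \<cdot> k"
    by (simp add: uuk)
  then have uk2: "(?u \<otimes> \<iota> (Ob W)) \<cdot> Del W \<cdot> k = (?v \<otimes> \<iota> (Ob W)) \<cdot> Del W \<cdot> k"
    by (simp add: reassoc2[OF TArr_pr] ru rv) (simp add: pr_def)
  have pb: "pullback C (\<iota> X \<otimes> ?u) (\<iota> X \<otimes> ?v) (\<iota> X \<otimes> k) (\<iota> X \<otimes> k)"
    "pullback C (?u \<otimes> \<iota> X) (?v \<otimes> \<iota> X) (k \<otimes> \<iota> X) (k \<otimes> \<iota> X)" if "X \<in> Obj C" for X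
    using intersection_TArr[OF bi that] by (auto simp: binary_intersection_def)
  \<comment> \<open>\<open>Del W \<cdot> k\<close> is lifted one tensor factor at a time:
    \<open>x\<close> has its second factor in \<open>?E\<close>, and \<open>d\<close> below has
    both. Each lift uses that the whiskered square is still a pullback.\<close>
  obtain x where x [simp]: "arr x" "Dom C x = ?E" "Cod C x = Ob W \<odot> ?E"
    and kx: "(\<iota> (Ob W) \<otimes> k) \<cdot> x = Del W \<cdot> k"
    using pullback_factor[OF pb(1), of "Ob W" "Del W \<cdot> k" "Del W \<cdot> k"] uk1 by auto
  \<comment> \<open>For the lift of the first factor the equation is tested after the cancellable
    \<open>\<iota> \<otimes> k\<close>, where \<open>x\<close> turns back into
    \<open>Del W \<cdot> k\<close>.\<close>
  have "(?u \<otimes> \<iota> ?E) \<cdot> x = (?v \<otimes> \<iota> ?E) \<cdot> x"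
  proof (rule eq_mono_cancel[OF eq_mono_TArr(1)[OF m, of "Ob W \<odot> Ob B"]])
    have s: "(\<iota> (Ob W \<odot> Ob B) \<otimes> k) \<cdot> (w \<otimes> \<iota> ?E) \<cdot> x = (w \<otimes> \<iota> (Ob W)) \<cdot> Del W \<cdot> k"
      if "cmor W (tns W B) w" for w
    proof -
      note [simp] = cmor_simps[OF that]
      have "(\<iota> (Ob W \<odot> Ob B) \<otimes> k) \<cdot> (w \<otimes> \<iota> ?E) \<cdot> x = (w \<otimes> \<iota> (Ob W)) \<cdot> (\<iota> (Ob W) \<otimes> k) \<cdot> x"
        by (simp add: merge')
      then show ?thesis
        by (simp add: kx)
    qed
    show "(\<iota> (Ob W \<odot> Ob B) \<otimes> k) \<cdot> (?u \<otimes> \<iota> ?E) \<cdot> x = (\<iota> (Ob W \<odot> Ob B) \<otimes> k) \<cdot> (?v \<otimes> \<iota> ?E) \<cdot> x"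
      unfolding s[OF u] s[OF v] by (rule uk2)
  qed simp_all
  then obtain d where d [simp]: "arr d" "Dom C d = ?E" "Cod C d = ?E \<odot> ?E" and kd: "(k \<otimes> \<iota> ?E) \<cdot> d = x"
    using pullback_factor[OF pb(2), of ?E x x] by auto
  have kkd: "(k \<otimes> k) \<cdot> d = Del W \<cdot> k"
  proof -
    have "(k \<otimes> k) \<cdot> d = (\<iota> (Ob W) \<otimes> k) \<cdot> (k \<otimes> \<iota> ?E) \<cdot> d"
      by (simp add: merge')
    then show ?thesis
      by (simp add: kd kx)
  qed
  define P where "P = \<lparr>Ob = ?E, Del = d, Eps = Eps W \<cdot> k\<rparr>"
  \<comment> \<open>Each law on \<open>?E\<close> is pushed along a tensor power of \<open>k\<close>
    to the same law on \<open>W\<close>, and the power of \<open>k\<close> is then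
    cancelled.\<close>
  have P: "coc P"
    unfolding P_def
  proof (rule cocI)
    show "\<alpha> ?E ?E ?E \<cdot> (d \<otimes> \<iota> ?E) \<cdot> d = (\<iota> ?E \<otimes> d) \<cdot> d"
    proof (rule eq_mono_cube_cancel[OF m])
      have "(k \<otimes> (k \<otimes> k)) \<cdot> \<alpha> ?E ?E ?E \<cdot> (d \<otimes> \<iota> ?E) \<cdot> d
        = \<alpha> (Ob W) (Ob W) (Ob W) \<cdot> ((Del W \<cdot> k) \<otimes> k) \<cdot> d"
        by (simp add: reassoc2[OF Assoc_nat[symmetric]] merge' kkd)
      also have "\<dots> = \<alpha> (Ob W) (Ob W) (Ob W) \<cdot> (Del W \<otimes> \<iota> (Ob W)) \<cdot> (k \<otimes> k) \<cdot> d"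
        by (simp add: merge')
      also have "\<dots> = (\<alpha> (Ob W) (Ob W) (Ob W) \<cdot> (Del W \<otimes> \<iota> (Ob W)) \<cdot> Del W) \<cdot> k"
        by (simp add: kkd)
      also have "\<dots> = (\<iota> (Ob W) \<otimes> Del W) \<cdot> (k \<otimes> k) \<cdot> d"
        unfolding coc_eqs(1)[OF W] by (simp add: kkd)
      also have "\<dots> = (k \<otimes> (Del W \<cdot> k)) \<cdot> d"
        by (simp add: merge')
      also have "\<dots> = (k \<otimes> (k \<otimes> k)) \<cdot> (\<iota> ?E \<otimes> d) \<cdot> d"
        by (simp add: merge' kkd)
      finally show "(k \<otimes> (k \<otimes> k)) \<cdot> \<alpha> ?E ?E ?E \<cdot> (d \<otimes> \<iota> ?E) \<cdot> d = \<dots>" .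
    qed simp_all
    show "\<ll> ?E \<cdot> ((Eps W \<cdot> k) \<otimes> \<iota> ?E) \<cdot> d = \<iota> ?E"
    proof (rule eq_mono_cancel[OF m])
      have "k \<cdot> \<ll> ?E \<cdot> ((Eps W \<cdot> k) \<otimes> \<iota> ?E) \<cdot> d = \<ll> (Ob W) \<cdot> (\<iota> \<one> \<otimes> k) \<cdot> ((Eps W \<cdot> k) \<otimes> \<iota> ?E) \<cdot> d"
        by (simp add: reassoc2[OF LUnit_nat])
      also have "\<dots> = \<ll> (Ob W) \<cdot> (Eps W \<otimes> \<iota> (Ob W)) \<cdot> (k \<otimes> k) \<cdot> d"
        by (simp add: merge')
      also have "\<dots> = (\<ll> (Ob W) \<cdot> (Eps W \<otimes> \<iota> (Ob W)) \<cdot> Del W) \<cdot> k"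
        by (simp add: kkd)
      also have "\<dots> = k \<cdot> \<iota> ?E"
        unfolding coc_eqs(2)[OF W] by simp
      finally show "k \<cdot> \<ll> ?E \<cdot> ((Eps W \<cdot> k) \<otimes> \<iota> ?E) \<cdot> d = \<dots>" .
    qed simp_all
    show "\<sigma> ?E ?E \<cdot> d = d"
    proof (rule eq_mono_square_cancel[OF m])
      have "(k \<otimes> k) \<cdot> \<sigma> ?E ?E \<cdot> d = \<sigma> (Ob W) (Ob W) \<cdot> (k \<otimes> k) \<cdot> d"
        by (simp add: reassoc2[OF Sym_nat])
      then show "(k \<otimes> k) \<cdot> \<sigma> ?E ?E \<cdot> d = (k \<otimes> k) \<cdot> d"
        by (simp add: kkd reassoc2[OF coc_simps(8)])
    qed simp_all
  qed simp_all
  have kP: "cmor P W k"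
    by (simp add: P_def cmor_def in_hom_iff kkd)
  \<comment> \<open>Equal graphs have equal second components. The second projection can be applied
    now because \<open>k\<close> is a comonoid morphism and so passes into the pairing.\<close>
  have "?u \<cdot> k = pr P k (a \<cdot> k)" "?v \<cdot> k = pr P k (b \<cdot> k)"
    using P by (simp_all add: pr_cmor[OF kP])
  then have "pr P k (a \<cdot> k) = pr P k (b \<cdot> k)"
    using uk by simp
  then have "proj2 W B \<cdot> pr P k (a \<cdot> k) = proj2 W B \<cdot> pr P k (b \<cdot> k)"
    by simp
  moreover have "proj2 W B \<cdot> pr P k (c \<cdot> k) = c \<cdot> k" if "cmor W B c" for c
    using P cmor_simps[OF that] cmor_simps[OF kP] by (intro proj_pr) simp_all
  ultimately have ak: "a \<cdot> k = b \<cdot> k"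
    using a b by simp
  show thesis
  proof (rule that[OF P kP ak])
    show "h = h'" if "arr h" "arr h'" "Cod C h = Ob P" "Cod C h' = Ob P" "Dom C h = Dom C h'" "k \<cdot> h = k \<cdot> h'" for h h'
      using eq_mono_cancel[OF m that(6)] that(1-5) by (simp add: P_def)
  next
    fix T h
    assume T [simp]: "coc T" and h: "cmor T W h" and ah: "a \<cdot> h = b \<cdot> h"
    note [simp] = cmor_simps[OF h]
    have "?u \<cdot> h = ?v \<cdot> h"
      by (simp add: pr_cmor[OF h] ah)
    then obtain h' where [simp]: "arr h'" "Dom C h' = Ob T" "Cod C h' = ?E" and kh: "k \<cdot> h' = h"
      using pullback_factor[of ?u ?v k k h h] bi by (auto simp: binary_intersection_def)
    have "d \<cdot> h' = (h' \<otimes> h') \<cdot> Del T"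
    proof (rule eq_mono_square_cancel[OF m])
      show "(k \<otimes> k) \<cdot> d \<cdot> h' = (k \<otimes> k) \<cdot> (h' \<otimes> h') \<cdot> Del T"
        by (simp add: merge' kh reassoc2[OF kkd] cmor_Del[OF h])
    qed simp_all
    then have "cmor T P h'"
      by (simp add: P_def cmor_def in_hom_iff kh)
    with kh show "\<exists>h'. cmor T P h' \<and> k \<cdot> h' = h"
      by blast
  qed
qed

text \<open>The universal property is tested against cocommutative comonoids and their morphisms,
  split into existence and joint monicity. It involves no group structure, so it applies to elements
  over any such \<open>T\<close>.\<close>

definition cpullback :: "('o, 'a) comon \<Rightarrow> ('o, 'a) comon \<Rightarrow> 'a \<Rightarrow> 'a \<Rightarrow> ('o, 'a) comon \<Rightarrow> 'a \<Rightarrow> 'a \<Rightarrow> bool" where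
  "cpullback A E f g P p q \<longleftrightarrow> coc P \<and> cmor P A p \<and> cmor P E q \<and> f \<cdot> p = g \<cdot> q \<and>
     (\<forall>T x y. coc T \<and> cmor T A x \<and> cmor T E y \<and> f \<cdot> x = g \<cdot> y \<longrightarrow>
        (\<exists>z. cmor T P z \<and> p \<cdot> z = x \<and> q \<cdot> z = y)) \<and>
     (\<forall>T z z'. coc T \<and> cmor T P z \<and> cmor T P z' \<and> p \<cdot> z = p \<cdot> z' \<and> q \<cdot> z = q \<cdot> z' \<longrightarrow> z = z')"

text \<open>The construction from a product and an equalizer: \<open>k\<close> equalizes
  \<open>f\<close> and \<open>g\<close> after the two projections, and surjective pairing turns
  joint monicity into cancellation of \<open>k\<close>.\<close>

lemma cpullback_exists:
  assumes [simp]: "coc A" "coc B" "coc E" and f: "cmor A B f" and g: "cmor E B g"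
  shows "\<exists>P p q. cpullback A E f g P p q"
proof -
  note [simp] = cmor_simps[OF f] cmor_simps[OF g]
  let ?p = "proj1 A E" and ?q = "proj2 A E"
  have c: "cmor (tns A E) B (f \<cdot> ?p)" "cmor (tns A E) B (g \<cdot> ?q)"
    by (rule cmor_Cmp[OF cmor_proj1 f] cmor_Cmp[OF cmor_proj2 g]; simp)+
  obtain P k where P [simp]: "coc P" and k: "cmor P (tns A E) k" and fk: "(f \<cdot> ?p) \<cdot> k = (g \<cdot> ?q) \<cdot> k"
    and mono: "\<And>h h'. arr h \<Longrightarrow> arr h' \<Longrightarrow> Cod C h = Ob P \<Longrightarrow> Cod C h' = Ob P \<Longrightarrow> Dom C h = Dom C h' \<Longrightarrow>
      k \<cdot> h = k \<cdot> h' \<Longrightarrow> h = h'"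
    and univ: "\<And>T h. coc T \<Longrightarrow> cmor T (tns A E) h \<Longrightarrow> (f \<cdot> ?p) \<cdot> h = (g \<cdot> ?q) \<cdot> h \<Longrightarrow> \<exists>h'. cmor T P h' \<and> k \<cdot> h' = h"
    by (rule cmor_equalizer[OF coc_tns[OF assms(1,3)] assms(2) c]) (rule that)
  note [simp] = cmor_simps[OF k]
  have "cpullback A E f g P (?p \<cdot> k) (?q \<cdot> k)"
    unfolding cpullback_def
  proof (intro conjI allI impI)
    show "cmor P A (?p \<cdot> k)" "cmor P E (?q \<cdot> k)"
      by (rule cmor_Cmp[OF k cmor_proj1] cmor_Cmp[OF k cmor_proj2]; simp)+
    show "f \<cdot> ?p \<cdot> k = g \<cdot> ?q \<cdot> k"
      using fk by simp
  next
    fix T x y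
    assume "coc T \<and> cmor T A x \<and> cmor T E y \<and> f \<cdot> x = g \<cdot> y"
    then have T [simp]: "coc T" and x: "cmor T A x" and y: "cmor T E y" and xy: "f \<cdot> x = g \<cdot> y"
      by auto
    note [simp] = cmor_simps[OF x] cmor_simps[OF y]
    obtain z where z: "cmor T P z" and kz: "k \<cdot> z = pr T x y"
      using univ[of T "pr T x y"] by (auto simp: cmor_pr x y proj_pr xy)
    with cmor_simps[OF z] show "\<exists>z. cmor T P z \<and> (?p \<cdot> k) \<cdot> z = x \<and> (?q \<cdot> k) \<cdot> z = y"
      by (intro exI[of _ z]) (simp add: kz proj_pr)
  next
    fix T z z'
    assume "coc T \<and> cmor T P z \<and> cmor T P z' \<and> (?p \<cdot> k) \<cdot> z = (?p \<cdot> k) \<cdot> z' \<and> (?q \<cdot> k) \<cdot> z = (?q \<cdot> k) \<cdot> z'"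
    then have T [simp]: "coc T" and z: "cmor T P z" and z': "cmor T P z'"
      and e: "(?p \<cdot> k) \<cdot> z = (?p \<cdot> k) \<cdot> z'" "(?q \<cdot> k) \<cdot> z = (?q \<cdot> k) \<cdot> z'"
      by auto
    note [simp] = cmor_simps[OF z] cmor_simps[OF z']
    have "k \<cdot> z = pr T (?p \<cdot> k \<cdot> z) (?q \<cdot> k \<cdot> z)" "k \<cdot> z' = pr T (?p \<cdot> k \<cdot> z') (?q \<cdot> k \<cdot> z')"
      by (rule pr_eta[symmetric]; simp add: cmor_Cmp[OF _ k] z z')+
    with e have "k \<cdot> z = k \<cdot> z'"
      by simp
    then show "z = z'"
      by (rule mono[rotated 5]) simp_all
  qed simp
  then show ?thesis
    by blast
qed

lemma cpullback_eqI:
  assumes "cpullback A E f g P p q" "coc T" "cmor T P z" "cmor T P z'" "p \<cdot> z = p \<cdot> z'" "q \<cdot> z = q \<cdot> z'"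
  shows "z = z'"
  using assms unfolding cpullback_def by blast

lemma cpullback_ex:
  assumes "cpullback A E f g P p q" "coc T" "cmor T A x" "cmor T E y" "f \<cdot> x = g \<cdot> y"
  obtains z where "cmor T P z" "p \<cdot> z = x" "q \<cdot> z = y"
  using assms unfolding cpullback_def by blast

lemma cpullbackD:
  assumes "cpullback A E f g P p q"
  shows "coc P" "cmor P A p" "cmor P E q" "f \<cdot> p = g \<cdot> q"
  using assms unfolding cpullback_def by blast+

text \<open>Multiplication, unit and inversion are induced from the componentwise ones. As
  \<open>p\<close> and \<open>q\<close> are jointly monic on elements, the group laws need only be
  compared in \<open>A\<close> and in \<open>E\<close>.\<close>

lemma hopf_pullback:
  assumes [simp]: "hopf A" "hopf B" "hopf E" and f: "bm A B f" and g: "bm E B g"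
  obtains H p q where "hopf H" "bm H A p" "bm H E q" "cpullback (comon_of A) (comon_of E) f g (comon_of H) p q"
proof -
  obtain P p q where cp: "cpullback (comon_of A) (comon_of E) f g P p q"
    using cpullback_exists[OF _ _ _ bm_cmor[OF f] bm_cmor[OF g]] by auto
  note P [simp] = cpullbackD(1)[OF cp] and p = cpullbackD(2)[OF cp] and q = cpullbackD(3)[OF cp]
    and pq = cpullbackD(4)[OF cp]
  note [simp] = bm_simps[OF f] bm_simps[OF g] cmor_simps[OF p, simplified] cmor_simps[OF q, simplified]
  have c: "cmor T (comon_of A) (p \<cdot> z)" "cmor T (comon_of E) (q \<cdot> z)" "f \<cdot> p \<cdot> z = g \<cdot> q \<cdot> z"
    if "coc T" "cmor T P z" for T z
    using that cmor_Cmp[OF that(2) p] cmor_Cmp[OF that(2) q] cmor_simps[OF that(2)] reassoc2[OF pq, of z]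
    by simp_all
  let ?T = "tns P P"
  let ?x = "proj1 P P" and ?y = "proj2 P P"
  have xy: "cmor ?T P ?x" "cmor ?T P ?y"
    by (simp_all add: cmor_proj1 cmor_proj2)
  \<comment> \<open>The two generic elements of \<open>P\<close> are multiplied in each component;
    the products agree over \<open>B\<close> because \<open>f\<close> and \<open>g\<close> are
    homomorphisms.\<close>
  obtain m where m: "cmor ?T P m" and pm: "p \<cdot> m = mult ?T A (p \<cdot> ?x) (p \<cdot> ?y)"
    and qm: "q \<cdot> m = mult ?T E (q \<cdot> ?x) (q \<cdot> ?y)"
  proof (rule cpullback_ex[OF cp, of ?T])
    show "f \<cdot> mult ?T A (p \<cdot> ?x) (p \<cdot> ?y) = g \<cdot> mult ?T E (q \<cdot> ?x) (q \<cdot> ?y)"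
      using c(3)[OF _ xy(1)] c(3)[OF _ xy(2)] by (simp add: bm_mult[OF f] bm_mult[OF g])
  qed (use xy in \<open>auto intro!: cmor_mult c\<close>)
  obtain u where u: "cmor unit_comon P u" and pu: "p \<cdot> u = unit unit_comon A" and qu: "q \<cdot> u = unit unit_comon E"
    by (rule cpullback_ex[OF cp, of unit_comon "unit unit_comon A" "unit unit_comon E"])
      (simp_all add: cmor_unit bm_unit[OF f] bm_unit[OF g])
  \<comment> \<open>The lift of the inverses exists because \<open>antip A \<cdot> p\<close> and
    \<open>antip E \<cdot> q\<close> are comonoid morphisms, which rests on
    \<open>cmor_antip\<close>.\<close>
  obtain s where s: "cmor P P s" and ps: "p \<cdot> s = antip A \<cdot> p" and qs: "q \<cdot> s = antip E \<cdot> q"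
    by (rule cpullback_ex[OF cp, of P "antip A \<cdot> p" "antip E \<cdot> q"])
      (simp_all add: cmor_antip_Cmp p q bm_antip[OF f p] bm_antip[OF g q] pq)
  note [simp] = cmor_simps[OF m, simplified] cmor_simps[OF u, simplified] cmor_simps[OF s]
  define H where "H = \<lparr>Car = Ob P, Mul = m, Uni = u, Com = Del P, Cou = Eps P\<rparr>"
  have mc: "cmor T P (m \<cdot> pr T x y)" "p \<cdot> m \<cdot> pr T x y = mult T A (p \<cdot> x) (p \<cdot> y)"
      "q \<cdot> m \<cdot> pr T x y = mult T E (q \<cdot> x) (q \<cdot> y)"
    if [simp]: "coc T" and x: "cmor T P x" and y: "cmor T P y" for T x y
  proof -
    note [simp] = cmor_simps[OF x] cmor_simps[OF y]
    have c: "cmor T ?T (pr T x y)"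
      by (simp add: cmor_pr x y)
    then show "cmor T P (m \<cdot> pr T x y)"
      by (rule cmor_Cmp[OF _ m]) simp_all
    show "p \<cdot> m \<cdot> pr T x y = mult T A (p \<cdot> x) (p \<cdot> y)"
      by (simp add: reassoc2[OF pm] mult_Cmp[OF c] proj_pr)
    show "q \<cdot> m \<cdot> pr T x y = mult T E (q \<cdot> x) (q \<cdot> y)"
      by (simp add: reassoc2[OF qm] mult_Cmp[OF c] proj_pr)
  qed
  have uc: "cmor T P (u \<cdot> Eps T)" "p \<cdot> u \<cdot> Eps T = unit T A" "q \<cdot> u \<cdot> Eps T = unit T E"
    if [simp]: "coc T" for T
  proof -
    show "cmor T P (u \<cdot> Eps T)"
      by (rule cmor_Cmp[OF cmor_Eps u]) simp_all
    show "p \<cdot> u \<cdot> Eps T = unit T A" "q \<cdot> u \<cdot> Eps T = unit T E"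
      by (simp_all add: reassoc2[OF pu] reassoc2[OF qu] unit_Cmp[OF cmor_Eps])
  qed
  have sc: "cmor T P (s \<cdot> x)" "p \<cdot> s \<cdot> x = antip A \<cdot> p \<cdot> x" "q \<cdot> s \<cdot> x = antip E \<cdot> q \<cdot> x"
    if [simp]: "coc T" and x: "cmor T P x" for T x
    using cmor_Cmp[OF x s] cmor_simps[OF x] by (simp_all add: reassoc2[OF ps] reassoc2[OF qs])
  have [simp]: "comon_of H = P"
    by (simp add: H_def comon_of_def)
  have H [simp]: "hopf H"
    unfolding H_def
  proof (rule hopfI[OF P m u s], goal_cases)
    case (1 T x y z)
    note [simp] = cmor_simps(1-3)[OF 1(2)] cmor_simps(1-3)[OF 1(3)] cmor_simps(1-3)[OF 1(4)]
    show ?case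
      by (rule cpullback_eqI[OF cp 1(1)]) (use 1 in \<open>simp_all add: mc mult_assoc\<close>)
  next
    case (2 T x)
    note [simp] = cmor_simps(1-3)[OF 2(2)]
    show ?case
      by (rule cpullback_eqI[OF cp 2(1)]) (use 2 in \<open>simp_all add: mc uc unit_mult\<close>)
  next
    case (3 T x)
    note [simp] = cmor_simps(1-3)[OF 3(2)]
    show ?case
      by (rule cpullback_eqI[OF cp 3(1)]) (use 3 in \<open>simp_all add: mc uc unit_mult\<close>)
  next
    case (4 T x)
    show ?case
      by (rule cpullback_eqI[OF cp 4(1)]) (use 4 in \<open>simp_all add: mc uc sc antip_mult c\<close>)
  next
    case (5 T x)
    show ?case
      by (rule cpullback_eqI[OF cp 5(1)]) (use 5 in \<open>simp_all add: mc uc sc antip_mult c\<close>)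
  qed
  have [simp]: "Car H = Ob P" "Mul H = m" "Uni H = u"
    by (simp_all add: H_def)
  have pb: "bm H A p" "bm H E q"
    using pm qm pu qu by (simp_all add: bm_iff p q mult_def unit_def TArr_eq_pr[of P P])
  show thesis
    by (rule that[OF H pb]) (simp add: cp)
qed

text \<open>Respecting multiplication and unit is an equation between comonoid morphisms into
  \<open>H\<close>, so it may be tested after the homomorphisms \<open>p\<close> and
  \<open>q\<close>. Hence such a pullback of comonoids is also one of Hopf monoids.\<close>

lemma cpullback_bm:
  assumes cp: "cpullback (comon_of A) (comon_of E) f g (comon_of H) p q" and p: "bm H A p" and q: "bm H E q"
    and [simp]: "hopf A" "hopf E" "hopf H" "hopf H'"
    and z: "cmor (comon_of H') (comon_of H) z" and pz: "bm H' A (p \<cdot> z)" and qz: "bm H' E (q \<cdot> z)"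
  shows "bm H' H z"
proof -
  note [simp] = bm_simps[OF p] bm_simps[OF q] cmor_simps(1-3)[OF z, simplified]
  have e: "p \<cdot> Mul H = Mul A \<cdot> (p \<otimes> p)" "p \<cdot> Uni H = Uni A" "q \<cdot> Mul H = Mul E \<cdot> (q \<otimes> q)" "q \<cdot> Uni H = Uni E"
    "p \<cdot> z \<cdot> Mul H' = Mul A \<cdot> ((p \<cdot> z) \<otimes> (p \<cdot> z))" "p \<cdot> z \<cdot> Uni H' = Uni A"
    "q \<cdot> z \<cdot> Mul H' = Mul E \<cdot> ((q \<cdot> z) \<otimes> (q \<cdot> z))" "q \<cdot> z \<cdot> Uni H' = Uni E"
    using p q pz qz by (auto simp: bm_iff)
  have "z \<cdot> Mul H' = Mul H \<cdot> (z \<otimes> z)"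
  proof (rule cpullback_eqI[OF cp])
    show "cmor (tns (comon_of H') (comon_of H')) (comon_of H) (z \<cdot> Mul H')"
      by (rule cmor_Cmp[OF cmor_Mul z]) simp_all
    show "cmor (tns (comon_of H') (comon_of H')) (comon_of H) (Mul H \<cdot> (z \<otimes> z))"
      by (rule cmor_Cmp[OF cmor_TArr[OF _ _ _ _ z z] cmor_Mul]) simp_all
  qed (simp_all add: e reassoc2[OF e(1)] reassoc2[OF e(3)] merge)
  moreover have "z \<cdot> Uni H' = Uni H"
  proof (rule cpullback_eqI[OF cp])
    show "cmor unit_comon (comon_of H) (z \<cdot> Uni H')"
      by (rule cmor_Cmp[OF cmor_Uni z]) simp_all
    show "cmor unit_comon (comon_of H) (Uni H)"
      by (simp add: cmor_Uni)
  qed (simp_all add: e)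
  ultimately show ?thesis
    by (simp add: bm_iff z)
qed

section \<open>Protomodularity\<close>

text \<open>Elements of \<open>E\<close> over the unit of \<open>B\<close> are encoded as pairs
  \<open>(1, e)\<close> in the pullback along \<open>f\<close>, so the isomorphism \<open>l\<close>
  makes \<open>h\<close> bijective on them. Division extends this to all elements: the quotient of
  two elements with equal image lies over the unit, and so does that of an element by the section of
  its image.\<close>

lemma hopf_short_five:
  assumes [simp]: "hopf A" "hopf B" "hopf E" "hopf E'"
    and f: "bm A B f" and p: "bm E B p" and s: "bm B E s" and p': "bm E' B p'" and h: "bm E E' h"
    and ph: "p' \<cdot> h = p" and ps: "p \<cdot> s = \<iota> (Car B)"
    and cp: "cpullback (comon_of A) (comon_of E) f p P p1 q1" and cp': "cpullback (comon_of A) (comon_of E') f p' P' p1' q1'"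
    and l: "cmor P P' l" and l': "cmor P' P l'" and ll': "l' \<cdot> l = \<iota> (Ob P)" "l \<cdot> l' = \<iota> (Ob P')"
    and pl: "p1' \<cdot> l = p1" and ql: "q1' \<cdot> l = h \<cdot> q1"
  obtains g where "bm E' E g" "g \<cdot> h = \<iota> (Car E)" "h \<cdot> g = \<iota> (Car E')"
proof -
  note P [simp] = cpullbackD(1)[OF cp] cpullbackD(1)[OF cp']
  note [simp] = bm_simps[OF f] bm_simps[OF p] bm_simps[OF s] bm_simps[OF p'] bm_simps[OF h]
    cmor_simps(1-3)[OF l] cmor_simps(1-3)[OF l']
    cmor_simps(1-3)[OF cpullbackD(2)[OF cp], simplified] cmor_simps(1-3)[OF cpullbackD(3)[OF cp], simplified]
    cmor_simps(1-3)[OF cpullbackD(2)[OF cp'], simplified] cmor_simps(1-3)[OF cpullbackD(3)[OF cp'], simplified]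
  have inj: "e = e'" if [simp]: "coc T" and e: "cmor T (comon_of E) e" and e': "cmor T (comon_of E) e'"
    and he: "h \<cdot> e = h \<cdot> e'" for T e e'
  proof -
    note [simp] = cmor_simps(1-3)[OF e, simplified] cmor_simps(1-3)[OF e', simplified]
    \<comment> \<open>The quotient \<open>e e'^-1\<close> is sent to the unit by \<open>h\<close>,
      hence also by \<open>p = p' h\<close>.\<close>
    let ?x = "mult T E e (antip E \<cdot> e')"
    have x: "cmor T (comon_of E) ?x"
      by (simp add: cmor_mult cmor_antip_Cmp e e')
    have he': "cmor T (comon_of E') (h \<cdot> e')"
      by (rule cmor_Cmp[OF e' bm_cmor[OF h]]) simp_all
    have hx: "h \<cdot> ?x = unit T E'"
      by (simp add: bm_mult[OF h] bm_antip[OF h e'] he antip_mult[OF _ _ he'])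
    have px: "p \<cdot> ?x = unit T B"
    proof -
      have "p \<cdot> ?x = p' \<cdot> h \<cdot> ?x"
        by (simp add: reassoc2[OF ph])
      then show ?thesis
        by (simp add: hx bm_unit[OF p'])
    qed
    \<comment> \<open>\<open>?x\<close> and the unit, each paired with the unit of \<open>A\<close>,
      give elements \<open>w\<close> and \<open>w'\<close> of \<open>P\<close>. They have the same
      image under \<open>l\<close> because \<open>h\<close> sends \<open>?x\<close> to the
      unit.\<close>
    obtain w where w: "cmor T P w" "p1 \<cdot> w = unit T A" "q1 \<cdot> w = ?x"
      by (rule cpullback_ex[OF cp, of T "unit T A" ?x]) (simp_all add: cmor_unit x px bm_unit[OF f])
    obtain w' where w': "cmor T P w'" "p1 \<cdot> w' = unit T A" "q1 \<cdot> w' = unit T E"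
      by (rule cpullback_ex[OF cp, of T "unit T A" "unit T E"]) (simp_all add: cmor_unit bm_unit[OF f] bm_unit[OF p])
    note [simp] = cmor_simps(1-3)[OF w(1)] cmor_simps(1-3)[OF w'(1)]
    have "l \<cdot> w = l \<cdot> w'"
    proof (rule cpullback_eqI[OF cp'])
      show "cmor T P' (l \<cdot> w)" "cmor T P' (l \<cdot> w')"
        using cmor_Cmp[OF w(1) l] cmor_Cmp[OF w'(1) l] by simp_all
    qed (simp_all add: reassoc2[OF pl] reassoc2[OF ql] w w' hx bm_unit[OF h])
    then have "l' \<cdot> l \<cdot> w = l' \<cdot> l \<cdot> w'"
      by simp
    then have "w = w'"
      by (simp add: reassoc2[OF ll'(1)])
    with w(3) w'(3) have xu: "?x = unit T E"
      by simp
    have "e = mult T E ?x e'"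
      by (rule mult_antip_cancel[symmetric]) (simp_all add: e')
    then show "e = e'"
      unfolding xu by (simp add: unit_mult)
  qed
  \<comment> \<open>Surjectivity is applied to the generic element of \<open>E'\<close>, the
    identity; its preimage under \<open>h\<close> will be the inverse arrow.\<close>
  let ?T = "comon_of E'"
  have id: "cmor ?T ?T (\<iota> (Car E'))"
    using cmor_Ide[of ?T] by simp
  have sp: "cmor ?T (comon_of E) (s \<cdot> p')"
    by (rule cmor_Cmp[OF bm_cmor[OF p'] bm_cmor[OF s]]) simp_all
  have hsp: "cmor ?T ?T (h \<cdot> s \<cdot> p')"
    by (rule cmor_Cmp[OF sp bm_cmor[OF h]]) simp_all
  \<comment> \<open>The divisor \<open>h s p'\<close> has the same image in \<open>B\<close> as the
    generic element, so the quotient lies over the unit and can be transported through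
    \<open>l'\<close>.\<close>
  let ?z = "mult ?T E' (\<iota> (Car E')) (antip E' \<cdot> h \<cdot> s \<cdot> p')"
  have z: "cmor ?T ?T ?z"
    by (simp add: cmor_mult cmor_antip_Cmp id hsp)
  have php: "p' \<cdot> h \<cdot> s \<cdot> p' = p'"
    by (simp add: reassoc2[OF ph] reassoc2[OF ps])
  have pz: "p' \<cdot> ?z = unit ?T B"
    by (simp add: bm_mult[OF p'] bm_antip[OF p' hsp] php antip_mult[OF _ _ bm_cmor[OF p']])
  obtain w where w: "cmor ?T P' w" "q1' \<cdot> w = ?z"
    by (rule cpullback_ex[OF cp', of ?T "unit ?T A" ?z]) (simp_all add: cmor_unit z pz bm_unit[OF f])
  note [simp] = cmor_simps(1-3)[OF w(1), simplified]
  let ?x = "q1 \<cdot> l' \<cdot> w"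
  have x: "cmor ?T (comon_of E) ?x"
    by (rule cmor_Cmp[OF cmor_Cmp[OF w(1) l'] cpullbackD(3)[OF cp]]) simp_all
  have hx: "h \<cdot> ?x = ?z"
    by (simp add: reassoc2[OF ql[symmetric]] reassoc2[OF ll'(2)] w(2))
  \<comment> \<open>\<open>?x\<close> is a preimage of \<open>?z\<close> under \<open>h\<close>;
    multiplying by \<open>s p'\<close> undoes the division, since \<open>h\<close> sends this factor
    to the divisor.\<close>
  define g where "g = mult ?T E ?x (s \<cdot> p')"
  have g: "cmor ?T (comon_of E) g"
    unfolding g_def by (simp add: cmor_mult x sp)
  note [simp] = cmor_simps(1-3)[OF g, simplified]
  have hg: "h \<cdot> g = \<iota> (Car E')"
  proof -
    have "h \<cdot> g = mult ?T E' ?z (h \<cdot> s \<cdot> p')"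
      unfolding g_def hx[symmetric] by (simp add: bm_mult[OF h])
    also have "\<dots> = \<iota> (Car E')"
      by (rule mult_antip_cancel) (simp_all add: hsp)
    finally show ?thesis .
  qed
  \<comment> \<open>Injectivity of \<open>h\<close> on elements turns \<open>h g h = h\<close> into
    the other inverse law.\<close>
  have gh: "g \<cdot> h = \<iota> (Car E)"
  proof (rule inj[of "comon_of E"])
    show "cmor (comon_of E) (comon_of E) (g \<cdot> h)"
      by (rule cmor_Cmp[OF bm_cmor[OF h] g]) simp_all
    show "cmor (comon_of E) (comon_of E) (\<iota> (Car E))"
      using cmor_Ide[of "comon_of E"] by simp
    show "h \<cdot> g \<cdot> h = h \<cdot> \<iota> (Car E)"
      by (simp add: reassoc2[OF hg])
  qed simp
  show thesis
    by (rule that[OF bm_inverse[OF h g gh hg] gh hg]) simp_all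
qed

section \<open>Back to the category of cocommutative Hopf monoids\<close>

abbreviation HC where "HC \<equiv> Hopf_coc C"

lemma HC_simps [simp]:
  "Obj HC = Collect hopf"
  "(H, f, K) \<in> Arr HC \<longleftrightarrow> hopf H \<and> hopf K \<and> bm H K f"
  "Dom HC (H, f, K) = H" "Cod HC (H, f, K) = K" "Ide HC H = (H, \<iota> (Car H), H)"
  "Cmp HC (K', g, L) (H, f, K) = (H, g \<cdot> f, L)"
  by (auto simp: Hopf_coc_def hopf_def)

lemma HC_hom: "F \<in> hom HC H K \<longleftrightarrow> (\<exists>f. F = (H, f, K) \<and> hopf H \<and> hopf K \<and> bm H K f)"
  by (cases F) (auto simp: hom_def)

lemma category_HC: "category HC"
proof
  fix F G J A B D E
  show "Dom HC F \<in> Obj HC" "Cod HC F \<in> Obj HC" if "F \<in> Arr HC"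
    using that by (cases F; simp)+
  show "Ide HC A \<in> hom HC A A" if "A \<in> Obj HC"
    using that by (simp add: HC_hom bm_Ide)
  show "Cmp HC G F \<in> hom HC A D" if "F \<in> hom HC A B" "G \<in> hom HC B D"
    using that by (auto simp: HC_hom bm_Cmp)
  show "Cmp HC F (Ide HC A) = F" "Cmp HC (Ide HC B) F = F" if "F \<in> hom HC A B"
    using that bm_simps by (auto simp: HC_hom)
  show "Cmp HC (Cmp HC J G) F = Cmp HC J (Cmp HC G F)"
    if "F \<in> hom HC A B" "G \<in> hom HC B D" "J \<in> hom HC D E"
    using that by (auto simp: HC_hom bm_simps)
qed

lemma pullback_HC_I:
  assumes [simp]: "hopf A" "hopf B" "hopf E" "hopf H" and f: "bm A B f" and g: "bm E B g"
    and p: "bm H A p" and q: "bm H E q" and cp: "cpullback (comon_of A) (comon_of E) f g (comon_of H) p q"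
  shows "pullback HC (A, f, B) (E, g, B) (H, p, A) (H, q, E)"
  unfolding pullback_def
proof (intro conjI allI ballI impI)
  fix T U V
  assume "U \<in> hom HC T (Dom HC (A, f, B))" "V \<in> hom HC T (Dom HC (E, g, B))"
    and e: "Cmp HC (A, f, B) U = Cmp HC (E, g, B) V"
  then obtain u v where [simp]: "hopf T" and uv: "U = (T, u, A)" "V = (T, v, E)" and u: "bm T A u" and v: "bm T E v"
    by (auto simp: HC_hom)
  with e have fu: "f \<cdot> u = g \<cdot> v"
    by simp
  obtain z where z: "cmor (comon_of T) (comon_of H) z" and pz: "p \<cdot> z = u" "q \<cdot> z = v"
    using cpullback_ex[OF cp _ bm_cmor[OF u] bm_cmor[OF v] fu] by auto
  then have "bm T H z"
    by (intro cpullback_bm[OF cp p q]) (simp_all add: u v)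
  with pz have "(T, z, H) \<in> hom HC T (Dom HC (H, p, A)) \<and> Cmp HC (H, p, A) (T, z, H) = U \<and> Cmp HC (H, q, E) (T, z, H) = V"
    by (simp add: HC_hom uv)
  moreover have "Z = (T, z, H)"
    if Z: "Z \<in> hom HC T (Dom HC (H, p, A)) \<and> Cmp HC (H, p, A) Z = U \<and> Cmp HC (H, q, E) Z = V" for Z
  proof -
    obtain z' where z': "Z = (T, z', H)" "bm T H z'"
      using Z by (auto simp: HC_hom)
    with Z have "p \<cdot> z' = u" "q \<cdot> z' = v"
      by (simp_all add: uv)
    with z' z pz show ?thesis
      using cpullback_eqI[OF cp _ bm_cmor[OF z'(2)] z] by simp
  qed
  ultimately show "\<exists>!Z. Z \<in> hom HC T (Dom HC (H, p, A)) \<and> Cmp HC (H, p, A) Z = U \<and> Cmp HC (H, q, E) Z = V"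
    by blast
qed (use f g p q cpullbackD(4)[OF cp] in \<open>auto simp: HC_hom\<close>)

text \<open>A cleavage may choose any pullback of Hopf monoids, tested only against Hopf monoids,
  whereas the five lemma uses elements over all cocommutative comonoids. Comparison with the
  pullback from \<open>hopf_pullback\<close> extends the universal property.\<close>

lemma pullback_HC_D:
  assumes pb: "pullback HC (A, f, B) (E, g, B) P Q"
  obtains H p q where "P = (H, p, A)" "Q = (H, q, E)" "hopf A" "hopf B" "hopf E" "hopf H" "bm A B f" "bm E B g"
    "bm H A p" "bm H E q" "cpullback (comon_of A) (comon_of E) f g (comon_of H) p q"
proof -
  interpret HC: category HC
    by (rule category_HC)
  note D = HC.pullbackD[OF pb]
  obtain H p q where PQ: "P = (H, p, A)" "Q = (H, q, E)"
    using D by (cases P; cases Q) auto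
  have h [simp]: "hopf A" "hopf B" "hopf E" "hopf H" and b: "bm A B f" "bm E B g" "bm H A p" "bm H E q"
    and e: "f \<cdot> p = g \<cdot> q"
    using D by (auto simp: PQ)
  obtain K p0 q0 where K [simp]: "hopf K" and b0: "bm K A p0" "bm K E q0"
    and cp: "cpullback (comon_of A) (comon_of E) f g (comon_of K) p0 q0"
    by (rule hopf_pullback[OF h(1-3) b(1,2)])
  obtain J where J: "J \<in> Arr HC" "Dom HC J = K" "Cod HC J = H" "Cmp HC P J = (K, p0, A)" "Cmp HC Q J = (K, q0, E)"
    using HC.pullback_factor[OF pb, of "(K, p0, A)" "(K, q0, E)"] b0 cpullbackD(4)[OF cp] by (auto simp: PQ)
  then obtain j where Jj: "J = (K, j, H)" and j: "bm K H j" and pj: "p \<cdot> j = p0" "q \<cdot> j = q0"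
    by (cases J) (auto simp: PQ)
  obtain k where k: "cmor (comon_of H) (comon_of K) k" and pk: "p0 \<cdot> k = p" "q0 \<cdot> k = q"
    using cpullback_ex[OF cp _ bm_cmor[OF b(3)] bm_cmor[OF b(4)] e] by auto
  then have bk: "bm H K k"
    by (intro cpullback_bm[OF cp b0]) (simp_all add: b)
  note [simp] = bm_simps[OF b(1)] bm_simps[OF b(2)] bm_simps[OF b(3)] bm_simps[OF b(4)]
    bm_simps[OF b0(1)] bm_simps[OF b0(2)] bm_simps[OF j] bm_simps[OF bk]
  \<comment> \<open>Both sides induce the same cone on \<open>H\<close>, so uniqueness among Hopf
    monoids applies. Then \<open>j\<close> carries factorizations from \<open>K\<close> to
    \<open>H\<close>, and \<open>k\<close>, with left inverse \<open>j\<close>, carries uniqueness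
    back.\<close>
  have "Cmp HC J (H, k, K) = Ide HC H"
    by (rule HC.pullback_unique[OF pb])
      (use bm_Cmp[OF bk j] bm_Ide[OF h(4)] in \<open>simp_all add: Jj PQ reassoc2[OF pj(1)] reassoc2[OF pj(2)] pk\<close>)
  then have jk: "j \<cdot> k = \<iota> (Car H)"
    by (simp add: Jj)
  have "cpullback (comon_of A) (comon_of E) f g (comon_of H) p q"
    unfolding cpullback_def
  proof (intro conjI allI impI)
    fix T x y
    assume T: "coc T \<and> cmor T (comon_of A) x \<and> cmor T (comon_of E) y \<and> f \<cdot> x = g \<cdot> y"
    then obtain z where z: "cmor T (comon_of K) z" "p0 \<cdot> z = x" "q0 \<cdot> z = y"
      using cpullback_ex[OF cp] by blast
    have "cmor T (comon_of H) (j \<cdot> z)"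
      by (rule cmor_Cmp[OF z(1) bm_cmor[OF j]]) (use T in simp_all)
    then show "\<exists>z. cmor T (comon_of H) z \<and> p \<cdot> z = x \<and> q \<cdot> z = y"
      using z cmor_simps(1-3)[OF z(1)] by (auto simp: reassoc2[OF pj(1)] reassoc2[OF pj(2)] intro!: exI[of _ "j \<cdot> z"])
  next
    fix T z z'
    assume T: "coc T \<and> cmor T (comon_of H) z \<and> cmor T (comon_of H) z' \<and> p \<cdot> z = p \<cdot> z' \<and> q \<cdot> z = q \<cdot> z'"
    then have [simp]: "coc T" and z: "cmor T (comon_of H) z" "cmor T (comon_of H) z'" and pz: "p \<cdot> z = p \<cdot> z'" "q \<cdot> z = q \<cdot> z'"
      by auto
    note [simp] = cmor_simps(1-3)[OF z(1), simplified] cmor_simps(1-3)[OF z(2), simplified]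
    have "k \<cdot> z = k \<cdot> z'"
    proof (rule cpullback_eqI[OF cp])
      show "cmor T (comon_of K) (k \<cdot> z)" "cmor T (comon_of K) (k \<cdot> z')"
        by (rule cmor_Cmp[OF z(1) k] cmor_Cmp[OF z(2) k]; simp)+
    qed (simp_all add: reassoc2[OF pk(1)] reassoc2[OF pk(2)] pz)
    then have "j \<cdot> k \<cdot> z = j \<cdot> k \<cdot> z'"
      by simp
    then show "z = z'"
      by (simp add: reassoc2[OF jk])
  qed (simp_all add: b bm_cmor e)
  then show thesis
    using that PQ h b by blast
qed

lemma HC_pullbacks_of_split_epis: "has_pullbacks_of_split_epis HC"
  unfolding has_pullbacks_of_split_epis_def
proof (intro ballI allI impI)
  fix F G
  assume F: "F \<in> Arr HC" and "split_epi HC G \<and> Cod HC G = Cod HC F"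
  then have G: "G \<in> Arr HC" "Cod HC G = Cod HC F"
    by (auto simp: split_epi_def)
  obtain A f B where Ff: "F = (A, f, B)"
    by (cases F)
  moreover obtain E g where Gg: "G = (E, g, B)"
    using G Ff by (cases G) auto
  ultimately have h: "hopf A" "hopf B" "hopf E" "bm A B f" "bm E B g"
    using F G by auto
  obtain H p q where "hopf H" "bm H A p" "bm H E q" "cpullback (comon_of A) (comon_of E) f g (comon_of H) p q"
    by (rule hopf_pullback[OF h])
  with h have "pullback HC F G (H, p, A) (H, q, E)"
    unfolding Ff Gg by (intro pullback_HC_I)
  then show "\<exists>p q. pullback HC F G p q"
    by blast
qed

text \<open>An isomorphism in the fibre supplies an isomorphism \<open>l\<close> of the chosen
  pullbacks, compatible with their projections; this is the input of
  \<open>hopf_short_five\<close>.\<close>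

lemma HC_reflects_isos:
  assumes cl: "point_cleavage HC \<kappa>" and F: "F \<in> Arr HC"
  shows "reflects_isos (points HC (Cod HC F)) (points HC (Dom HC F)) (inverse_image HC \<kappa> F)"
  unfolding reflects_isos_def
proof (intro ballI impI)
  interpret HC: category HC
    by (rule category_HC)
  fix a
  assume a: "a \<in> Arr (points HC (Cod HC F))"
    and iso: "iso (points HC (Dom HC F)) (FArr (inverse_image HC \<kappa> F) a)"
  obtain A f B where Ff: "F = (A, f, B)"
    by (cases F)
  with F have hA [simp]: "hopf A" "hopf B" and f: "bm A B f"
    by auto
  obtain E p s E' p' s' h where a_eq: "a = (((E, p, B), (B, s, E)), (E, h, E'), ((E', p', B), (B, s', E')))"
    and hE [simp]: "hopf E" "hopf E'" and b: "bm E B p" "bm B E s" "bm E' B p'" "bm B E' s'" "bm E E' h"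
    and ps: "p \<cdot> s = \<iota> (Car B)" and ps': "p' \<cdot> s' = \<iota> (Car B)" and ph: "p' \<cdot> h = p" and hs: "h \<cdot> s = s'"
    using a by (auto simp: points_def Ff hom_def Let_def)
  let ?X = "((E, p, B), (B, s, E))" and ?Y = "((E', p', B), (B, s', E'))"
  obtain P1 Q1 P1' Q1' where k: "\<kappa> F ?X = (P1, Q1)" "\<kappa> F ?Y = (P1', Q1')"
    by (metis surj_pair)
  have X: "?X \<in> Obj (points HC B)" "?Y \<in> Obj (points HC B)"
    using b ps ps' by (auto simp: points_def HC_hom)
  have pb: "pullback HC F (E, p, B) P1 Q1" "pullback HC F (E', p', B) P1' Q1'"
    using cl F X k unfolding point_cleavage_def Ff by fastforce+
  obtain H p1 q1 where P1: "P1 = (H, p1, A)" "Q1 = (H, q1, E)" and [simp]: "hopf H" and b1: "bm H A p1" "bm H E q1"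
    and cp: "cpullback (comon_of A) (comon_of E) f p (comon_of H) p1 q1"
    by (rule pullback_HC_D[OF pb(1)[unfolded Ff]])
  obtain H' p1' q1' where P1': "P1' = (H', p1', A)" "Q1' = (H', q1', E')" and [simp]: "hopf H'" and b1': "bm H' A p1'" "bm H' E' q1'"
    and cp': "cpullback (comon_of A) (comon_of E') f p' (comon_of H') p1' q1'"
    by (rule pullback_HC_D[OF pb(2)[unfolded Ff]])
  note [simp] = bm_simps[OF b(1)] bm_simps[OF b(2)] bm_simps[OF b(3)] bm_simps[OF b(4)] bm_simps[OF b(5)]
    bm_simps[OF b1(1)] bm_simps[OF b1(2)] bm_simps[OF b1'(1)] bm_simps[OF b1'(2)] bm_simps[OF f]
  define L where "L = induced HC P1' Q1' P1 (Cmp HC (E, h, E') Q1)"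
  have u: "P1 \<in> hom HC H (Dom HC F)" "Cmp HC (E, h, E') Q1 \<in> hom HC H (Dom HC (E', p', B))"
    "Cmp HC F P1 = Cmp HC (E', p', B) (Cmp HC (E, h, E') Q1)"
    using bm_Cmp[OF b1(2) b(5)] b1
    by (simp_all add: HC_hom P1 Ff reassoc2[OF ph] cpullbackD(4)[OF cp])
  have "L \<in> hom HC H (Dom HC P1')" "Cmp HC P1' L = P1" "Cmp HC Q1' L = Cmp HC (E, h, E') Q1"
    unfolding L_def by (fact HC.induced_pullback[OF pb(2) u])+
  then obtain l where L: "L = (H, l, H')" and l: "bm H H' l" and pl: "p1' \<cdot> l = p1" and ql: "q1' \<cdot> l = h \<cdot> q1"
    by (auto simp: HC_hom P1 P1')
  have Fa: "FArr (inverse_image HC \<kappa> F) a = (pullback_point HC \<kappa> F ?X, L, pullback_point HC \<kappa> F ?Y)"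
    by (simp add: inverse_image_def a_eq k L_def del: HC_simps)
  have pp: "fst (pullback_point HC \<kappa> F ?X) = P1" "fst (pullback_point HC \<kappa> F ?Y) = P1'"
    by (simp_all add: pullback_point_def k)
  \<comment> \<open>Arrows of points compose through their middle components, so an inverse in the
    fibre contains an inverse of \<open>L\<close>.\<close>
  obtain L' where "L' \<in> hom HC H' H" "Cmp HC L' L = Ide HC H" "Cmp HC L L' = Ide HC H'"
    using iso pp unfolding Fa iso_def inverse_arrows_def points_def Let_def hom_def
    by (auto simp: P1 P1')
  then obtain l' where l': "bm H' H l'" and ll': "l' \<cdot> l = \<iota> (Car H)" "l \<cdot> l' = \<iota> (Car H')"
    by (auto simp: HC_hom L)
  obtain g where g: "bm E' E g" and gh: "g \<cdot> h = \<iota> (Car E)" and hg: "h \<cdot> g = \<iota> (Car E')"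
    by (rule hopf_short_five[OF hA hE f b(1-3,5) ph ps cp cp' bm_cmor[OF l] bm_cmor[OF l'] _ _ pl ql])
      (simp_all add: ll')
  note [simp] = bm_simps[OF g]
  \<comment> \<open>The inverse of the underlying arrow automatically respects projections and
    sections, so it is an arrow of points.\<close>
  have "p \<cdot> g = p'"
    using hg by (simp add: ph[symmetric])
  moreover have "g \<cdot> s' = s"
    by (simp add: hs[symmetric] reassoc2[OF gh])
  ultimately have "inverse_arrows (points HC (Cod HC F)) a (?Y, (E', g, E), ?X)"
    using a X g gh hg by (simp add: inverse_arrows_def hom_def points_def Let_def a_eq Ff)
  then show "iso (points HC (Cod HC F)) a"
    unfolding iso_def by (rule exI)
qed

end

theorem corollary4p3:
  fixes C :: "('o, 'a, 'm) smcat_scheme"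
  assumes "symmetric_monoidal_category C"
    and "has_binary_intersections C"
    and "tensor_preserves_binary_intersections C"
  shows "protomodular (Hopf_coc C)"
proof -
  interpret symmetric_monoidal_category C
    by fact
  interpret intersective_monoidal_category C
    by unfold_locales (fact assms)+
  show ?thesis
    unfolding protomodular_def
    using category_HC HC_pullbacks_of_split_epis HC_reflects_isos by blast
qed

end
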